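(* Let $k$ be a field and let $S = k[x_1,\dots,x_n]$ be a polynomial ring with a (possibly nonstandard) $\mathbb{Z}$-grading such that $\deg(x_i)\in\mathbb{Z}_{>0}$ for every $i$ (and $k$ in degree $0$). Then for every $e\in\mathbb{Z}$ the truncation $S_{\geq e}=\bigoplus_{i\geq e}S_i$ is a nonstandard Koszul $S$-module; that is, $\operatorname{gr}_{\mathfrak m}(S_{\geq e})$ has a linear resolution over the standard graded ring $\operatorname{gr}_{\mathfrak m}(S)$, where $\mathfrak m=\langle x_1,\dots,x_n\rangle$.
   Context: For a graded $S$-module $M$ and $e\in\mathbb{Z}$, the $e$-th truncation is $M_{\geq e}=\bigoplus_{i\geq e}M_i$, a graded $S$-submodule of $M$. For an $S$-module $M$, $\operatorname{gr}_{\mathfrak m}(M)=\bigoplus_{i\geq 0}\mathfrak m^iM/\mathfrak m^{i+1}M$, where the $i$-th summand is placed in degree $i$; it is a graded module over $\operatorname{gr}_{\mathfrak m}(S)=\bigoplus_{i\geq 0}\mathfrak m^i/\mathfrak m^{i+1}$. The ring $\operatorname{gr}_{\mathfrak m}(S)$ is a polynomial ring over $k$ in (the classes of) $x_1,\dots,x_n$, each of degree $1$, regardless of the grading on $S$. Write $R=\operatorname{gr}_{\mathfrak m}(S)$. The graded $R$-module $\operatorname{gr}_{\mathfrak m}(M)$ has a linear resolution over $R$ if it has a graded free resolution $\cdots\to F_1\to F_0\to \operatorname{gr}_{\mathfrak m}(M)\to 0$ (with degree-$0$ maps) in which each $F_i$ is a direct sum of copies of $R(-i)$, i.e. is free with all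 generators in degree $i$. A graded $S$-module $M$ is a nonstandard Koszul module if $\operatorname{gr}_{\mathfrak m}(M)$ has a linear resolution over $\operatorname{gr}_{\mathfrak m}(S)$. *)

theory Defs
  imports
    "HOL-Library.Poly_Mapping"
    "HOL-Algebra.Module"
    "HOL-Algebra.AbelCoset"
    "HOL-Algebra.Ideal_Product"
    "HOL-Algebra.Product_Groups"
begin

section \<open>The weighted polynomial ring\<close>

text \<open>Polynomials are finitely supported maps from exponent vectors to coefficients;
  \<open>mpoly_ring n\<close> is the subring of those in which only the variables
  \<open>0, \<dots>, n - 1\<close> occur.\<close>

type_synonym 'k mpoly = "(nat \<Rightarrow>\<^sub>0 nat) \<Rightarrow>\<^sub>0 'k"

definition mpoly_ring :: "nat \<Rightarrow> 'k::field mpoly ring" where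
  "mpoly_ring n =
    \<lparr>carrier = {p. \<forall>m\<in>Poly_Mapping.keys p. Poly_Mapping.keys m \<subseteq> {..<n}},
     mult = (*), one = 1, zero = 0, add = (+)\<rparr>"

definition mvar :: "nat \<Rightarrow> 'k::field mpoly" where
  "mvar i = Poly_Mapping.single (Poly_Mapping.single i 1) 1"

definition irrelevant_ideal :: "nat \<Rightarrow> 'k::field mpoly set" where
  "irrelevant_ideal n = genideal (mpoly_ring n) (mvar ` {..<n})"

definition wdeg :: "(nat \<Rightarrow> int) \<Rightarrow> (nat \<Rightarrow>\<^sub>0 nat) \<Rightarrow> int" where
  "wdeg w m = (\<Sum>i\<in>Poly_Mapping.keys m. int (Poly_Mapping.lookup m i) * w i)"

definition wgrading :: "nat \<Rightarrow> (nat \<Rightarrow> int) \<Rightarrow> int \<Rightarrow> 'k::field mpoly set" where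
  "wgrading n w d =
    {p \<in> carrier (mpoly_ring n). \<forall>m\<in>Poly_Mapping.keys p. wdeg w m = d}"

section \<open>Graded modules and truncations\<close>

text \<open>In records of type \<open>module\<close> the inherited fields \<open>mult\<close> and \<open>one\<close> carry no meaning.\<close>

definition self_module :: "('a, 'c) ring_scheme \<Rightarrow> ('a, 'a) module" where
  "self_module R =
    \<lparr>carrier = carrier R, mult = mult R, one = one R, zero = zero R, add = add R,
     smult = mult R\<rparr>"

definition graded_module ::
    "('a, 'c) ring_scheme \<Rightarrow> (int \<Rightarrow> 'a set) \<Rightarrow> ('a, 'm, 'd) module_scheme
      \<Rightarrow> (int \<Rightarrow> 'm set) \<Rightarrow> bool" where
  "graded_module R \<G> M \<M> \<longleftrightarrow>
    module R M \<and>
    (\<forall>i. subgroup (\<M> i) (add_monoid M)) \<and>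
    (\<forall>x\<in>carrier M. \<exists>!f. (\<forall>i. f i \<in> \<M> i) \<and> finite {i. f i \<noteq> \<zero>\<^bsub>M\<^esub>} \<and>
        x = finsum M f {i. f i \<noteq> \<zero>\<^bsub>M\<^esub>}) \<and>
    (\<forall>i j. \<forall>a\<in>\<G> i. \<forall>x\<in>\<M> j. a \<odot>\<^bsub>M\<^esub> x \<in> \<M> (i + j))"

definition truncation ::
    "('a, 'm) module \<Rightarrow> (int \<Rightarrow> 'm set) \<Rightarrow> int \<Rightarrow> ('a, 'm) module" where
  "truncation M \<M> e =
    M\<lparr>carrier := {finsum M f I | f I. finite I \<and> I \<subseteq> {e..} \<and> (\<forall>i\<in>I. f i \<in> \<M> i)}\<rparr>"

definition truncation_grading ::
    "('a, 'm) module \<Rightarrow> (int \<Rightarrow> 'm set) \<Rightarrow> int \<Rightarrow> int \<Rightarrow> 'm set" where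
  "truncation_grading M \<M> e i = (if e \<le> i then \<M> i else {\<zero>\<^bsub>M\<^esub>})"

section \<open>Associated graded ring and module of an ideal\<close>

text \<open>\<open>ideal_filt R I M i\<close> is the submodule $I^i M$; the power of \<open>I\<close> is taken in the
  monoid of ideals, so that $I^0 = R$.\<close>

definition ideal_filt ::
    "('a, 'c) ring_scheme \<Rightarrow> 'a set \<Rightarrow> ('a, 'm) module \<Rightarrow> nat \<Rightarrow> 'm set" where
  "ideal_filt R I M i =
    generate (add_monoid M)
      {a \<odot>\<^bsub>M\<^esub> x | a x. a \<in> I [^]\<^bsub>ideals_set R\<^esub> i \<and> x \<in> carrier M}"

definition gr_piece ::
    "('a, 'c) ring_scheme \<Rightarrow> 'a set \<Rightarrow> ('a, 'm) module \<Rightarrow> nat \<Rightarrow> 'm set monoid" where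
  "gr_piece R I M i =
    (M\<lparr>carrier := ideal_filt R I M i\<rparr>) A_Mod (ideal_filt R I M (Suc i))"

text \<open>The product of a class in $I^i/I^{i+1}$ and a class in $I^j M/I^{j+1} M$, a class in
  $I^{i+j} M/I^{i+j+1} M$; compare \<open>rcoset_mult\<close>.\<close>

definition gr_piece_smult ::
    "('a, 'c) ring_scheme \<Rightarrow> 'a set \<Rightarrow> ('a, 'm) module \<Rightarrow> nat \<Rightarrow> nat
      \<Rightarrow> 'a set \<Rightarrow> 'm set \<Rightarrow> 'm set" where
  "gr_piece_smult R I M i j A X =
    (\<Union>a\<in>A. \<Union>x\<in>X. ideal_filt R I M (Suc (i + j)) +>\<^bsub>M\<^esub> (a \<odot>\<^bsub>M\<^esub> x))"

text \<open>An element of the associated graded module is the family of its homogeneous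
  components, each of which is a coset. The component of a product in degree \<open>d\<close> is a sum in the
  quotient group \<open>gr_piece R I M d\<close>, which is written multiplicatively in the library.\<close>

definition gr_smult ::
    "('a, 'c) ring_scheme \<Rightarrow> 'a set \<Rightarrow> ('a, 'm) module
      \<Rightarrow> (nat \<Rightarrow> 'a set) \<Rightarrow> (nat \<Rightarrow> 'm set) \<Rightarrow> nat \<Rightarrow> 'm set" where
  "gr_smult R I M f g =
    (\<lambda>d. finprod (gr_piece R I M d)
           (\<lambda>i. gr_piece_smult R I M i (d - i) (f i) (g (d - i))) {..d})"

definition gr_module ::
    "('a, 'c) ring_scheme \<Rightarrow> 'a set \<Rightarrow> ('a, 'm) module
      \<Rightarrow> (nat \<Rightarrow> 'a set, nat \<Rightarrow> 'm set) module" where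
  "gr_module R I M =
    \<lparr>carrier = carrier (sum_group UNIV (gr_piece R I M)),
     mult = undefined, one = undefined,
     zero = one (sum_group UNIV (gr_piece R I M)),
     add = mult (sum_group UNIV (gr_piece R I M)),
     smult = gr_smult R I M\<rparr>"

definition gr_ring ::
    "('a, 'c) ring_scheme \<Rightarrow> 'a set \<Rightarrow> (nat \<Rightarrow> 'a set) ring" where
  "gr_ring R I =
    \<lparr>carrier = carrier (gr_module R I (self_module R)),
     mult = gr_smult R I (self_module R),
     one = (\<lambda>i. ideal_filt R I (self_module R) (Suc i) +>\<^bsub>R\<^esub> (if i = 0 then \<one>\<^bsub>R\<^esub> else \<zero>\<^bsub>R\<^esub>)),
     zero = zero (gr_module R I (self_module R)),
     add = add (gr_module R I (self_module R))\<rparr>"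

definition gr_grading ::
    "('a, 'c) ring_scheme \<Rightarrow> 'a set \<Rightarrow> ('a, 'm) module \<Rightarrow> int \<Rightarrow> (nat \<Rightarrow> 'm set) set" where
  "gr_grading R I M d =
    {f \<in> carrier (gr_module R I M). \<forall>i. int i \<noteq> d \<longrightarrow> f i = \<one>\<^bsub>gr_piece R I M i\<^esub>}"

section \<open>Linear resolutions\<close>

text \<open>\<open>free_module R B\<close> is the direct sum of copies of \<open>R\<close> indexed by \<open>B\<close>, and
  \<open>free_grading R \<G> B s\<close> makes it the direct sum of copies of $R(-s)$, where
  $R(-s)_d = R_{d-s}$.\<close>

definition free_module :: "('r, 'c) ring_scheme \<Rightarrow> 'b set \<Rightarrow> ('r, 'b \<Rightarrow> 'r) module" where
  "free_module R B =
    \<lparr>carrier = carrier (sum_group B (\<lambda>_. add_monoid R)),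
     mult = undefined, one = undefined,
     zero = one (sum_group B (\<lambda>_. add_monoid R)),
     add = mult (sum_group B (\<lambda>_. add_monoid R)),
     smult = (\<lambda>r f. \<lambda>b\<in>B. r \<otimes>\<^bsub>R\<^esub> f b)\<rparr>"

definition free_grading ::
    "('r, 'c) ring_scheme \<Rightarrow> (int \<Rightarrow> 'r set) \<Rightarrow> 'b set \<Rightarrow> int \<Rightarrow> int \<Rightarrow> ('b \<Rightarrow> 'r) set" where
  "free_grading R \<G> B s d = {f \<in> carrier (free_module R B). \<forall>b\<in>B. f b \<in> \<G> (d - s)}"

definition graded_hom ::
    "('r, 'c) ring_scheme \<Rightarrow> ('r, 'm) module \<Rightarrow> (int \<Rightarrow> 'm set)
      \<Rightarrow> ('r, 'n) module \<Rightarrow> (int \<Rightarrow> 'n set) \<Rightarrow> ('m \<Rightarrow> 'n) set" where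
  "graded_hom R M \<M> N \<N> =
    {h \<in> hom (add_monoid M) (add_monoid N).
      (\<forall>r\<in>carrier R. \<forall>x\<in>carrier M. h (r \<odot>\<^bsub>M\<^esub> x) = r \<odot>\<^bsub>N\<^esub> h x) \<and>
      (\<forall>d. h ` \<M> d \<subseteq> \<N> d)}"

text \<open>The ranks of the free modules are not restricted: in a linear resolution over a nonzero
  nonnegatively graded ring the basis of $F_0$ embeds into $N_0$, and that of $F_{i+1}$ into the finitely supported functions
  from the basis of $F_i$ to $R_1$, so every basis can be indexed by a subset of the
  (infinite) type \<open>('r \<times> 'n) list\<close>.\<close>

definition has_linear_resolution ::
    "('r, 'c) ring_scheme \<Rightarrow> (int \<Rightarrow> 'r set) \<Rightarrow> ('r, 'n) module \<Rightarrow> (int \<Rightarrow> 'n set) \<Rightarrow> bool" where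
  "has_linear_resolution R \<G> N \<N> \<longleftrightarrow>
    (\<exists>(B :: nat \<Rightarrow> ('r \<times> 'n) list set)
      (\<epsilon> :: (('r \<times> 'n) list \<Rightarrow> 'r) \<Rightarrow> 'n)
      (\<delta> :: nat \<Rightarrow> (('r \<times> 'n) list \<Rightarrow> 'r) \<Rightarrow> (('r \<times> 'n) list \<Rightarrow> 'r)).
      let F = (\<lambda>i. free_module R (B i));
          \<F> = (\<lambda>i. free_grading R \<G> (B i) (int i))
      in \<epsilon> \<in> graded_hom R (F 0) (\<F> 0) N \<N> \<and>
         (\<forall>i. \<delta> i \<in> graded_hom R (F (Suc i)) (\<F> (Suc i)) (F i) (\<F> i)) \<and>
         \<epsilon> ` carrier (F 0) = carrier N \<and>
         \<delta> 0 ` carrier (F 1) = a_kernel (F 0) N \<epsilon> \<and>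
         (\<forall>i. \<delta> (Suc i) ` carrier (F (Suc (Suc i))) = a_kernel (F (Suc i)) (F i) (\<delta> i)))"

definition nonstandard_Koszul ::
    "nat \<Rightarrow> (nat \<Rightarrow> int) \<Rightarrow> ('k::field mpoly, 'm) module \<Rightarrow> (int \<Rightarrow> 'm set) \<Rightarrow> bool" where
  "nonstandard_Koszul n w M \<M> \<longleftrightarrow>
    (let S = mpoly_ring n; \<mm> = irrelevant_ideal n
     in graded_module S (wgrading n w) M \<M> \<and>
        has_linear_resolution
          (gr_ring S \<mm>) (gr_grading S \<mm> (self_module S))
          (gr_module S \<mm> M) (gr_grading S \<mm> M))"

end

theory Submission
  imports Defs "HOL-Computational_Algebra.Polynomial"
begin

text \<open>All powers of the irrelevant ideal times the truncation are spanned by monomials, so the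
  associated graded module has a basis of classes of monomials. Order the variables by weight. The
  monomial minimal generators \<open>c\<close> of the truncation, suitably ordered, generate the associated graded
  module with linear quotients: the colon ideal of \<open>c\<close> modulo the earlier generators is generated by
  the variables larger than some variable of \<open>c\<close>. Indeed, if $x_p$ divides \<open>c\<close> and $x_j$ is larger,
  then $x_j c = x_p c'$ where either $c'$ is an earlier generator or the class vanishes; and
  if \<open>b\<close> contains no such variable, then \<open>b\<close> consists of the smallest variables of \<open>b c\<close>, so that no
  monomial of larger degree can be split off from \<open>b c\<close> within the truncation.
  The syzygies of a module with linear quotients by ideals of variables have
  linear quotients by ideals of variables again, and iterating this gives the resolution.\<close>

section \<open>Linear quotients give linear resolutions\<close>

text \<open>The obstacle is that the associated graded module is not an ideal. For a generator c the
  product x_j c may lie in m^2 S_{\<ge>e}, and then its class in degree 1 is zero. Relations with a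
  single entry therefore occur beside the binomial ones, and linear quotients are formulated for
  sets of relations instead of for monomial ideals. What the argument uses of the ring is collected
  in this locale. Two facts carry the induction: a variable outside A is a nonzerodivisor modulo the
  ideal of A (\<open>Id_colon\<close>), and a quadratic element of such an ideal has linear
  cofactors (\<open>Id_repr_quadratic\<close>). So the associated graded ring never has to be
  identified with a polynomial ring. The weights matter only for the first generators and their
  order. From the first syzygies on, the variables are ordered by their numbering: ideals generated
  by variables have linear quotients in every order of the variables.\<close>

locale linear_coefficient_ring = cring R for R (structure) +
  fixes \<G> :: "int \<Rightarrow> 'a set" and n :: nat and x :: "nat \<Rightarrow> 'a" and Id :: "nat set \<Rightarrow> 'a set"
  assumes grade_subgroup: "\<And>d. subgroup (\<G> d) (add_monoid R)"
    and grade_mult: "\<And>i j a b. a \<in> \<G> i \<Longrightarrow> b \<in> \<G> j \<Longrightarrow> a \<otimes> b \<in> \<G> (i + j)"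
    and var_grade: "\<And>j. j < n \<Longrightarrow> x j \<in> \<G> 1"
    and Id_sum: "\<And>A c. A \<subseteq> {..<n} \<Longrightarrow> c \<in> A \<rightarrow> carrier R \<Longrightarrow> (\<Oplus>j\<in>A. c j \<otimes> x j) \<in> Id A"
    and Id_repr: "\<And>A r. A \<subseteq> {..<n} \<Longrightarrow> r \<in> Id A \<Longrightarrow>
          \<exists>c\<in>A \<rightarrow> carrier R. r = (\<Oplus>j\<in>A. c j \<otimes> x j)"
    and Id_repr_quadratic: "\<And>A r. A \<subseteq> {..<n} \<Longrightarrow> r \<in> Id A \<Longrightarrow> r \<in> \<G> 2 \<Longrightarrow>
          \<exists>c\<in>A \<rightarrow> \<G> 1. r = (\<Oplus>j\<in>A. c j \<otimes> x j)"
    and Id_colon: "\<And>A r j. A \<subseteq> {..<n} \<Longrightarrow> j < n \<Longrightarrow> j \<notin> A \<Longrightarrow> r \<in> carrier R \<Longrightarrow>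
          r \<otimes> x j \<in> Id A \<Longrightarrow> r \<in> Id A"
begin

lemma grade_subset: "\<G> d \<subseteq> carrier R"
  using subgroup.subset[OF grade_subgroup] by simp

lemma var_carrier [simp]: "j < n \<Longrightarrow> x j \<in> carrier R"
  using var_grade grade_subset by blast

lemma finsum_in_subgroup:
  assumes "subgroup D (add_monoid R)" "\<And>l. l \<in> A \<Longrightarrow> f l \<in> D"
  shows "(\<Oplus>l\<in>A. f l) \<in> D"
proof (cases "finite A")
  case True
  then show ?thesis
    using assms(2)
  proof (induction A rule: finite_induct)
    case empty
    then show ?case using subgroup.one_closed[OF assms(1)] by simp
  next
    case (insert a A)
    have "f \<in> A \<rightarrow> carrier R" "f a \<in> carrier R"
      using insert.prems subgroup.subset[OF assms(1)] by auto
    then show ?case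
      using insert subgroup.m_closed[OF assms(1)] by simp
  qed
next
  case False
  then show ?thesis using subgroup.one_closed[OF assms(1)]
    by (simp add: finsum_infinite)
qed

section \<open>Coefficient vectors and relations\<close>

definition coeffs :: "nat set \<Rightarrow> (nat \<Rightarrow> 'a) set" where
  "coeffs C = {f. (\<forall>l\<in>C. f l \<in> carrier R) \<and> (\<forall>l. l \<notin> C \<longrightarrow> f l = \<zero>)}"

text \<open>The product of the row vector h with the matrix whose rows are the vectors
  \<open>k l\<close>. The differentials of the resolution have this form.\<close>

definition comb :: "nat set \<Rightarrow> (nat \<Rightarrow> nat \<Rightarrow> 'a) \<Rightarrow> (nat \<Rightarrow> 'a) \<Rightarrow> nat \<Rightarrow> 'a" where
  "comb C k h m = (\<Oplus>l\<in>C. h l \<otimes> k l m)"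

text \<open>\<open>Z\<close> is the set of relations among generators indexed by the finite set \<open>C\<close>, and the
  generators have linear quotients: the coefficients of the last generator occurring in a relation
  range over the ideal of the variables \<open>J i\<close>, and each such variable is realised by a relation
  with linear entries.\<close>

definition linear_relations :: "nat set \<Rightarrow> (nat \<Rightarrow> nat set) \<Rightarrow> (nat \<Rightarrow> 'a) set \<Rightarrow> bool" where
  "linear_relations C J Z \<longleftrightarrow>
    finite C \<and> (\<forall>i\<in>C. J i \<subseteq> {..<n}) \<and> Z \<subseteq> coeffs C \<and> (\<lambda>_. \<zero>) \<in> Z \<and>
    (\<forall>f\<in>Z. \<forall>g\<in>Z. (\<lambda>l. f l \<oplus> g l) \<in> Z) \<and>
    (\<forall>r\<in>carrier R. \<forall>f\<in>Z. (\<lambda>l. r \<otimes> f l) \<in> Z) \<and>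
    (\<forall>f\<in>Z. \<forall>i\<in>C. (\<forall>l>i. f l = \<zero>) \<longrightarrow> f i \<in> Id (J i)) \<and>
    (\<forall>i\<in>C. \<forall>j\<in>J i. \<exists>f\<in>Z. f i = x j \<and> (\<forall>l>i. f l = \<zero>) \<and> (\<forall>l. f l \<in> \<G> 1))"

lemma linear_relationsI:
  assumes "finite C" "\<And>i. i \<in> C \<Longrightarrow> J i \<subseteq> {..<n}" "Z \<subseteq> coeffs C" "(\<lambda>_. \<zero>) \<in> Z"
    and "\<And>f g. f \<in> Z \<Longrightarrow> g \<in> Z \<Longrightarrow> (\<lambda>l. f l \<oplus> g l) \<in> Z"
    and "\<And>r f. r \<in> carrier R \<Longrightarrow> f \<in> Z \<Longrightarrow> (\<lambda>l. r \<otimes> f l) \<in> Z"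
    and "\<And>f i. f \<in> Z \<Longrightarrow> i \<in> C \<Longrightarrow> (\<And>l. l > i \<Longrightarrow> f l = \<zero>) \<Longrightarrow> f i \<in> Id (J i)"
    and "\<And>i j. i \<in> C \<Longrightarrow> j \<in> J i \<Longrightarrow>
           \<exists>f\<in>Z. f i = x j \<and> (\<forall>l>i. f l = \<zero>) \<and> (\<forall>l. f l \<in> \<G> 1)"
  shows "linear_relations C J Z"
  unfolding linear_relations_def using assms by (intro conjI ballI impI) simp_all

lemma coeffsD: "f \<in> coeffs C \<Longrightarrow> f l \<in> carrier R"
  unfolding coeffs_def by (cases "l \<in> C") auto

lemma comb_carrier: "h \<in> coeffs C \<Longrightarrow> (\<And>l. l \<in> C \<Longrightarrow> k l m \<in> carrier R) \<Longrightarrow> comb C k h m \<in> carrier R"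
  unfolding comb_def by (intro finsum_closed) (auto simp: coeffsD)

lemma comb_add:
  assumes "h \<in> coeffs C" "h' \<in> coeffs C" "\<And>l. l \<in> C \<Longrightarrow> k l m \<in> carrier R"
  shows "comb C k (\<lambda>l. h l \<oplus> h' l) m = comb C k h m \<oplus> comb C k h' m"
proof -
  have "comb C k (\<lambda>l. h l \<oplus> h' l) m = (\<Oplus>l\<in>C. h l \<otimes> k l m \<oplus> h' l \<otimes> k l m)"
    unfolding comb_def using assms by (intro finsum_cong') (auto simp: coeffsD l_distr)
  also have "\<dots> = comb C k h m \<oplus> comb C k h' m"
    unfolding comb_def using assms by (intro finsum_addf) (auto simp: coeffsD)
  finally show ?thesis .
qed

lemma comb_smult:
  assumes "finite C" "h \<in> coeffs C" "r \<in> carrier R" "\<And>l. l \<in> C \<Longrightarrow> k l m \<in> carrier R"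
  shows "comb C k (\<lambda>l. r \<otimes> h l) m = r \<otimes> comb C k h m"
proof -
  have "r \<otimes> comb C k h m = (\<Oplus>l\<in>C. r \<otimes> (h l \<otimes> k l m))"
    unfolding comb_def using assms by (intro finsum_rdistr) (auto simp: coeffsD)
  also have "\<dots> = comb C k (\<lambda>l. r \<otimes> h l) m"
    unfolding comb_def using assms by (intro finsum_cong') (auto simp: coeffsD m_assoc)
  finally show ?thesis by simp
qed

lemma comb_zero: "(\<And>l. l \<in> C \<Longrightarrow> k l m \<in> carrier R) \<Longrightarrow> comb C k (\<lambda>_. \<zero>) m = \<zero>"
  unfolding comb_def by (rule add.finprod_one_eqI) auto

lemma linear_relationsD:
  assumes "linear_relations C J Z"
  shows "finite C" "i \<in> C \<Longrightarrow> J i \<subseteq> {..<n}" "f \<in> Z \<Longrightarrow> f \<in> coeffs C" "(\<lambda>_. \<zero>) \<in> Z"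
    "f \<in> Z \<Longrightarrow> g \<in> Z \<Longrightarrow> (\<lambda>l. f l \<oplus> g l) \<in> Z"
    "r \<in> carrier R \<Longrightarrow> f \<in> Z \<Longrightarrow> (\<lambda>l. r \<otimes> f l) \<in> Z"
    "f \<in> Z \<Longrightarrow> i \<in> C \<Longrightarrow> (\<And>l. l > i \<Longrightarrow> f l = \<zero>) \<Longrightarrow> f i \<in> Id (J i)"
    "i \<in> C \<Longrightarrow> j \<in> J i \<Longrightarrow> \<exists>f\<in>Z. f i = x j \<and> (\<forall>l>i. f l = \<zero>) \<and> (\<forall>l. f l \<in> \<G> 1)"
proof -
  note * = assms[unfolded linear_relations_def]
  show "finite C" using * by (elim conjE)
  show "(\<lambda>_. \<zero>) \<in> Z" using * by (elim conjE)
  have "\<forall>i\<in>C. J i \<subseteq> {..<n}" using * by (elim conjE)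
  then show "i \<in> C \<Longrightarrow> J i \<subseteq> {..<n}" by (rule bspec)
  have "Z \<subseteq> coeffs C" using * by (elim conjE)
  then show "f \<in> Z \<Longrightarrow> f \<in> coeffs C" by (rule subsetD)
  have "\<forall>f\<in>Z. \<forall>g\<in>Z. (\<lambda>l. f l \<oplus> g l) \<in> Z" using * by (elim conjE)
  then show "f \<in> Z \<Longrightarrow> g \<in> Z \<Longrightarrow> (\<lambda>l. f l \<oplus> g l) \<in> Z" by simp
  have "\<forall>r\<in>carrier R. \<forall>f\<in>Z. (\<lambda>l. r \<otimes> f l) \<in> Z" using * by (elim conjE)
  then show "r \<in> carrier R \<Longrightarrow> f \<in> Z \<Longrightarrow> (\<lambda>l. r \<otimes> f l) \<in> Z" by simp
  have "\<forall>f\<in>Z. \<forall>i\<in>C. (\<forall>l>i. f l = \<zero>) \<longrightarrow> f i \<in> Id (J i)" using * by (elim conjE)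
  then show "f \<in> Z \<Longrightarrow> i \<in> C \<Longrightarrow> (\<And>l. l > i \<Longrightarrow> f l = \<zero>) \<Longrightarrow> f i \<in> Id (J i)" by simp
  have "\<forall>i\<in>C. \<forall>j\<in>J i. \<exists>f\<in>Z. f i = x j \<and> (\<forall>l>i. f l = \<zero>) \<and> (\<forall>l. f l \<in> \<G> 1)"
    using * by (elim conjE)
  then show "i \<in> C \<Longrightarrow> j \<in> J i \<Longrightarrow> \<exists>f\<in>Z. f i = x j \<and> (\<forall>l>i. f l = \<zero>) \<and> (\<forall>l. f l \<in> \<G> 1)"
    by simp
qed

lemma comb_in_relations:
  assumes Z: "linear_relations C J Z" and "finite B" "\<And>l. l \<in> B \<Longrightarrow> k l \<in> Z"
    and "\<And>l. l \<in> B \<Longrightarrow> c l \<in> carrier R"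
  shows "comb B k c \<in> Z"
  using assms(2-4)
proof (induction B rule: finite_induct)
  case empty
  then show ?case using linear_relationsD(4)[OF Z] by (simp add: comb_def)
next
  case (insert a B)
  have car: "k l m \<in> carrier R" if "l \<in> insert a B" for l m
    using coeffsD[OF linear_relationsD(3)[OF Z insert.prems(1)[OF that]]] .
  have "comb (insert a B) k c = (\<lambda>m. (c a \<otimes> k a m) \<oplus> comb B k c m)"
    unfolding comb_def
    using insert.hyps insert.prems car by (intro ext finsum_insert) auto
  moreover have "(\<lambda>m. (c a \<otimes> k a m) \<oplus> comb B k c m) \<in> Z"
    using insert.IH insert.prems by (intro linear_relationsD(5,6)[OF Z]) auto
  ultimately show ?case by simp
qed

text \<open>The syzygy module of a module with linear quotients again has linear quotients; its generators
  are indexed by the pairs \<open>(i, j)\<close> with \<open>j \<in> J i\<close>, encoded lexicographically as \<open>i * n + j\<close>.\<close>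

definition syz_index :: "nat set \<Rightarrow> (nat \<Rightarrow> nat set) \<Rightarrow> nat set" where
  "syz_index C J = {l. l div n \<in> C \<and> l mod n \<in> J (l div n)}"

text \<open>For a fixed leading position i the generators (i, j) behave like the variables x_j. If
  j' < j, the Koszul relation of x_j' and x_j has the coefficient x_j' at the later generator (i,
  j).\<close>

definition syz_vars :: "(nat \<Rightarrow> nat set) \<Rightarrow> nat \<Rightarrow> nat set" where
  "syz_vars J l = J (l div n) \<inter> {..<l mod n}"

definition syz_generators ::
    "nat set \<Rightarrow> (nat \<Rightarrow> nat set) \<Rightarrow> (nat \<Rightarrow> 'a) set \<Rightarrow> (nat \<Rightarrow> nat \<Rightarrow> 'a) \<Rightarrow> bool" where
  "syz_generators C J Z k \<longleftrightarrow>
    (\<forall>l\<in>syz_index C J. k l \<in> Z \<and> k l (l div n) = x (l mod n) \<and>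
       (\<forall>m>l div n. k l m = \<zero>) \<and> (\<forall>m. k l m \<in> \<G> 1))"

section \<open>Syzygies of generators with linear quotients\<close>

context
  fixes C J Z k
  assumes lin: "linear_relations C J Z" and gen: "syz_generators C J Z k"
begin

lemmas fin_C = linear_relationsD(1)[OF lin] and J_sub = linear_relationsD(2)[OF lin]
  and Z_coeffs = linear_relationsD(3)[OF lin] and Z_add = linear_relationsD(5)[OF lin]
  and Z_smult = linear_relationsD(6)[OF lin] and Z_lead = linear_relationsD(7)[OF lin]

lemma var_J: "i \<in> C \<Longrightarrow> j \<in> J i \<Longrightarrow> x j \<in> carrier R"
  by (rule var_carrier) (use J_sub in blast)

lemma index_lt: "l \<in> syz_index C J \<Longrightarrow> l mod n < n"
  using J_sub unfolding syz_index_def by blast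

lemma index_pair: "i \<in> C \<Longrightarrow> j \<in> J i \<Longrightarrow> i * n + j \<in> syz_index C J \<and> (i * n + j) div n = i \<and> (i * n + j) mod n = j"
  using J_sub[of i] unfolding syz_index_def by auto

lemma finite_index: "finite (syz_index C J)"
proof (rule finite_subset)
  show "syz_index C J \<subseteq> (\<lambda>(i, j). i * n + j) ` (C \<times> {..<n})"
  proof
    fix l assume "l \<in> syz_index C J"
    moreover have "l = (\<lambda>(i, j). i * n + j) (l div n, l mod n)" by simp
    ultimately show "l \<in> (\<lambda>(i, j). i * n + j) ` (C \<times> {..<n})"
      using index_lt unfolding syz_index_def by blast
  qed
qed (use fin_C in auto)

lemma gen_Z: "l \<in> syz_index C J \<Longrightarrow> k l \<in> Z"
  and gen_lead: "l \<in> syz_index C J \<Longrightarrow> k l (l div n) = x (l mod n)"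
  and gen_beyond: "l \<in> syz_index C J \<Longrightarrow> l div n < m \<Longrightarrow> k l m = \<zero>"
  and gen_grade: "l \<in> syz_index C J \<Longrightarrow> k l m \<in> \<G> 1"
  using gen unfolding syz_generators_def by blast+

lemma gen_carrier [simp]: "l \<in> syz_index C J \<Longrightarrow> k l m \<in> carrier R"
  using gen_grade grade_subset by blast

lemma index_fibre:
  assumes "t \<in> C"
  shows "{l \<in> syz_index C J. l div n = t} = (\<lambda>j. t * n + j) ` J t"
proof -
  have "l \<in> (\<lambda>j. t * n + j) ` J t" if "l \<in> syz_index C J" "l div n = t" for l
  proof -
    have "l = t * n + l mod n" using that by (metis div_mult_mod_eq)
    then show ?thesis using that unfolding syz_index_def by blast
  qed
  then show ?thesis using index_pair[OF assms] by auto
qed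

text \<open>At entry t, the generators with leading position t are the variables of
  \<open>J t\<close> themselves, so there a combination of them is an element written in terms of
  these variables.\<close>

lemma finsum_fibre:
  assumes "t \<in> C" "c \<in> J t \<rightarrow> carrier R"
  shows "(\<Oplus>l\<in>{l \<in> syz_index C J. l div n = t}. c (l mod n) \<otimes> k l t) = (\<Oplus>j\<in>J t. c j \<otimes> x j)"
proof -
  have inj: "inj_on (\<lambda>j. t * n + j) (J t)" by (auto simp: inj_on_def)
  have c: "c (l mod n) \<in> carrier R" if "l \<in> syz_index C J" "l div n = t" for l
    using that assms(2) unfolding syz_index_def by auto
  have eq: "c ((t * n + j) mod n) \<otimes> k (t * n + j) t = c j \<otimes> x j" if "j \<in> J t" for j
    using index_pair[OF assms(1) that] gen_lead[of "t * n + j"] by auto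
  have "(\<Oplus>l\<in>{l \<in> syz_index C J. l div n = t}. c (l mod n) \<otimes> k l t)
      = (\<Oplus>j\<in>J t. c ((t * n + j) mod n) \<otimes> k (t * n + j) t)"
    unfolding index_fibre[OF assms(1)]
    by (rule finsum_reindex[OF _ inj]) (use c index_fibre[OF assms(1), symmetric] in auto)
  also have "\<dots> = (\<Oplus>j\<in>J t. c j \<otimes> x j)"
    using assms eq var_J[OF assms(1)] by (intro finsum_cong') auto
  finally show ?thesis .
qed

text \<open>Gaussian elimination from the last entry downwards: the entry at t lies in the ideal of
  \<open>J t\<close> and is cancelled by generators with leading position t. The subgroups allow two
  uses: with D = D' = R it shows that the generators span, and with degrees 1 and 2 it keeps the
  coefficients linear. The bound on the support of h is what later protects a leading
  coefficient.\<close>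

lemma relation_generation:
  assumes D: "subgroup D (add_monoid R)" and D': "subgroup D' (add_monoid R)"
    and mult: "\<And>a b. a \<in> D \<Longrightarrow> b \<in> \<G> 1 \<Longrightarrow> a \<otimes> b \<in> D'"
    and repr: "\<And>A r. A \<subseteq> {..<n} \<Longrightarrow> r \<in> Id A \<Longrightarrow> r \<in> D' \<Longrightarrow> \<exists>c\<in>A \<rightarrow> D. r = (\<Oplus>j\<in>A. c j \<otimes> x j)"
    and f: "f \<in> Z" "\<And>l. l \<ge> t \<Longrightarrow> f l = \<zero>" "\<And>l. f l \<in> D'"
  shows "\<exists>h\<in>coeffs (syz_index C J). (\<forall>l. h l \<in> D) \<and> (\<forall>l. t \<le> l div n \<longrightarrow> h l = \<zero>) \<and>
           f = comb (syz_index C J) k h"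
  using f
proof (induction t arbitrary: f)
  case 0
  have "comb (syz_index C J) k (\<lambda>_. \<zero>) = f"
    using 0(2) comb_zero gen_carrier by auto
  then show ?case
    using subgroup.one_closed[OF D] by (intro bexI[of _ "\<lambda>_. \<zero>"]) (auto simp: coeffs_def)
next
  case (Suc t)
  show ?case
  proof (cases "t \<in> C")
    case False
    then have "f t = \<zero>" using Z_coeffs[OF Suc.prems(1)] unfolding coeffs_def by simp
    then have "f l = \<zero>" if "l \<ge> t" for l
      using Suc.prems(2)[of l] that by (cases "l = t") auto
    from Suc.IH[OF Suc.prems(1) this Suc.prems(3)] show ?thesis by (auto elim!: bexI[rotated])
  next
    case True
    have DR: "D \<subseteq> carrier R" using subgroup.subset[OF D] by simp
    let ?C' = "syz_index C J"
    have "f t \<in> Id (J t)"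
      using Suc.prems(2) by (intro Z_lead[OF Suc.prems(1) True]) simp
    from repr[OF J_sub[OF True] this Suc.prems(3)]
    obtain c where c: "c \<in> J t \<rightarrow> D" "f t = (\<Oplus>j\<in>J t. c j \<otimes> x j)" by blast
    define B where "B = {l \<in> ?C'. l div n = t}"
    have finB: "finite B" and BC: "B \<subseteq> ?C'" unfolding B_def using finite_index by auto
    define cc where "cc = (\<lambda>l. c (l mod n))"
    have cc: "cc l \<in> D" if "l \<in> B" for l
      using c that unfolding B_def cc_def syz_index_def by auto
    have ccR: "cc l \<in> carrier R" if "l \<in> B" for l using cc[OF that] DR by blast
    have kR: "k l m \<in> carrier R" if "l \<in> B" for l m using that BC by auto
    have gZ: "comb B k cc \<in> Z"
      using comb_in_relations[OF lin finB] gen_Z BC ccR by blast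
    have gt: "comb B k cc t = f t"
      using finsum_fibre[OF True, of c] c DR unfolding comb_def B_def cc_def by auto
    have gbeyond: "comb B k cc m = \<zero>" if "m > t" for m
      unfolding comb_def
      by (rule add.finprod_one_eqI) (use gen_beyond that ccR in \<open>auto simp: B_def\<close>)
    have gD: "comb B k cc m \<in> D'" for m
      unfolding comb_def by (rule finsum_in_subgroup[OF D']) (use mult cc gen_grade BC in auto)
    have gR: "comb B k cc m \<in> carrier R" for m
      using coeffsD[OF Z_coeffs[OF gZ]] .
    have fR: "f m \<in> carrier R" for m
      using coeffsD[OF Z_coeffs[OF Suc.prems(1)]] .
    define f' where "f' = (\<lambda>m. f m \<ominus> comb B k cc m)"
    \<comment> \<open>\<open>Z\<close> is closed under sums and multiples, so the difference is
      formed with the factor -1.\<close>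
    have "(\<lambda>m. f m \<oplus> (\<ominus> \<one>) \<otimes> comb B k cc m) \<in> Z"
      by (rule Z_add[OF Suc.prems(1) Z_smult[OF _ gZ]]) simp
    moreover have "(\<lambda>m. f m \<oplus> (\<ominus> \<one>) \<otimes> comb B k cc m) = f'"
      unfolding f'_def using gR fR by (auto simp: a_minus_def l_minus)
    ultimately have "f' \<in> Z" by simp
    moreover have "f' l = \<zero>" if "l \<ge> t" for l
      using Suc.prems(2)[of l] that gt gbeyond fR unfolding f'_def a_minus_def
      by (cases "l = t") (auto simp: r_neg)
    moreover have "f' l \<in> D'" for l
      using subgroup.m_closed[OF D' Suc.prems(3) subgroup.m_inv_closed[OF D' gD]]
      unfolding f'_def a_minus_def a_inv_def by simp
    ultimately obtain h where h: "h \<in> coeffs ?C'" "\<And>l. h l \<in> D" "\<And>l. t \<le> l div n \<Longrightarrow> h l = \<zero>"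
        "f' = comb ?C' k h"
      using Suc.IH[of f'] by blast
    \<comment> \<open>By the induction hypothesis h vanishes on \<open>B\<close>, so the two
      coefficient vectors have disjoint supports and can be merged.\<close>
    define h' where "h' = (\<lambda>l. if l \<in> B then cc l else h l)"
    have h'co: "h' \<in> coeffs ?C'"
      using h(1) ccR BC unfolding h'_def coeffs_def by auto
    have "comb ?C' k h' m = f m" for m
    proof -
      have split: "(\<Oplus>l\<in>?C'. u l) = (\<Oplus>l\<in>B. u l) \<oplus> (\<Oplus>l\<in>?C' - B. u l)"
        if "u \<in> ?C' \<rightarrow> carrier R" for u
      proof -
        have "?C' = B \<union> (?C' - B)" using BC by auto
        then show ?thesis
          using that finsum_Un_disjoint[of B "?C' - B" u] finB finite_index BC by auto
      qed
      have hc: "h l \<in> carrier R" for l using coeffsD[OF h(1)] .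
      have "(\<Oplus>l\<in>B. h l \<otimes> k l m) = \<zero>"
        by (rule add.finprod_one_eqI) (use h(3) kR in \<open>auto simp: B_def\<close>)
      then have a: "(\<Oplus>l\<in>?C' - B. h l \<otimes> k l m) = comb ?C' k h m"
        unfolding comb_def using split[of "\<lambda>l. h l \<otimes> k l m"] hc by auto
      have "comb ?C' k h' m = (\<Oplus>l\<in>B. h' l \<otimes> k l m) \<oplus> (\<Oplus>l\<in>?C' - B. h' l \<otimes> k l m)"
        unfolding comb_def using coeffsD[OF h'co] by (intro split) auto
      also have "(\<Oplus>l\<in>B. h' l \<otimes> k l m) = comb B k cc m"
        unfolding comb_def h'_def using ccR kR by (intro finsum_cong') auto
      also have "(\<Oplus>l\<in>?C' - B. h' l \<otimes> k l m) = (\<Oplus>l\<in>?C' - B. h l \<otimes> k l m)"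
        unfolding h'_def using hc by (intro finsum_cong') auto
      also have "\<dots> = f' m" using a h(4) by simp
      finally show ?thesis
        unfolding f'_def using gR fR by (simp add: a_minus_def add.m_lcomm r_neg)
    qed
    moreover have "\<forall>l. h' l \<in> D" using h(2) cc unfolding h'_def by auto
    moreover have "\<forall>l. Suc t \<le> l div n \<longrightarrow> h' l = \<zero>"
      using h(3) unfolding h'_def B_def by auto
    ultimately show ?thesis using h'co by (intro bexI[of _ h']) auto
  qed
qed

lemma relations_eq_image: "Z = comb (syz_index C J) k ` coeffs (syz_index C J)"
proof
  show "Z \<subseteq> comb (syz_index C J) k ` coeffs (syz_index C J)"
  proof
    fix f assume f: "f \<in> Z"
    \<comment> \<open>The inserted 0 makes the maximum exist even if C is empty. All entries of f
      from this position on vanish.\<close>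
    let ?t = "Suc (Max (insert 0 C))"
    have gen_all: "\<exists>h\<in>coeffs (syz_index C J). (\<forall>l. h l \<in> carrier R) \<and>
        (\<forall>l. ?t \<le> l div n \<longrightarrow> h l = \<zero>) \<and> f = comb (syz_index C J) k h"
      if "\<And>l. l \<ge> ?t \<Longrightarrow> f l = \<zero>"
    proof (rule relation_generation)
      show "subgroup (carrier R) (add_monoid R)" "subgroup (carrier R) (add_monoid R)"
        using add.subgroup_self by simp_all
      show "a \<otimes> b \<in> carrier R" if "a \<in> carrier R" "b \<in> \<G> 1" for a b
        using that grade_subset by blast
    qed (use that f Id_repr coeffsD[OF Z_coeffs[OF f]] in auto)
    have beyond: "f l = \<zero>" if "l \<ge> ?t" for l
    proof -
      have "l \<notin> C" using that fin_C Max_ge[of "insert 0 C" l]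
        by (metis finite_insert insertI2 not_less_eq_eq)
      then show ?thesis using Z_coeffs[OF f] unfolding coeffs_def by auto
    qed
    then show "f \<in> comb (syz_index C J) k ` coeffs (syz_index C J)"
      using gen_all[OF beyond] by blast
  qed
  show "comb (syz_index C J) k ` coeffs (syz_index C J) \<subseteq> Z"
    using comb_in_relations[OF lin finite_index gen_Z] coeffsD by auto
qed

text \<open>Let l encode (i, j) and read the syzygy at entry i. Generators with smaller leading
  position are zero there, and those with larger leading position come after l and have coefficient
  zero. What remains says that h l times x_j lies in the ideal of the smaller variables of
  \<open>J i\<close>, and x_j is a nonzerodivisor modulo that ideal.\<close>

lemma syz_lead:
  assumes h: "h \<in> coeffs (syz_index C J)" "comb (syz_index C J) k h = (\<lambda>_. \<zero>)"
    and l: "l \<in> syz_index C J" "\<And>l'. l' > l \<Longrightarrow> h l' = \<zero>"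
  shows "h l \<in> Id (syz_vars J l)"
proof -
  let ?C' = "syz_index C J"
  define i where "i = l div n"
  define j where "j = l mod n"
  have ij: "i \<in> C" "j \<in> J i" "l = i * n + j" "j < n"
    using l index_lt[OF l(1)] unfolding syz_index_def i_def j_def by auto
  have hR: "h m \<in> carrier R" for m using coeffsD[OF h(1)] .
  define B where "B = {m \<in> ?C'. m div n = i}"
  define c where "c = (\<lambda>j'. h (i * n + j'))"
  have mod_eq: "i * n + m mod n = m" if "m \<in> B" for m
    using that unfolding B_def by (metis (mono_tags) div_mult_mod_eq mem_Collect_eq)
  have "(\<Oplus>m\<in>?C'. h m \<otimes> k m i) = (\<Oplus>m\<in>B. h m \<otimes> k m i)"
  proof (rule add.finprod_mono_neutral_cong_right)
    show "h m \<otimes> k m i = \<zero>" if m: "m \<in> ?C' - B" for m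
      proof (cases "m div n < i")
        case True
        then show ?thesis using gen_beyond[of m i] m hR by simp
      next
        case False
        then have "m div n > i" using m unfolding B_def by auto
        then have "m > l" unfolding i_def by (metis div_le_mono not_le)
        then show ?thesis using l(2) m by simp
      qed
  qed (use finite_index hR in \<open>auto simp: B_def\<close>)
  also have "\<dots> = (\<Oplus>m\<in>B. c (m mod n) \<otimes> k m i)"
    using mod_eq hR unfolding c_def by (intro finsum_cong') (auto simp: B_def)
  also have "\<dots> = (\<Oplus>j'\<in>J i. c j' \<otimes> x j')"
    unfolding B_def using finsum_fibre[OF ij(1), of c] hR unfolding c_def by auto
  also have "\<dots> = (\<Oplus>j'\<in>insert j (J i \<inter> {..<j}). c j' \<otimes> x j')"
  proof (rule add.finprod_mono_neutral_cong_right)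
    show "c j' \<otimes> x j' = \<zero>" if "j' \<in> J i - insert j (J i \<inter> {..<j})" for j'
      using that l(2) ij J_sub[OF ij(1)] unfolding c_def by auto
  qed (use ij J_sub[OF ij(1)] hR finite_subset[OF J_sub[OF ij(1)]] in \<open>auto simp: c_def\<close>)
  also have "\<dots> = c j \<otimes> x j \<oplus> (\<Oplus>j'\<in>J i \<inter> {..<j}. c j' \<otimes> x j')"
    using J_sub[OF ij(1)] hR ij by (intro finsum_insert) (auto simp: c_def)
  finally have eq: "c j \<otimes> x j \<oplus> (\<Oplus>j'\<in>J i \<inter> {..<j}. c j' \<otimes> x j') = \<zero>"
    using fun_cong[OF h(2), of i] unfolding comb_def by simp
  have cR: "c j' \<in> carrier R" for j' using hR unfolding c_def .
  have xR: "x j' \<in> carrier R" if "j' \<in> J i \<inter> {..<j}" for j' using that J_sub[OF ij(1)] by auto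
  have sR: "(\<Oplus>j'\<in>J i \<inter> {..<j}. c j' \<otimes> x j') \<in> carrier R"
    using cR xR by (intro finsum_closed) auto
  have "c j \<otimes> x j = \<ominus> (\<Oplus>j'\<in>J i \<inter> {..<j}. c j' \<otimes> x j')"
    using eq sR cR ij(4) by (simp add: minus_equality)
  also have "\<dots> = (\<ominus> \<one>) \<otimes> (\<Oplus>j'\<in>J i \<inter> {..<j}. c j' \<otimes> x j')"
    using sR by (simp add: l_minus)
  also have "\<dots> = (\<Oplus>j'\<in>J i \<inter> {..<j}. (\<ominus> \<one>) \<otimes> (c j' \<otimes> x j'))"
    using cR xR by (intro finsum_rdistr) auto
  also have "\<dots> = (\<Oplus>j'\<in>J i \<inter> {..<j}. (\<ominus> \<one> \<otimes> c j') \<otimes> x j')"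
    using cR xR by (intro finsum_cong') (auto simp: m_assoc)
  finally have "c j \<otimes> x j = \<dots>" .
  moreover have "(\<Oplus>j'\<in>J i \<inter> {..<j}. (\<ominus> \<one> \<otimes> c j') \<otimes> x j') \<in> Id (J i \<inter> {..<j})"
    using J_sub[OF ij(1)] cR by (intro Id_sum) auto
  ultimately have "c j \<in> Id (J i \<inter> {..<j})"
    using Id_colon[of "J i \<inter> {..<j}" j "c j"] J_sub[OF ij(1)] ij cR by auto
  then show ?thesis
    unfolding syz_vars_def c_def i_def[symmetric] j_def[symmetric] ij(3)[symmetric] by simp
qed

text \<open>The Koszul combination of the generators (i, j) and (i, j') cancels at entry i but in
  general not at the earlier entries. It becomes a syzygy after a correction by generators with
  smaller leading position.\<close>

lemma syz_linear:
  assumes l: "l \<in> syz_index C J" and j': "j' \<in> syz_vars J l"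
  shows "\<exists>h\<in>coeffs (syz_index C J). comb (syz_index C J) k h = (\<lambda>_. \<zero>) \<and> h l = x j' \<and>
           (\<forall>l'>l. h l' = \<zero>) \<and> (\<forall>l'. h l' \<in> \<G> 1)"
proof -
  let ?C' = "syz_index C J"
  define i where "i = l div n"
  define j where "j = l mod n"
  have ij: "i \<in> C" "j \<in> J i" "l = i * n + j" "j < n" "j' \<in> J i" "j' < j"
    using l index_lt[OF l] j' unfolding syz_index_def i_def j_def syz_vars_def by auto
  define l' where "l' = i * n + j'"
  have l': "l' \<in> ?C'" "l' div n = i" "l' mod n = j'" "l' < l"
    using index_pair[OF ij(1,5)] ij unfolding l'_def by auto
  have xg: "x j \<in> \<G> 1" "x j' \<in> \<G> 1" using var_grade ij by auto
  have xR: "x j \<in> carrier R" "x j' \<in> carrier R" using ij by auto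
  define u where "u = (\<lambda>m. if m = l then x j' else if m = l' then \<ominus> x j else \<zero>)"
  have uco: "u \<in> coeffs ?C'" using l l' xR unfolding u_def coeffs_def by auto
  have zG: "\<zero> \<in> \<G> d" for d using subgroup.one_closed[OF grade_subgroup] by simp
  have mG: "\<ominus> a \<in> \<G> d" if "a \<in> \<G> d" for a d
    using subgroup.m_inv_closed[OF grade_subgroup that] unfolding a_inv_def by simp
  have uG: "u m \<in> \<G> 1" for m unfolding u_def using xg zG mG by auto
  define f where "f = comb ?C' k u"
  have fZ: "f \<in> Z" unfolding f_def relations_eq_image using uco by blast
  have fe: "f m = x j' \<otimes> k l m \<oplus> (\<ominus> x j \<otimes> k l' m)" for m
  proof -
    have "f m = (\<Oplus>a\<in>{l, l'}. u a \<otimes> k a m)"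
      unfolding f_def comb_def
    proof (rule add.finprod_mono_neutral_cong_right)
      show "u a \<otimes> k a m = \<zero>" if "a \<in> ?C' - {l, l'}" for a using that by (simp add: u_def)
    qed (use finite_index l l' coeffsD[OF uco] in auto)
    then show ?thesis using l l' xR by (simp add: u_def)
  qed
  have fG: "f m \<in> \<G> 2" for m
    unfolding f_def comb_def
    by (rule finsum_in_subgroup[OF grade_subgroup])
      (use grade_mult[OF uG gen_grade] in auto)
  have f0: "f m = \<zero>" if "m \<ge> i" for m
  proof (cases "m = i")
    case True
    moreover have "\<ominus> x j \<otimes> x j' = \<ominus> (x j' \<otimes> x j)"
      using xR l_minus m_comm by simp
    ultimately show ?thesis
      using gen_lead[OF l] gen_lead[OF l'(1)] xR l' unfolding fe i_def[symmetric] j_def[symmetric]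
      by (simp add: r_neg)
  next
    case False
    then have "k l m = \<zero>" "k l' m = \<zero>"
      using that gen_beyond[OF l] gen_beyond[OF l'(1)] l'(2) i_def by auto
    then show ?thesis unfolding fe using xR by simp
  qed
  \<comment> \<open>The rest of the Koszul combination is a relation with quadratic entries that
    vanish from i on. Elimination with D in degree 1 and D' in degree 2 yields linear
    coefficients.\<close>
  have "\<exists>h\<in>coeffs ?C'. (\<forall>l. h l \<in> \<G> 1) \<and> (\<forall>l. i \<le> l div n \<longrightarrow> h l = \<zero>) \<and> f = comb ?C' k h"
  proof (rule relation_generation[OF grade_subgroup grade_subgroup])
    show "a \<otimes> b \<in> \<G> 2" if "a \<in> \<G> 1" "b \<in> \<G> 1" for a b
      using grade_mult[OF that] by simp
  qed (use Id_repr_quadratic fZ f0 fG in auto)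
  then obtain h where h: "h \<in> coeffs ?C'" "\<And>l. h l \<in> \<G> 1" "\<And>l. i \<le> l div n \<Longrightarrow> h l = \<zero>"
    "f = comb ?C' k h" by blast
  define v where "v = (\<lambda>m. u m \<oplus> (\<ominus> \<one>) \<otimes> h m)"
  have hR: "h m \<in> carrier R" for m using coeffsD[OF h(1)] .
  have uR: "u m \<in> carrier R" for m using coeffsD[OF uco] .
  have hco: "(\<lambda>m. (\<ominus> \<one>) \<otimes> h m) \<in> coeffs ?C'"
    using h(1) unfolding coeffs_def by auto
  have "comb ?C' k v m = \<zero>" for m
  proof -
    have fR: "f m \<in> carrier R" using fG grade_subset by blast
    have "comb ?C' k v m = f m \<oplus> comb ?C' k (\<lambda>m. (\<ominus> \<one>) \<otimes> h m) m"
      unfolding v_def f_def by (rule comb_add[OF uco hco]) simp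
    also have "comb ?C' k (\<lambda>m. (\<ominus> \<one>) \<otimes> h m) m = (\<ominus> \<one>) \<otimes> f m"
      unfolding h(4) by (rule comb_smult[OF finite_index h(1)]) auto
    finally show ?thesis using fR by (simp add: l_minus r_neg)
  qed
  moreover have "v \<in> coeffs ?C'" using uco hco unfolding v_def coeffs_def by auto
  \<comment> \<open>The correction is supported on leading positions below i, so it does not disturb
    the coefficient at l.\<close>
  moreover have "v l = x j'" using h(3)[of l] xR unfolding v_def u_def i_def by simp
  moreover have "v m = \<zero>" if "m > l" for m
  proof -
    have "i \<le> m div n" using that unfolding i_def by (simp add: div_le_mono)
    then show ?thesis using h(3)[of m] that l'(4) unfolding v_def u_def by auto
  qed
  moreover have "v m \<in> \<G> 1" for m
  proof -
    have "(\<ominus> \<one>) \<otimes> h m = \<ominus> h m" using hR by (simp add: l_minus)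
    then show ?thesis
      unfolding v_def using subgroup.m_closed[OF grade_subgroup uG mG[OF h(2)]] by simp
  qed
  ultimately show ?thesis by (intro bexI[of _ v]) auto
qed

lemma linear_relations_syz:
  "linear_relations (syz_index C J) (syz_vars J)
     {h \<in> coeffs (syz_index C J). comb (syz_index C J) k h = (\<lambda>_. \<zero>)}"
proof (rule linear_relationsI)
  let ?C' = "syz_index C J"
  let ?K = "{h \<in> coeffs ?C'. comb ?C' k h = (\<lambda>_. \<zero>)}"
  show "finite ?C'" by (rule finite_index)
  show "syz_vars J i \<subseteq> {..<n}" if "i \<in> ?C'" for i
    using that J_sub unfolding syz_index_def syz_vars_def by blast
  show "?K \<subseteq> coeffs ?C'" by blast
  show "(\<lambda>_. \<zero>) \<in> ?K"
    using comb_zero by (auto simp: coeffs_def)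
  show "(\<lambda>l. f l \<oplus> g l) \<in> ?K" if "f \<in> ?K" "g \<in> ?K" for f g
  proof -
    have "comb ?C' k (\<lambda>l. f l \<oplus> g l) m = \<zero>" for m
      using that by (subst comb_add) auto
    then show ?thesis using that by (auto simp: coeffs_def)
  qed
  show "(\<lambda>l. r \<otimes> f l) \<in> ?K" if "r \<in> carrier R" "f \<in> ?K" for f r
  proof -
    have "comb ?C' k (\<lambda>l. r \<otimes> f l) m = \<zero>" for m
      using that by (subst comb_smult[OF finite_index]) auto
    then show ?thesis using that by (auto simp: coeffs_def)
  qed
  show "f i \<in> Id (syz_vars J i)" if "f \<in> ?K" "i \<in> ?C'" "\<And>l. l > i \<Longrightarrow> f l = \<zero>" for f i
    using that by (intro syz_lead) auto
  show "\<exists>f\<in>?K. f i = x j \<and> (\<forall>l>i. f l = \<zero>) \<and> (\<forall>l. f l \<in> \<G> 1)"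
    if "i \<in> ?C'" "j \<in> syz_vars J i" for i j
    using syz_linear[OF that] by blast
qed

end

section \<open>Iterated syzygies\<close>

lemma syz_generators_exist:
  assumes "linear_relations C J Z"
  shows "\<exists>k. syz_generators C J Z k"
proof -
  have "\<exists>f. f \<in> Z \<and> f (l div n) = x (l mod n) \<and> (\<forall>m>l div n. f m = \<zero>) \<and> (\<forall>m. f m \<in> \<G> 1)"
    if "l \<in> syz_index C J" for l
    using that linear_relationsD(8)[OF assms] unfolding syz_index_def by blast
  then show ?thesis unfolding syz_generators_def by metis
qed

text \<open>Dependent choice is used since each stage is the kernel of a map that is itself chosen.
  The states also carry the sets J of variables, which are needed to continue but are forgotten in
  the statement.\<close>

lemma resolution_stages:
  assumes "linear_relations C J Z"
  shows "\<exists>CC ZZ kk. CC 0 = C \<and> ZZ 0 = Z \<and>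
    (\<forall>i. finite (CC i) \<and> (\<forall>l\<in>CC (Suc i). kk i l \<in> coeffs (CC i) \<and> (\<forall>m. kk i l m \<in> \<G> 1)) \<and>
       ZZ i = comb (CC (Suc i)) (kk i) ` coeffs (CC (Suc i)) \<and>
       ZZ (Suc i) = {h \<in> coeffs (CC (Suc i)). comb (CC (Suc i)) (kk i) h = (\<lambda>_. \<zero>)})"
proof -
  \<comment> \<open>The last component is the differential that leaves the stage. At stage 0 it is
    arbitrary, since the map out of stage 0 is the augmentation; this is why \<open>kk i\<close> is
    read off at stage Suc i.\<close>
  define P where "P = (\<lambda>i (C', J', Z', k' :: nat \<Rightarrow> nat \<Rightarrow> 'a).
    linear_relations C' J' Z' \<and> (i = (0::nat) \<longrightarrow> C' = C \<and> Z' = Z))"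
  define Q where "Q = (\<lambda>(i :: nat) (C', J' :: nat \<Rightarrow> nat set, Z', k' :: nat \<Rightarrow> nat \<Rightarrow> 'a)
      (C'', J'' :: nat \<Rightarrow> nat set, Z'', k'').
    (\<forall>l\<in>C''. k'' l \<in> coeffs C' \<and> (\<forall>m. k'' l m \<in> \<G> 1)) \<and> Z' = comb C'' k'' ` coeffs C'' \<and>
    Z'' = {h \<in> coeffs C''. comb C'' k'' h = (\<lambda>_. \<zero>)})"
  have "\<exists>s. P 0 s" using assms unfolding P_def by auto
  moreover have "\<exists>s'. P (Suc i) s' \<and> Q i s s'" if "P i s" for i s
  proof -
    obtain C' J' Z' k' where s: "s = (C', J', Z', k')" by (cases s)
    have lin: "linear_relations C' J' Z'" using that unfolding s P_def by simp
    obtain k'' where gen: "syz_generators C' J' Z' k''" using syz_generators_exist[OF lin] by blast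
    have "P (Suc i) (syz_index C' J', syz_vars J',
        {h \<in> coeffs (syz_index C' J'). comb (syz_index C' J') k'' h = (\<lambda>_. \<zero>)}, k'')"
      using linear_relations_syz[OF lin gen] unfolding P_def by simp
    moreover have "k'' l \<in> coeffs C' \<and> (\<forall>m. k'' l m \<in> \<G> 1)" if "l \<in> syz_index C' J'" for l
      using gen_Z[OF lin gen that] gen_grade[OF lin gen that] linear_relationsD(3)[OF lin] by blast
    ultimately show ?thesis
      using relations_eq_image[OF lin gen] unfolding s Q_def by fastforce
  qed
  ultimately obtain f where f: "\<And>i. P i (f i)" "\<And>i. Q i (f i) (f (Suc i))"
    using dependent_nat_choice[of P Q] by blast
  define CC where "CC = (\<lambda>i. fst (f i))"
  define ZZ where "ZZ = (\<lambda>i. fst (snd (snd (f i))))"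
  define kk where "kk = (\<lambda>i. snd (snd (snd (f (Suc i)))))"
  have "finite (CC i)" for i
    using f(1)[of i] unfolding P_def CC_def linear_relations_def by (auto simp: case_prod_unfold)
  moreover have "CC 0 = C" "ZZ 0 = Z"
    using f(1)[of 0] unfolding P_def CC_def ZZ_def by (auto simp: case_prod_unfold)
  moreover have "(\<forall>l\<in>CC (Suc i). kk i l \<in> coeffs (CC i) \<and> (\<forall>m. kk i l m \<in> \<G> 1)) \<and>
       ZZ i = comb (CC (Suc i)) (kk i) ` coeffs (CC (Suc i)) \<and>
       ZZ (Suc i) = {h \<in> coeffs (CC (Suc i)). comb (CC (Suc i)) (kk i) h = (\<lambda>_. \<zero>)}" for i
    using f(2)[of i] unfolding Q_def CC_def ZZ_def kk_def case_prod_unfold .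
  ultimately show ?thesis by (intro exI[of _ CC] exI[of _ ZZ] exI[of _ kk] conjI allI) blast+
qed

text \<open>A linear resolution has its bases indexed by lists. A number is encoded as a list of
  that length, and the entries of the list do not matter.\<close>

definition code :: "nat \<Rightarrow> 'i list" where
  "code l = replicate l undefined"

lemma length_code [simp]: "length (code l) = l"
  by (simp add: code_def)

lemma code_eq_iff [simp]: "code l = code m \<longleftrightarrow> l = m"
  by (metis length_code)

text \<open>Elements of a free module are \<open>undefined\<close> off the basis, whereas
  coefficient vectors are zero off their index set. This map and \<open>to_coeffs\<close> translate
  between the two conventions.\<close>

definition of_coeffs :: "nat set \<Rightarrow> (nat \<Rightarrow> 'a) \<Rightarrow> 'i list \<Rightarrow> 'a" where
  "of_coeffs C h = (\<lambda>b\<in>code ` C. h (length b))"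

definition to_coeffs :: "nat set \<Rightarrow> ('i list \<Rightarrow> 'a) \<Rightarrow> nat \<Rightarrow> 'a" where
  "to_coeffs C f = (\<lambda>l. if l \<in> C then f (code l) else \<zero>)"

lemma carrier_free_module:
  "finite B \<Longrightarrow> carrier (free_module R B) = B \<rightarrow>\<^sub>E carrier R"
  unfolding free_module_def by (auto simp: carrier_sum_group a_group)

lemma free_module_simps:
  "zero (free_module R B) = (\<lambda>b\<in>B. \<zero>)"
  "add (free_module R B) = (\<lambda>f g. \<lambda>b\<in>B. f b \<oplus> g b)"
  "(\<odot>\<^bsub>free_module R B\<^esub>) = (\<lambda>r f. \<lambda>b\<in>B. r \<otimes> f b)"
  unfolding free_module_def by simp_all

lemma to_coeffs_in: "finite C \<Longrightarrow> f \<in> carrier (free_module R (code ` C)) \<Longrightarrow> to_coeffs C f \<in> coeffs C"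
  by (auto simp: carrier_free_module to_coeffs_def coeffs_def)

lemma of_coeffs_in: "finite C \<Longrightarrow> h \<in> coeffs C \<Longrightarrow> of_coeffs C h \<in> carrier (free_module R (code ` C))"
  by (auto simp: carrier_free_module of_coeffs_def coeffs_def)

lemma to_of_coeffs: "h \<in> coeffs C \<Longrightarrow> to_coeffs C (of_coeffs C h) = h"
  by (auto simp: to_coeffs_def of_coeffs_def coeffs_def)

lemma of_to_coeffs:
  assumes "finite C" "f \<in> carrier (free_module R (code ` C))"
  shows "of_coeffs C (to_coeffs C f) = f"
proof
  fix b
  show "of_coeffs C (to_coeffs C f) b = f b"
    using assms by (cases "b \<in> code ` C")
      (auto simp: to_coeffs_def of_coeffs_def carrier_free_module PiE_def extensional_def)
qed

lemma to_coeffs_image: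
  assumes "finite C"
  shows "to_coeffs C ` carrier (free_module R (code ` C)) = coeffs C"
proof (intro subset_antisym image_subsetI subsetI)
  show "h \<in> to_coeffs C ` carrier (free_module R (code ` C))" if "h \<in> coeffs C" for h
    by (rule image_eqI[where x = "of_coeffs C h"])
      (simp_all add: that to_of_coeffs of_coeffs_in assms)
qed (rule to_coeffs_in[OF assms])

lemma to_coeffs_add:
  "to_coeffs C (f \<oplus>\<^bsub>free_module R (code ` C)\<^esub> g) = (\<lambda>l. to_coeffs C f l \<oplus> to_coeffs C g l)"
  by (auto simp: to_coeffs_def free_module_simps)

lemma to_coeffs_smult:
  "r \<in> carrier R \<Longrightarrow> to_coeffs C (r \<odot>\<^bsub>free_module R (code ` C)\<^esub> f) = (\<lambda>l. r \<otimes> to_coeffs C f l)"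
  by (auto simp: to_coeffs_def free_module_simps)

lemma of_coeffs_eq_zero:
  assumes "h \<in> coeffs C"
  shows "of_coeffs C h = \<zero>\<^bsub>free_module R (code ` C)\<^esub> \<longleftrightarrow> h = (\<lambda>_. \<zero>)"
proof
  assume eq: "of_coeffs C h = \<zero>\<^bsub>free_module R (code ` C)\<^esub>"
  have "h l = \<zero>" for l
    using fun_cong[OF eq, of "code l"] assms
    by (cases "l \<in> C") (auto simp: free_module_simps of_coeffs_def coeffs_def)
  then show "h = (\<lambda>_. \<zero>)" by blast
qed (simp add: free_module_simps of_coeffs_def)

lemma grade_to_coeffs:
  assumes "f \<in> free_grading R \<G> (code ` C) s d"
  shows "to_coeffs C f l \<in> \<G> (d - s)"
  using assms subgroup.one_closed[OF grade_subgroup] by (auto simp: free_grading_def to_coeffs_def)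

text \<open>Matrix entries of degree 1 compensate for the shift between consecutive free modules: (d
  - (s + 1)) + 1 = d - s.\<close>

lemma differential_hom:
  assumes fin: "finite C" "finite C'"
    and k: "\<And>l. l \<in> C' \<Longrightarrow> k l \<in> coeffs C" "\<And>l m. l \<in> C' \<Longrightarrow> k l m \<in> \<G> 1"
  shows "(\<lambda>f :: 'i list \<Rightarrow> 'a. of_coeffs C (comb C' k (to_coeffs C' f)) :: 'i list \<Rightarrow> 'a) \<in>
    graded_hom R (free_module R (code ` C')) (free_grading R \<G> (code ` C') (s + 1))
      (free_module R (code ` C)) (free_grading R \<G> (code ` C) s)"
proof -
  have kR: "k l m \<in> carrier R" if "l \<in> C'" for l m
    using k(1)[OF that] coeffsD by blast
  have co: "comb C' k h \<in> coeffs C" if "h \<in> coeffs C'" for h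
  proof -
    have "comb C' k h m = \<zero>" if "m \<notin> C" for m
      unfolding comb_def
      by (rule add.finprod_one_eqI)
        (use k(1) that coeffsD[OF \<open>h \<in> coeffs C'\<close>] in \<open>auto simp: coeffs_def\<close>)
    then show ?thesis using comb_carrier[OF that] kR by (auto simp: coeffs_def)
  qed
  show ?thesis
    unfolding graded_hom_def
  proof (intro CollectI conjI ballI allI homI)
    fix f :: "'i list \<Rightarrow> 'a" assume f: "f \<in> carrier (add_monoid (free_module R (code ` C')))"
    then have f': "f \<in> carrier (free_module R (code ` C'))" by simp
    show "of_coeffs C (comb C' k (to_coeffs C' f)) \<in> carrier (add_monoid (free_module R (code ` C)))"
      using of_coeffs_in[OF fin(1) co[OF to_coeffs_in[OF fin(2) f']]] by simp
    fix g :: "'i list \<Rightarrow> 'a" assume "g \<in> carrier (add_monoid (free_module R (code ` C')))"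
    then have g': "g \<in> carrier (free_module R (code ` C'))" by simp
    show "of_coeffs C (comb C' k (to_coeffs C' (f \<otimes>\<^bsub>add_monoid (free_module R (code ` C'))\<^esub> g))) =
        of_coeffs C (comb C' k (to_coeffs C' f)) \<otimes>\<^bsub>add_monoid (free_module R (code ` C))\<^esub>
        of_coeffs C (comb C' k (to_coeffs C' g))"
    proof -
      have "comb C' k (\<lambda>l. to_coeffs C' f l \<oplus> to_coeffs C' g l) m =
          comb C' k (to_coeffs C' f) m \<oplus> comb C' k (to_coeffs C' g) m" for m
        by (rule comb_add[OF to_coeffs_in[OF fin(2) f'] to_coeffs_in[OF fin(2) g']]) (rule kR)
      then show ?thesis
        by (simp add: to_coeffs_add) (auto simp: free_module_simps of_coeffs_def)
    qed
  next
    fix r and f :: "'i list \<Rightarrow> 'a" assume rf: "r \<in> carrier R" "f \<in> carrier (free_module R (code ` C'))"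
    show "of_coeffs C (comb C' k (to_coeffs C' (r \<odot>\<^bsub>free_module R (code ` C')\<^esub> f))) =
        r \<odot>\<^bsub>free_module R (code ` C)\<^esub> of_coeffs C (comb C' k (to_coeffs C' f))"
    proof -
      have "comb C' k (\<lambda>l. r \<otimes> to_coeffs C' f l) m = r \<otimes> comb C' k (to_coeffs C' f) m" for m
        by (rule comb_smult[OF fin(2) to_coeffs_in[OF fin(2) rf(2)] rf(1)]) (rule kR)
      then show ?thesis
        by (simp add: to_coeffs_smult[OF rf(1)]) (auto simp: free_module_simps of_coeffs_def)
    qed
  next
    fix d
    show "(\<lambda>f :: 'i list \<Rightarrow> 'a. of_coeffs C (comb C' k (to_coeffs C' f)) :: 'i list \<Rightarrow> 'a) ` free_grading R \<G> (code ` C') (s + 1) d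
        \<subseteq> free_grading R \<G> (code ` C) s d"
    proof (rule image_subsetI)
      fix f :: "'i list \<Rightarrow> 'a" assume f: "f \<in> free_grading R \<G> (code ` C') (s + 1) d"
      then have f': "f \<in> carrier (free_module R (code ` C'))" by (simp add: free_grading_def)
      have "comb C' k (to_coeffs C' f) m \<in> \<G> (d - s)" for m
        unfolding comb_def
      proof (rule finsum_in_subgroup[OF grade_subgroup])
        fix l assume "l \<in> C'"
        then show "to_coeffs C' f l \<otimes> k l m \<in> \<G> (d - s)"
          using grade_mult[OF grade_to_coeffs[OF f, of l] k(2)[of l m]] by simp
      qed
      then show "of_coeffs C (comb C' k (to_coeffs C' f)) \<in> free_grading R \<G> (code ` C) s d"
        using of_coeffs_in[OF fin(1) co[OF to_coeffs_in[OF fin(2) f']]]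
        by (auto simp: free_grading_def of_coeffs_def)
    qed
  qed
qed

section \<open>The augmentation defined by finitely many generators of a module\<close>

context
  fixes N :: "('a, 'm) module" and C :: "nat set" and g :: "nat \<Rightarrow> 'm"
  assumes N: "Module.module R N" and gN: "\<And>l. l \<in> C \<Longrightarrow> g l \<in> carrier N"
begin

interpretation N: Module.module R N by (rule N)

lemma lincomb_carrier: "h \<in> coeffs C \<Longrightarrow> (\<Oplus>\<^bsub>N\<^esub>l\<in>C. h l \<odot>\<^bsub>N\<^esub> g l) \<in> carrier N"
  using gN by (intro N.finsum_closed) (auto simp: coeffsD)

lemma lincomb_add:
  assumes "h \<in> coeffs C" "h' \<in> coeffs C"
  shows "(\<Oplus>\<^bsub>N\<^esub>l\<in>C. (h l \<oplus> h' l) \<odot>\<^bsub>N\<^esub> g l) =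
    (\<Oplus>\<^bsub>N\<^esub>l\<in>C. h l \<odot>\<^bsub>N\<^esub> g l) \<oplus>\<^bsub>N\<^esub> (\<Oplus>\<^bsub>N\<^esub>l\<in>C. h' l \<odot>\<^bsub>N\<^esub> g l)"
proof -
  have "(\<Oplus>\<^bsub>N\<^esub>l\<in>C. (h l \<oplus> h' l) \<odot>\<^bsub>N\<^esub> g l) = (\<Oplus>\<^bsub>N\<^esub>l\<in>C. h l \<odot>\<^bsub>N\<^esub> g l \<oplus>\<^bsub>N\<^esub> h' l \<odot>\<^bsub>N\<^esub> g l)"
    using assms gN by (intro N.finsum_cong') (auto simp: coeffsD N.smult_l_distr)
  also have "\<dots> = (\<Oplus>\<^bsub>N\<^esub>l\<in>C. h l \<odot>\<^bsub>N\<^esub> g l) \<oplus>\<^bsub>N\<^esub> (\<Oplus>\<^bsub>N\<^esub>l\<in>C. h' l \<odot>\<^bsub>N\<^esub> g l)"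
    using assms gN by (intro N.finsum_addf) (auto simp: coeffsD)
  finally show ?thesis .
qed

lemma lincomb_smult:
  assumes "finite C" "h \<in> coeffs C" "r \<in> carrier R"
  shows "(\<Oplus>\<^bsub>N\<^esub>l\<in>C. (r \<otimes> h l) \<odot>\<^bsub>N\<^esub> g l) = r \<odot>\<^bsub>N\<^esub> (\<Oplus>\<^bsub>N\<^esub>l\<in>C. h l \<odot>\<^bsub>N\<^esub> g l)"
proof -
  have "r \<odot>\<^bsub>N\<^esub> (\<Oplus>\<^bsub>N\<^esub>l\<in>C. h l \<odot>\<^bsub>N\<^esub> g l) = (\<Oplus>\<^bsub>N\<^esub>l\<in>C. r \<odot>\<^bsub>N\<^esub> (h l \<odot>\<^bsub>N\<^esub> g l))"
    using assms gN by (intro N.finsum_smult_ldistr) (auto simp: coeffsD)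
  also have "\<dots> = (\<Oplus>\<^bsub>N\<^esub>l\<in>C. (r \<otimes> h l) \<odot>\<^bsub>N\<^esub> g l)"
    using assms gN by (intro N.finsum_cong') (auto simp: coeffsD N.smult_assoc1)
  finally show ?thesis by simp
qed

lemma lincomb_zero: "(\<Oplus>\<^bsub>N\<^esub>l\<in>C. \<zero> \<odot>\<^bsub>N\<^esub> g l) = \<zero>\<^bsub>N\<^esub>"
  using gN by (intro N.add.finprod_one_eqI) simp

text \<open>The closure properties are automatic for the kernel of a linear map, so only the two
  conditions special to linear quotients have to be supplied.\<close>

lemma kernel_linear_relations:
  assumes "finite C" "\<And>i. i \<in> C \<Longrightarrow> J i \<subseteq> {..<n}"
    and lead: "\<And>h i. h \<in> coeffs C \<Longrightarrow> (\<Oplus>\<^bsub>N\<^esub>l\<in>C. h l \<odot>\<^bsub>N\<^esub> g l) = \<zero>\<^bsub>N\<^esub> \<Longrightarrow> i \<in> C \<Longrightarrow>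
        (\<And>l. l > i \<Longrightarrow> h l = \<zero>) \<Longrightarrow> h i \<in> Id (J i)"
    and linear: "\<And>i j. i \<in> C \<Longrightarrow> j \<in> J i \<Longrightarrow> \<exists>h\<in>coeffs C. (\<Oplus>\<^bsub>N\<^esub>l\<in>C. h l \<odot>\<^bsub>N\<^esub> g l) = \<zero>\<^bsub>N\<^esub> \<and>
        h i = x j \<and> (\<forall>l>i. h l = \<zero>) \<and> (\<forall>l. h l \<in> \<G> 1)"
  shows "linear_relations C J {h \<in> coeffs C. (\<Oplus>\<^bsub>N\<^esub>l\<in>C. h l \<odot>\<^bsub>N\<^esub> g l) = \<zero>\<^bsub>N\<^esub>}"
proof (rule linear_relationsI[OF assms(1,2)])
  let ?Z = "{h \<in> coeffs C. (\<Oplus>\<^bsub>N\<^esub>l\<in>C. h l \<odot>\<^bsub>N\<^esub> g l) = \<zero>\<^bsub>N\<^esub>}"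
  show "?Z \<subseteq> coeffs C" by blast
  show "(\<lambda>_. \<zero>) \<in> ?Z" using lincomb_zero by (simp add: coeffs_def)
  show "(\<lambda>l. f l \<oplus> f' l) \<in> ?Z" if "f \<in> ?Z" "f' \<in> ?Z" for f f'
    using that lincomb_add[of f f'] by (auto simp: coeffs_def)
  show "(\<lambda>l. r \<otimes> f l) \<in> ?Z" if "r \<in> carrier R" "f \<in> ?Z" for r f
    using that lincomb_smult[OF assms(1), of f r] by (auto simp: coeffs_def)
  show "f i \<in> Id (J i)" if "f \<in> ?Z" "i \<in> C" "\<And>l. l > i \<Longrightarrow> f l = \<zero>" for f i
    using that by (intro lead) auto
  show "\<exists>f\<in>?Z. f i = x j \<and> (\<forall>l>i. f l = \<zero>) \<and> (\<forall>l. f l \<in> \<G> 1)" if ij: "i \<in> C" "j \<in> J i" for i j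
  proof -
    from linear[OF ij] obtain h where "h \<in> coeffs C" "(\<Oplus>\<^bsub>N\<^esub>l\<in>C. h l \<odot>\<^bsub>N\<^esub> g l) = \<zero>\<^bsub>N\<^esub>"
      "h i = x j" "\<forall>l>i. h l = \<zero>" "\<forall>l. h l \<in> \<G> 1" by blast
    then show ?thesis by (intro bexI[of _ h]) auto
  qed
qed

end

text \<open>Exactness holds because each \<open>ZZ i\<close> is at once the kernel of the map out of
  stage i and the image of the differential into it. The generators lie in degree 0 and every matrix
  entry in degree 1, which makes the resolution linear.\<close>

lemma has_linear_resolutionI:
  fixes N :: "('a, 'm) module"
  assumes N: "Module.module R N"
    and grades: "\<And>d. subgroup (\<N> d) (add_monoid N)"
      "\<And>i j a y. a \<in> \<G> i \<Longrightarrow> y \<in> \<N> j \<Longrightarrow> a \<odot>\<^bsub>N\<^esub> y \<in> \<N> (i + j)"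
    and g: "\<And>l. l \<in> C \<Longrightarrow> g l \<in> \<N> 0"
    and lin: "linear_relations C J {h \<in> coeffs C. (\<Oplus>\<^bsub>N\<^esub>l\<in>C. h l \<odot>\<^bsub>N\<^esub> g l) = \<zero>\<^bsub>N\<^esub>}"
    and surj: "\<And>y. y \<in> carrier N \<Longrightarrow> \<exists>h\<in>coeffs C. y = (\<Oplus>\<^bsub>N\<^esub>l\<in>C. h l \<odot>\<^bsub>N\<^esub> g l)"
  shows "has_linear_resolution R \<G> N \<N>"
proof -
  interpret N: Module.module R N by (rule N)
  have gN: "g l \<in> carrier N" if "l \<in> C" for l
    using subgroup.subset[OF grades(1)] g[OF that] by auto
  define \<epsilon>' where "\<epsilon>' = (\<lambda>h. \<Oplus>\<^bsub>N\<^esub>l\<in>C. h l \<odot>\<^bsub>N\<^esub> g l)"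
  have \<epsilon>'_eq: "(\<Oplus>\<^bsub>N\<^esub>l\<in>C. h l \<odot>\<^bsub>N\<^esub> g l) = \<epsilon>' h" for h
    by (simp add: \<epsilon>'_def)
  have fin: "finite C" using linear_relationsD(1)[OF lin] .
  have eN: "\<epsilon>' h \<in> carrier N" if "h \<in> coeffs C" for h
    unfolding \<epsilon>'_def using lincomb_carrier[of N C g] N gN that by blast
  have e_add: "\<epsilon>' (\<lambda>l. h l \<oplus> h' l) = \<epsilon>' h \<oplus>\<^bsub>N\<^esub> \<epsilon>' h'" if "h \<in> coeffs C" "h' \<in> coeffs C" for h h'
    unfolding \<epsilon>'_def using lincomb_add[of N C g] N gN that by blast
  have e_smult: "\<epsilon>' (\<lambda>l. r \<otimes> h l) = r \<odot>\<^bsub>N\<^esub> \<epsilon>' h" if "h \<in> coeffs C" "r \<in> carrier R" for h r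
    unfolding \<epsilon>'_def using lincomb_smult[of N C g] N gN fin that by blast
  have e_grade: "\<epsilon>' h \<in> \<N> d" if "h \<in> coeffs C" "\<And>l. h l \<in> \<G> d" for h d
  proof -
    have "(\<Oplus>\<^bsub>N\<^esub>l\<in>A. h l \<odot>\<^bsub>N\<^esub> g l) \<in> \<N> d" if "A \<subseteq> C" for A
      using finite_subset[OF that fin] that
    proof (induction A rule: finite_induct)
      case empty
      then show ?case using subgroup.one_closed[OF grades(1)] by simp
    next
      case (insert a A)
      have "h a \<odot>\<^bsub>N\<^esub> g a \<in> \<N> d"
        using grades(2)[OF \<open>h a \<in> \<G> d\<close> g[of a]] insert.prems by simp
      then show ?case
        using insert subgroup.m_closed[OF grades(1), of "h a \<odot>\<^bsub>N\<^esub> g a" d]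
          gN coeffsD[OF \<open>h \<in> coeffs C\<close>]
        by (subst N.finsum_insert) auto
    qed
    then show ?thesis unfolding \<epsilon>'_def by blast
  qed
  obtain CC ZZ kk where CC: "CC 0 = C" "ZZ 0 = {h \<in> coeffs C. \<epsilon>' h = \<zero>\<^bsub>N\<^esub>}" "\<And>i. finite (CC i)"
    and k: "\<And>i l. l \<in> CC (Suc i) \<Longrightarrow> kk i l \<in> coeffs (CC i)"
      "\<And>i l m. l \<in> CC (Suc i) \<Longrightarrow> kk i l m \<in> \<G> 1"
    and im: "\<And>i. ZZ i = comb (CC (Suc i)) (kk i) ` coeffs (CC (Suc i))"
    and ker: "\<And>i. ZZ (Suc i) = {h \<in> coeffs (CC (Suc i)). comb (CC (Suc i)) (kk i) h = (\<lambda>_. \<zero>)}"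
  proof -
    obtain CC ZZ kk where *: "CC 0 = C" "ZZ 0 = {h \<in> coeffs C. \<epsilon>' h = \<zero>\<^bsub>N\<^esub>}"
      and **: "\<forall>i. finite (CC i) \<and>
        (\<forall>l\<in>CC (Suc i). kk i l \<in> coeffs (CC i) \<and> (\<forall>m. kk i l m \<in> \<G> 1)) \<and>
        ZZ i = comb (CC (Suc i)) (kk i) ` coeffs (CC (Suc i)) \<and>
        ZZ (Suc i) = {h \<in> coeffs (CC (Suc i)). comb (CC (Suc i)) (kk i) h = (\<lambda>_. \<zero>)}"
      using resolution_stages[OF lin] unfolding \<epsilon>'_eq by (elim exE conjE) (rule that)
    show ?thesis
    proof (rule that[of CC ZZ kk])
      fix i
      note ** = spec[OF **, of i]
      show "finite (CC i)" "ZZ i = comb (CC (Suc i)) (kk i) ` coeffs (CC (Suc i))"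
        "ZZ (Suc i) = {h \<in> coeffs (CC (Suc i)). comb (CC (Suc i)) (kk i) h = (\<lambda>_. \<zero>)}"
        using ** by auto
      show "kk i l \<in> coeffs (CC i)" "kk i l m \<in> \<G> 1" if "l \<in> CC (Suc i)" for l m
        using ** that by auto
    qed (fact *)+
  qed
  define B :: "nat \<Rightarrow> ('a \<times> 'm) list set" where "B = (\<lambda>i. code ` CC i)"
  define \<epsilon> :: "(('a \<times> 'm) list \<Rightarrow> 'a) \<Rightarrow> 'm" where "\<epsilon> = (\<lambda>f. \<epsilon>' (to_coeffs C f))"
  define \<delta> :: "nat \<Rightarrow> (('a \<times> 'm) list \<Rightarrow> 'a) \<Rightarrow> (('a \<times> 'm) list \<Rightarrow> 'a)"
    where "\<delta> = (\<lambda>i f. of_coeffs (CC i) (comb (CC (Suc i)) (kk i) (to_coeffs (CC (Suc i)) f)))"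
  have tc: "to_coeffs (CC i) f \<in> coeffs (CC i)" if "f \<in> carrier (free_module R (B i))" for i
    and f :: "('a \<times> 'm) list \<Rightarrow> 'a"
    using that to_coeffs_in[OF CC(3)] unfolding B_def by blast
  have d_im: "\<delta> i ` carrier (free_module R (B (Suc i))) = of_coeffs (CC i) ` ZZ i" for i
  proof -
    have "\<delta> i ` carrier (free_module R (B (Suc i))) = of_coeffs (CC i) ` comb (CC (Suc i)) (kk i) `
        to_coeffs (CC (Suc i)) ` carrier (free_module R (B (Suc i)))"
      unfolding \<delta>_def by (simp add: image_image)
    then show ?thesis unfolding B_def to_coeffs_image[OF CC(3)] im .
  qed
  have ZZ_coeffs: "ZZ i \<subseteq> coeffs (CC i)" for i
    using CC(1,2) ker by (cases i) auto
  \<comment> \<open>Images and kernels are both compared with this set, once as an image under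
    \<open>of_coeffs\<close> and once as a preimage under \<open>to_coeffs\<close>.\<close>
  have of_Z: "of_coeffs (CC i) ` ZZ i = {f \<in> carrier (free_module R (B i)). to_coeffs (CC i) f \<in> ZZ i}" for i
  proof (intro subset_antisym subsetI)
    fix f :: "('a \<times> 'm) list \<Rightarrow> 'a"
    assume "f \<in> of_coeffs (CC i) ` ZZ i"
    then obtain h where h: "h \<in> ZZ i" "f = of_coeffs (CC i) h" by blast
    then have "h \<in> coeffs (CC i)" using ZZ_coeffs by blast
    then show "f \<in> {f \<in> carrier (free_module R (B i)). to_coeffs (CC i) f \<in> ZZ i}"
      using h unfolding B_def by (simp add: of_coeffs_in[OF CC(3)] to_of_coeffs)
  next
    fix f :: "('a \<times> 'm) list \<Rightarrow> 'a"
    assume "f \<in> {f \<in> carrier (free_module R (B i)). to_coeffs (CC i) f \<in> ZZ i}"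
    then show "f \<in> of_coeffs (CC i) ` ZZ i"
      unfolding B_def by (intro image_eqI[where x = "to_coeffs (CC i) f"]) (simp_all add: of_to_coeffs[OF CC(3)])
  qed
  have k_comb: "comb (CC (Suc i)) (kk i) h \<in> coeffs (CC i)" if "h \<in> coeffs (CC (Suc i))" for i h
    using that im[of i] ZZ_coeffs[of i] by blast
  have r1: "\<epsilon> \<in> graded_hom R (free_module R (B 0)) (free_grading R \<G> (B 0) (int 0)) N \<N>"
    unfolding graded_hom_def
  proof (intro CollectI conjI ballI allI homI)
    fix f :: "('a \<times> 'm) list \<Rightarrow> 'a" assume "f \<in> carrier (add_monoid (free_module R (B 0)))"
    then have f: "to_coeffs C f \<in> coeffs C" using tc[of f 0] CC(1) by simp
    show "\<epsilon> f \<in> carrier (add_monoid N)" using eN[OF f] unfolding \<epsilon>_def by simp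
    fix f' :: "('a \<times> 'm) list \<Rightarrow> 'a" assume "f' \<in> carrier (add_monoid (free_module R (B 0)))"
    then have f': "to_coeffs C f' \<in> coeffs C" using tc[of f' 0] CC(1) by simp
    show "\<epsilon> (f \<otimes>\<^bsub>add_monoid (free_module R (B 0))\<^esub> f') = \<epsilon> f \<otimes>\<^bsub>add_monoid N\<^esub> \<epsilon> f'"
      using e_add[OF f f'] unfolding \<epsilon>_def B_def CC(1) by (simp add: to_coeffs_add)
  next
    fix r and f :: "('a \<times> 'm) list \<Rightarrow> 'a" assume r: "r \<in> carrier R" and "f \<in> carrier (free_module R (B 0))"
    then have f: "to_coeffs C f \<in> coeffs C" using tc[of f 0] CC(1) by simp
    show "\<epsilon> (r \<odot>\<^bsub>free_module R (B 0)\<^esub> f) = r \<odot>\<^bsub>N\<^esub> \<epsilon> f"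
      using e_smult[OF f r] unfolding \<epsilon>_def B_def CC(1) to_coeffs_smult[OF r] .
  next
    fix d
    show "\<epsilon> ` free_grading R \<G> (B 0) (int 0) d \<subseteq> \<N> d"
    proof (rule image_subsetI)
      fix f :: "('a \<times> 'm) list \<Rightarrow> 'a" assume f: "f \<in> free_grading R \<G> (B 0) (int 0) d"
      then have f': "to_coeffs C f \<in> coeffs C"
        using tc[of f 0] CC(1) by (simp add: free_grading_def)
      have "to_coeffs C f l \<in> \<G> d" for l
        using grade_to_coeffs[of f C 0 d l] f CC(1) unfolding B_def by simp
      then show "\<epsilon> f \<in> \<N> d" unfolding \<epsilon>_def by (rule e_grade[OF f'])
    qed
  qed
  have r2: "\<delta> i \<in> graded_hom R (free_module R (B (Suc i))) (free_grading R \<G> (B (Suc i)) (int (Suc i)))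
      (free_module R (B i)) (free_grading R \<G> (B i) (int i))" for i
  proof -
    have "int (Suc i) = int i + 1" by simp
    then show ?thesis
      unfolding \<delta>_def B_def by (simp only:) (rule differential_hom[OF CC(3) CC(3)]; use k in blast)
  qed
  have r3: "\<epsilon> ` carrier (free_module R (B 0)) = carrier N"
  proof -
    have "\<epsilon> ` carrier (free_module R (B 0)) = \<epsilon>' ` coeffs C"
      using to_coeffs_image[OF fin] unfolding \<epsilon>_def B_def CC(1) by (metis image_image)
    also have "\<dots> = carrier N" using eN surj[unfolded \<epsilon>'_eq] by auto
    finally show ?thesis .
  qed
  have r4: "\<delta> 0 ` carrier (free_module R (B 1)) = a_kernel (free_module R (B 0)) N \<epsilon>"
  proof -
    have "\<delta> 0 ` carrier (free_module R (B 1)) =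
        {f \<in> carrier (free_module R (B 0)). to_coeffs C f \<in> {h \<in> coeffs C. \<epsilon>' h = \<zero>\<^bsub>N\<^esub>}}"
      using d_im[of 0] of_Z[of 0] unfolding CC(1,2) by simp
    then show ?thesis
      using tc[of _ 0] unfolding CC(1) a_kernel_def kernel_def \<epsilon>_def by auto
  qed
  have r5: "\<delta> (Suc i) ` carrier (free_module R (B (Suc (Suc i)))) =
      a_kernel (free_module R (B (Suc i))) (free_module R (B i)) (\<delta> i)" for i
  proof -
    have "to_coeffs (CC (Suc i)) f \<in> ZZ (Suc i) \<longleftrightarrow> \<delta> i f = \<zero>\<^bsub>free_module R (B i)\<^esub>"
      if "f \<in> carrier (free_module R (B (Suc i)))" for f
      using tc[OF that]
      by (simp add: ker \<delta>_def B_def of_coeffs_eq_zero[OF k_comb[OF tc[OF that]]])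
    then show ?thesis
      using d_im[of "Suc i"] unfolding of_Z a_kernel_def kernel_def by auto
  qed
  show ?thesis
    unfolding has_linear_resolution_def Let_def
    by (intro exI[of _ B] exI[of _ \<epsilon>] exI[of _ \<delta>] conjI allI) (rule r1 r2 r3 r4 r5)+
qed

end

section \<open>Spans of monomials\<close>

definition mspan :: "(nat \<Rightarrow>\<^sub>0 nat) set \<Rightarrow> 'k::field mpoly set" where
  "mspan A = {p. Poly_Mapping.keys p \<subseteq> A}"

lemma mspanI: "(\<And>a. Poly_Mapping.lookup p a \<noteq> 0 \<Longrightarrow> a \<in> A) \<Longrightarrow> p \<in> mspan A"
  by (auto simp: mspan_def in_keys_iff)

lemma mspanD: "p \<in> mspan A \<Longrightarrow> Poly_Mapping.lookup p a \<noteq> 0 \<Longrightarrow> a \<in> A"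
  by (auto simp: mspan_def in_keys_iff)

lemma mspan_mono: "A \<subseteq> B \<Longrightarrow> p \<in> mspan A \<Longrightarrow> p \<in> mspan B"
  by (auto simp: mspan_def)

lemma mspan_zero [simp]: "0 \<in> mspan A"
  by (simp add: mspan_def)

lemma mspan_add: "p \<in> mspan A \<Longrightarrow> q \<in> mspan A \<Longrightarrow> p + q \<in> mspan A"
  by (rule mspanI) (metis add_0 lookup_add mspanD)

lemma mspan_uminus: "p \<in> mspan A \<Longrightarrow> - p \<in> mspan A"
  by (rule mspanI) (auto dest: mspanD)

lemma mspan_diff: "p \<in> mspan A \<Longrightarrow> q \<in> mspan A \<Longrightarrow> p - q \<in> mspan A"
  by (metis add_uminus_conv_diff mspan_add mspan_uminus)

lemma mspan_sum: "(\<And>i. i \<in> I \<Longrightarrow> f i \<in> mspan A) \<Longrightarrow> sum f I \<in> mspan A"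
  by (induction I rule: infinite_finite_induct) (auto intro: mspan_add)

lemma mspan_single [simp]: "a \<in> A \<Longrightarrow> Poly_Mapping.single a c \<in> mspan A"
  by (simp add: mspan_def)

lemma mspan_mult:
  assumes "p \<in> mspan A" "q \<in> mspan B" "\<And>a b. a \<in> A \<Longrightarrow> b \<in> B \<Longrightarrow> a + b \<in> C"
  shows "p * q \<in> mspan C"
  using keys_mult[of p q] assms unfolding mspan_def by blast

lemma poly_mapping_sum_single:
  "(\<Sum>a\<in>Poly_Mapping.keys p. Poly_Mapping.single a (Poly_Mapping.lookup p a)) = p"
proof (rule poly_mapping_eqI)
  fix b
  have "(\<Sum>a\<in>Poly_Mapping.keys p. Poly_Mapping.lookup (Poly_Mapping.single a (Poly_Mapping.lookup p a)) b)
      = (\<Sum>a\<in>Poly_Mapping.keys p. if a = b then Poly_Mapping.lookup p b else 0)"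
    by (intro sum.cong) (auto simp: lookup_single)
  then show "Poly_Mapping.lookup (\<Sum>a\<in>Poly_Mapping.keys p.
      Poly_Mapping.single a (Poly_Mapping.lookup p a)) b = Poly_Mapping.lookup p b"
    by (simp add: lookup_sum in_keys_iff)
qed

lemma mspan_induct:
  assumes "p \<in> mspan A" "P 0" "\<And>a c. a \<in> A \<Longrightarrow> P (Poly_Mapping.single a c)"
    and add: "\<And>p q. P p \<Longrightarrow> P q \<Longrightarrow> P (p + q)"
  shows "P p"
proof -
  have "P (\<Sum>a\<in>B. Poly_Mapping.single a (Poly_Mapping.lookup p a))"
    if "finite B" "B \<subseteq> Poly_Mapping.keys p" for B
    using that
  proof (induction B rule: finite_induct)
    case (insert a B)
    have "a \<in> A" using assms(1) insert.prems unfolding mspan_def by blast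
    then show ?case using insert assms(3) add by simp
  qed (use assms(2) in simp)
  from this[of "Poly_Mapping.keys p"] show ?thesis by (simp add: poly_mapping_sum_single)
qed

lemma lookup_single_times:
  fixes a :: "nat \<Rightarrow>\<^sub>0 nat"
  shows "Poly_Mapping.lookup (p * Poly_Mapping.single a (1::'k::field)) (b + a) = Poly_Mapping.lookup p b"
proof -
  have *: "prod_fun (Poly_Mapping.lookup p) (Poly_Mapping.lookup (Poly_Mapping.single a 1)) (b + a)
      = (\<Sum>l. Poly_Mapping.lookup p l * (\<Sum>q. (1 when a = q) when b + a = l + q))"
    by (simp add: prod_fun_def lookup_single)
  \<comment> \<open>Only q = a contributes, and cancelling a in b + a = l + a leaves l = b.\<close>
  have "(\<Sum>q. ((1::'k) when a = q) when b + a = l + q) = (1 when l = b)" for l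
  proof -
    have "(\<Sum>q. ((1::'k) when a = q) when b + a = l + q) = (\<Sum>q. (1 when b + a = l + a) when q = a)"
      by (intro Sum_any.cong) (auto simp: when_def)
    then show ?thesis by (auto simp: when_def)
  qed
  then show ?thesis
    by (simp add: times_poly_mapping.rep_eq * mult_when)
qed

lemma lookup_single_times_eq_0:
  fixes a :: "nat \<Rightarrow>\<^sub>0 nat"
  assumes "\<And>b. c \<noteq> b + a"
  shows "Poly_Mapping.lookup (p * Poly_Mapping.single a (1::'k::field)) c = 0"
proof -
  have "c \<notin> Poly_Mapping.keys (p * Poly_Mapping.single a 1)"
    using keys_mult[of p "Poly_Mapping.single a 1"] assms by auto
  then show ?thesis by (simp add: in_keys_iff)
qed

section \<open>The filtration by powers of the irrelevant ideal\<close>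

locale weighted_variables =
  fixes n :: nat and w :: "nat \<Rightarrow> int"
  assumes weight_pos: "\<And>i. i < n \<Longrightarrow> w i > 0"
begin

definition Mon :: "(nat \<Rightarrow>\<^sub>0 nat) set" where
  "Mon = {a. Poly_Mapping.keys a \<subseteq> {..<n}}"

definition tdeg :: "(nat \<Rightarrow>\<^sub>0 nat) \<Rightarrow> nat" where
  "tdeg a = (\<Sum>i<n. Poly_Mapping.lookup a i)"

definition var :: "nat \<Rightarrow> nat \<Rightarrow>\<^sub>0 nat" where
  "var i = Poly_Mapping.single i 1"

lemma lookup_var: "Poly_Mapping.lookup (var i) j = (if i = j then 1 else 0)"
  by (simp add: var_def lookup_single when_def)

lemma mvar_eq: "mvar i = Poly_Mapping.single (var i) (1::'k::field)"
  by (simp add: mvar_def var_def)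

lemma Mon_zero [simp]: "0 \<in> Mon" by (simp add: Mon_def)

lemma Mon_add_iff [simp]: "a + b \<in> Mon \<longleftrightarrow> a \<in> Mon \<and> b \<in> Mon"
  unfolding Mon_def by (auto simp: in_keys_iff lookup_add subset_iff)

lemma Mon_var [simp]: "i < n \<Longrightarrow> var i \<in> Mon" by (simp add: Mon_def var_def)

lemma tdeg_add [simp]: "tdeg (a + b) = tdeg a + tdeg b"
  by (simp add: tdeg_def lookup_add sum.distrib)

lemma tdeg_zero [simp]: "tdeg 0 = 0" by (simp add: tdeg_def)

lemma tdeg_var [simp]: "i < n \<Longrightarrow> tdeg (var i) = 1"
  by (simp add: tdeg_def lookup_var)

lemma wdeg_eq: "a \<in> Mon \<Longrightarrow> wdeg w a = (\<Sum>i<n. int (Poly_Mapping.lookup a i) * w i)"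
  unfolding wdeg_def Mon_def by (intro sum.mono_neutral_left) (auto simp: in_keys_iff)

lemma wdeg_add: "a \<in> Mon \<Longrightarrow> b \<in> Mon \<Longrightarrow> wdeg w (a + b) = wdeg w a + wdeg w b"
  by (simp add: wdeg_eq lookup_add sum.distrib algebra_simps)

lemma wdeg_zero [simp]: "wdeg w 0 = 0" by (simp add: wdeg_def)

lemma wdeg_var [simp]: "wdeg w (var i) = w i" by (simp add: wdeg_def var_def)

lemma wdeg_nonneg: "a \<in> Mon \<Longrightarrow> wdeg w a \<ge> 0"
  unfolding wdeg_eq using weight_pos by (intro sum_nonneg mult_nonneg_nonneg) (auto intro: less_imp_le)

lemma split_var:
  assumes "a \<in> Mon" "i \<in> Poly_Mapping.keys a"
  obtains b where "b \<in> Mon" "a = var i + b" "i < n"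
proof -
  have "a = var i + (a - var i)"
    using assms(2) by (intro poly_mapping_eqI) (auto simp: lookup_add lookup_minus lookup_var in_keys_iff)
  moreover from this assms(1) have "a - var i \<in> Mon" by (metis Mon_add_iff)
  moreover have "i < n" using assms by (auto simp: Mon_def)
  ultimately show ?thesis using that by blast
qed

lemma tdeg_eq_0_iff: "a \<in> Mon \<Longrightarrow> tdeg a = 0 \<longleftrightarrow> a = 0"
  by (auto simp: tdeg_def Mon_def intro!: poly_mapping_eqI) (metis in_keys_iff lessThan_iff subset_iff)

lemma tdeg_pos_split:
  assumes "a \<in> Mon" "tdeg a > 0"
  obtains i b where "b \<in> Mon" "a = var i + b" "i < n"
proof -
  have "Poly_Mapping.keys a \<noteq> {}"
    using assms by (auto simp: tdeg_def in_keys_iff)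
  then show ?thesis using split_var[OF assms(1)] that by blast
qed

lemma tdeg_split:
  assumes "a \<in> Mon" "d \<le> tdeg a"
  shows "\<exists>b\<in>Mon. \<exists>c\<in>Mon. a = b + c \<and> tdeg b = d"
  using assms(2)
proof (induction d)
  case 0
  then show ?case using assms(1) by (intro bexI[of _ 0] bexI[of _ a]) auto
next
  case (Suc d)
  then obtain b c where bc: "b \<in> Mon" "c \<in> Mon" "a = b + c" "tdeg b = d" by auto
  then have "tdeg c > 0" using Suc.prems by simp
  then obtain i c' where "c' \<in> Mon" "c = var i + c'" "i < n"
    using tdeg_pos_split bc by metis
  then show ?case
    using bc by (intro bexI[of _ "b + var i"] bexI[of _ c']) (auto simp: add.assoc)
qed

text \<open>The exponents of the monomials in $\mathfrak m^d S_{\ge e}$.\<close>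

definition lev :: "int \<Rightarrow> nat \<Rightarrow> (nat \<Rightarrow>\<^sub>0 nat) set" where
  "lev e d = {b + c | b c. b \<in> Mon \<and> c \<in> Mon \<and> tdeg b = d \<and> e \<le> wdeg w c}"

lemma levI: "b \<in> Mon \<Longrightarrow> c \<in> Mon \<Longrightarrow> tdeg b = d \<Longrightarrow> e \<le> wdeg w c \<Longrightarrow> b + c \<in> lev e d"
  unfolding lev_def by blast

lemma lev_Mon: "lev e d \<subseteq> Mon"
  unfolding lev_def by auto

lemma lev_0: "lev e 0 = {a \<in> Mon. e \<le> wdeg w a}"
  unfolding lev_def using tdeg_eq_0_iff by force

lemma lev_tdeg: "a \<in> lev e d \<Longrightarrow> d \<le> tdeg a"
  unfolding lev_def by auto

text \<open>Weighted degrees are nonnegative, so for e = 0 the weight condition is void and only the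
  powers of the irrelevant ideal remain. Thus S itself is the case e = 0 of all that
  follows.\<close>

lemma lev_zero: "lev 0 d = {a \<in> Mon. d \<le> tdeg a}"
proof (intro subset_antisym subsetI)
  show "a \<in> {a \<in> Mon. d \<le> tdeg a}" if "a \<in> lev 0 d" for a
    using that lev_Mon lev_tdeg by blast
  show "a \<in> lev 0 d" if "a \<in> {a \<in> Mon. d \<le> tdeg a}" for a
    using that tdeg_split[of a d] wdeg_nonneg levI by blast
qed

text \<open>One variable moves from the first factor to the second. Its weight is positive, so the
  second factor stays in the truncation.\<close>

lemma lev_Suc: "lev e (Suc d) \<subseteq> lev e d"
proof
  fix a assume "a \<in> lev e (Suc d)"
  then obtain b c where bc: "b \<in> Mon" "c \<in> Mon" "tdeg b = Suc d" "e \<le> wdeg w c" "a = b + c"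
    unfolding lev_def by blast
  then obtain i b' where b': "b' \<in> Mon" "b = var i + b'" "i < n"
    using tdeg_pos_split[of b thesis] by auto
  then have "b' + (var i + c) \<in> lev e d"
    using bc weight_pos[of i] by (intro levI) (auto simp: wdeg_add)
  then show "a \<in> lev e d" using bc b' by (simp add: ac_simps)
qed

lemma lev_antimono: "d \<le> d' \<Longrightarrow> lev e d' \<subseteq> lev e d"
  by (induction d' rule: dec_induct) (use lev_Suc in blast)+

text \<open>The surplus factor of b has nonnegative weight and can be absorbed into the factor of a
  that lies in the truncation.\<close>

lemma lev_add: "b \<in> lev 0 i \<Longrightarrow> a \<in> lev e j \<Longrightarrow> b + a \<in> lev e (i + j)"
proof -
  assume "b \<in> lev 0 i" "a \<in> lev e j"
  then obtain b1 b2 where b: "b1 \<in> Mon" "b2 \<in> Mon" "b = b1 + b2" "tdeg b1 = i"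
    unfolding lev_def by blast
  obtain a1 a2 where a: "a1 \<in> Mon" "a2 \<in> Mon" "a = a1 + a2" "tdeg a1 = j" "e \<le> wdeg w a2"
    using \<open>a \<in> lev e j\<close> unfolding lev_def by blast
  have "(b1 + a1) + (b2 + a2) \<in> lev e (i + j)"
    using a b wdeg_nonneg[OF b(2)] by (intro levI) (auto simp: wdeg_add)
  then show ?thesis using a b by (simp add: ac_simps)
qed

lemma mspan_lev_mult: "p \<in> mspan (lev 0 i) \<Longrightarrow> q \<in> mspan (lev e j) \<Longrightarrow> p * q \<in> mspan (lev e (i + j))"
  by (erule (1) mspan_mult) (rule lev_add)

subsection \<open>The truncation and its powers\<close>

text \<open>An explicit model of the truncation as a span of monomials. Since \<open>trunc 0\<close>
  is S as a module over itself, ring and module can be treated by the same lemmas.\<close>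

definition trunc :: "int \<Rightarrow> ('k::field mpoly, 'k mpoly) module" where
  "trunc e = (self_module (mpoly_ring n))\<lparr>carrier := mspan (lev e 0)\<rparr>"

lemma carrier_mpoly_ring: "carrier (mpoly_ring n) = mspan Mon"
  by (simp add: mpoly_ring_def mspan_def Mon_def subset_eq)

lemma mpoly_ring_simps [simp]:
  "(\<otimes>\<^bsub>mpoly_ring n\<^esub>) = (*)" "one (mpoly_ring n) = 1" "zero (mpoly_ring n) = 0"
  "add (mpoly_ring n) = (+)"
  by (simp_all add: mpoly_ring_def)

lemma trunc_simps [simp]:
  "carrier (trunc e) = mspan (lev e 0)" "zero (trunc e) = 0" "add (trunc e) = (+)" "(\<odot>\<^bsub>trunc e\<^esub>) = (*)"
  by (simp_all add: trunc_def self_module_def)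

lemma lev_0_0: "lev 0 0 = Mon"
  by (auto simp: lev_zero)

lemma self_module_mpoly: "self_module (mpoly_ring n) = trunc 0"
  by (simp add: self_module_def trunc_def lev_0_0 carrier_mpoly_ring)

lemma one_in_mspan: "1 \<in> mspan Mon"
  using mspan_single[of 0 Mon 1] by simp

lemma mspan_Mon_mult: "p \<in> mspan Mon \<Longrightarrow> q \<in> mspan Mon \<Longrightarrow> p * q \<in> mspan Mon"
  by (erule (1) mspan_mult) simp

lemma cring_mpoly: "cring (mpoly_ring n :: 'k::field mpoly ring)"
proof (intro cringI abelian_groupI comm_monoidI)
  fix p :: "'k mpoly" assume "p \<in> carrier (mpoly_ring n)"
  then show "\<exists>q\<in>carrier (mpoly_ring n). q \<oplus>\<^bsub>mpoly_ring n\<^esub> p = \<zero>\<^bsub>mpoly_ring n\<^esub>"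
    by (intro bexI[of _ "- p"]) (auto simp: carrier_mpoly_ring mspan_uminus)
qed (auto simp: carrier_mpoly_ring mspan_add mspan_Mon_mult one_in_mspan algebra_simps)

lemma module_trunc: "Module.module (mpoly_ring n) (trunc e :: ('k::field mpoly, 'k mpoly) module)"
proof (intro moduleI abelian_groupI)
  fix p :: "'k mpoly" assume "p \<in> carrier (trunc e)"
  then show "\<exists>q\<in>carrier (trunc e). q \<oplus>\<^bsub>trunc e\<^esub> p = \<zero>\<^bsub>trunc e\<^esub>"
    by (intro bexI[of _ "- p"]) (auto simp: mspan_uminus)
next
  fix p q :: "'k mpoly" assume "p \<in> carrier (mpoly_ring n)" "q \<in> carrier (trunc e)"
  then show "p \<odot>\<^bsub>trunc e\<^esub> q \<in> carrier (trunc e)"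
    using mspan_lev_mult[of p 0 q e 0] by (simp add: carrier_mpoly_ring lev_0_0)
qed (auto simp: cring_mpoly mspan_add algebra_simps)

lemma subgroup_mspan:
  assumes "A \<subseteq> lev e 0"
  shows "subgroup (mspan A) (add_monoid (trunc e :: ('k::field mpoly, 'k mpoly) module))"
proof -
  interpret M: Module.module "mpoly_ring n" "trunc e :: ('k mpoly, 'k mpoly) module" by (rule module_trunc)
  have inv: "inv\<^bsub>add_monoid (trunc e)\<^esub> p = - p" if "p \<in> mspan (lev e 0)" for p :: "'k mpoly"
    using M.add.inv_equality[of "- p" p] that mspan_uminus by (auto simp: a_inv_def)
  show ?thesis
  proof
    show "mspan A \<subseteq> carrier (add_monoid (trunc e))" using assms mspan_mono by auto
    show "inv\<^bsub>add_monoid (trunc e)\<^esub> p \<in> mspan A" if "p \<in> mspan A" for p :: "'k mpoly"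
      using that inv[of p] mspan_mono[OF assms that] mspan_uminus by auto
  qed (auto simp: mspan_add)
qed

lemma finsum_trunc:
  fixes f :: "'i \<Rightarrow> 'k::field mpoly"
  assumes "finite I" "\<And>i. i \<in> I \<Longrightarrow> f i \<in> mspan (lev e 0)"
  shows "finsum (trunc e) f I = sum f I"
proof -
  interpret M: Module.module "mpoly_ring n" "trunc e :: ('k mpoly, 'k mpoly) module" by (rule module_trunc)
  show ?thesis using assms by (induction I rule: finite_induct) auto
qed

lemma wgrading_eq: "wgrading n w d = mspan {a \<in> Mon. wdeg w a = d}"
  by (auto simp: wgrading_def carrier_mpoly_ring mspan_def)

text \<open>A polynomial is the sum of its weighted homogeneous parts, and these are indexed by the
  weights of its monomials.\<close>

lemma truncation_eq:
  "truncation (self_module (mpoly_ring n)) (wgrading n w) e = (trunc e :: ('k::field mpoly, 'k mpoly) module)"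
proof -
  have "{finsum (trunc 0) f I | f I. finite I \<and> I \<subseteq> {e..} \<and> (\<forall>i\<in>I. f i \<in> wgrading n w i)}
      = (mspan (lev e 0) :: 'k mpoly set)" (is "?L = ?R")
  proof (intro subset_antisym subsetI)
    fix p assume "p \<in> ?L"
    then obtain f I where fI: "p = finsum (trunc 0) f I" "finite I" "I \<subseteq> {e..}"
      "\<And>i. i \<in> I \<Longrightarrow> f i \<in> wgrading n w i" by blast
    have "f i \<in> mspan (lev e 0)" if "i \<in> I" for i
      using fI(4)[OF that] fI(3) that unfolding wgrading_eq
      by (rule_tac mspan_mono[rotated]) (auto simp: lev_0)
    \<comment> \<open>The sum is formed in the untruncated module \<open>trunc 0\<close>, so
      membership there is needed as well.\<close>
    moreover have "f i \<in> mspan (lev 0 0)" if "i \<in> I" for i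
      using fI(4)[OF that] unfolding wgrading_eq
      by (rule_tac mspan_mono[rotated]) (auto simp: lev_0_0)
    ultimately show "p \<in> ?R" using finsum_trunc[OF fI(2), of f 0] fI(1) by (auto intro: mspan_sum)
  next
    fix p :: "'k mpoly" assume p: "p \<in> ?R"
    define I where "I = wdeg w ` Poly_Mapping.keys p"
    define f where "f = (\<lambda>d. \<Sum>a\<in>{a \<in> Poly_Mapping.keys p. wdeg w a = d}.
      Poly_Mapping.single a (Poly_Mapping.lookup p a))"
    have keys: "Poly_Mapping.keys p \<subseteq> lev e 0" using p by (simp add: mspan_def)
    have f: "f i \<in> wgrading n w i" for i
      unfolding f_def wgrading_eq
      by (rule mspan_sum, rule mspan_single) (use keys in \<open>auto simp: lev_0\<close>)
    have "p = sum f I"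
      unfolding f_def I_def
      by (subst sum.group) (auto simp: poly_mapping_sum_single)
    moreover have "f i \<in> mspan (lev 0 0)" for i
      using f[of i] unfolding wgrading_eq by (rule mspan_mono[rotated]) (auto simp: lev_0_0)
    ultimately have "p = finsum (trunc 0) f I" using finsum_trunc[of I f 0] by (simp add: I_def)
    moreover have "I \<subseteq> {e..}" "finite I" using keys by (auto simp: I_def lev_0)
    ultimately show "p \<in> ?L" using f by blast
  qed
  then show ?thesis by (simp add: truncation_def self_module_mpoly) (simp add: trunc_def)
qed

lemma ideal_mspan_lev: "ideal (mspan (lev 0 d)) (mpoly_ring n :: 'k::field mpoly ring)"
proof -
  interpret S: cring "mpoly_ring n :: 'k mpoly ring" by (rule cring_mpoly)
  have inv: "inv\<^bsub>add_monoid (mpoly_ring n)\<^esub> p = - p" if "p \<in> mspan Mon" for p :: "'k mpoly"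
    using S.add.inv_equality[of "- p" p] that mspan_uminus by (auto simp: a_inv_def carrier_mpoly_ring)
  have "subgroup (mspan (lev 0 d)) (add_monoid (mpoly_ring n :: 'k mpoly ring))"
  proof
    show "mspan (lev 0 d) \<subseteq> carrier (add_monoid (mpoly_ring n :: 'k mpoly ring))"
      using mspan_mono[OF lev_Mon] by (auto simp: carrier_mpoly_ring)
    show "inv\<^bsub>add_monoid (mpoly_ring n)\<^esub> p \<in> mspan (lev 0 d)" if "p \<in> mspan (lev 0 d)" for p :: "'k mpoly"
      using that inv[of p] mspan_mono[OF lev_Mon that] mspan_uminus by auto
  qed (auto simp: mspan_add)
  moreover have "p * q \<in> mspan (lev 0 d)" "q * p \<in> mspan (lev 0 d)"
    if "p \<in> mspan Mon" "q \<in> mspan (lev 0 d)" for p q :: "'k mpoly"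
    using mspan_lev_mult[of p 0 q 0 d] that by (simp_all add: lev_0_0 mult.commute)
  ultimately show ?thesis
    by (intro idealI) (auto simp: carrier_mpoly_ring S.ring_axioms)
qed

lemma irrelevant_ideal_eq: "irrelevant_ideal n = (mspan (lev 0 1) :: 'k::field mpoly set)"
proof
  interpret S: cring "mpoly_ring n :: 'k mpoly ring" by (rule cring_mpoly)
  have sub: "mvar ` {..<n} \<subseteq> (mspan (lev 0 1) :: 'k mpoly set)"
    by (auto simp: mvar_eq lev_zero)
  then show "irrelevant_ideal n \<subseteq> (mspan (lev 0 1) :: 'k mpoly set)"
    unfolding irrelevant_ideal_def by (rule S.genideal_minimal[OF ideal_mspan_lev])
  have "mvar ` {..<n} \<subseteq> carrier (mpoly_ring n :: 'k mpoly ring)"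
    by (auto simp: mvar_eq carrier_mpoly_ring)
  then interpret I: ideal "irrelevant_ideal n :: 'k mpoly set" "mpoly_ring n :: 'k mpoly ring"
    unfolding irrelevant_ideal_def by (rule S.genideal_ideal)
  have mv: "mvar i \<in> (irrelevant_ideal n :: 'k mpoly set)" if "i < n" for i
    using S.genideal_self[of "mvar ` {..<n}"] that \<open>mvar ` {..<n} \<subseteq> carrier _\<close>
    unfolding irrelevant_ideal_def by blast
  show "mspan (lev 0 1) \<subseteq> (irrelevant_ideal n :: 'k mpoly set)"
  proof
    fix p :: "'k mpoly" assume "p \<in> mspan (lev 0 1)"
    then show "p \<in> irrelevant_ideal n"
    proof (rule mspan_induct)
      fix a and c :: 'k assume "a \<in> lev 0 1"
      then have "a \<in> Mon" "tdeg a > 0" by (auto simp: lev_zero)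
      then obtain i b where b: "b \<in> Mon" "a = var i + b" "i < n" using tdeg_pos_split by metis
      then have "Poly_Mapping.single a c = mvar i * Poly_Mapping.single b c"
        by (simp add: mvar_eq mult_single)
      then show "Poly_Mapping.single a c \<in> irrelevant_ideal n"
        using I.I_r_closed[OF mv[OF b(3)], of "Poly_Mapping.single b c"] b
        by (simp add: carrier_mpoly_ring)
    qed (use I.zero_closed I.a_closed in auto)
  qed
qed

text \<open>A monomial of degree at least d + 1 splits into one of degree d and one of degree at
  least 1, so products of single terms already span the next power.\<close>

lemma ideal_power_eq:
  "(irrelevant_ideal n :: 'k::field mpoly set) [^]\<^bsub>ideals_set (mpoly_ring n)\<^esub> d = mspan (lev 0 d)"
proof (induction d)
  interpret S: cring "mpoly_ring n :: 'k mpoly ring" by (rule cring_mpoly)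
  interpret I: comm_monoid "ideals_set (mpoly_ring n :: 'k mpoly ring)"
    by (rule S.ideals_set_is_comm_monoid)
  case 0
  show ?case by (simp add: ideals_set_def lev_0_0 carrier_mpoly_ring)
next
  interpret S: cring "mpoly_ring n :: 'k mpoly ring" by (rule cring_mpoly)
  interpret I: comm_monoid "ideals_set (mpoly_ring n :: 'k mpoly ring)"
    by (rule S.ideals_set_is_comm_monoid)
  case (Suc d)
  let ?P = "ideal_prod (mpoly_ring n) (mspan (lev 0 d)) (mspan (lev 0 1)) :: 'k mpoly set"
  have "?P = mspan (lev 0 (Suc d))"
  proof (intro subset_antisym subsetI)
    fix p assume "p \<in> ?P"
    then show "p \<in> mspan (lev 0 (Suc d))"
    proof (induction p rule: ideal_prod.induct)
      case (prod i j)
      then show ?case using mspan_lev_mult[of i d j 0 1] by simp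
    qed (auto intro: mspan_add)
  next
    fix p :: "'k mpoly" assume "p \<in> mspan (lev 0 (Suc d))"
    then show "p \<in> ?P"
    proof (rule mspan_induct)
      show "0 \<in> ?P" using ideal_prod.prod[of 0 "mspan (lev 0 d)" 0 "mspan (lev 0 1)" "mpoly_ring n"] by simp
      show "p + q \<in> ?P" if "p \<in> ?P" "q \<in> ?P" for p q
        using ideal_prod.sum[OF that] by simp
    next
      fix a and c :: 'k assume "a \<in> lev 0 (Suc d)"
      then have "a \<in> Mon" "Suc d \<le> tdeg a" by (auto simp: lev_zero)
      then obtain b1 b2 where b: "b1 \<in> Mon" "b2 \<in> Mon" "a = b1 + b2" "tdeg b1 = d"
        using tdeg_split[of a d] by auto
      then have "Poly_Mapping.single a c = Poly_Mapping.single b1 c * Poly_Mapping.single b2 1"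
        by (simp add: mult_single)
      moreover have "b1 \<in> lev 0 d" "b2 \<in> lev 0 1"
        using b \<open>Suc d \<le> tdeg a\<close> by (auto simp: lev_zero)
      ultimately show "Poly_Mapping.single a c \<in> ?P"
        using ideal_prod.prod[of "Poly_Mapping.single b1 c" "mspan (lev 0 d)" "Poly_Mapping.single b2 1"
            "mspan (lev 0 1)" "mpoly_ring n"] by simp
    qed
  qed
  then show ?case
    using Suc by (simp add: irrelevant_ideal_eq) (simp add: ideals_set_def)
qed

text \<open>The splitting in the definition of \<open>lev\<close> writes every term as a product of
  an element of m^d and a monomial of the truncation.\<close>

lemma ideal_filt_eq:
  "ideal_filt (mpoly_ring n) (irrelevant_ideal n) (trunc e) d = (mspan (lev e d) :: 'k::field mpoly set)"
proof -
  interpret M: Module.module "mpoly_ring n" "trunc e :: ('k mpoly, 'k mpoly) module" by (rule module_trunc)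
  let ?X = "{a * x | a x. a \<in> mspan (lev 0 d) \<and> x \<in> (mspan (lev e 0) :: 'k mpoly set)}"
  have X: "?X \<subseteq> mspan (lev e d)"
    using mspan_lev_mult[where j = 0 and e = e and i = d and ?'a = 'k] by auto
  have sg: "subgroup (mspan (lev e d)) (add_monoid (trunc e :: ('k mpoly, 'k mpoly) module))"
    by (rule subgroup_mspan) (simp add: lev_antimono)
  have "generate (add_monoid (trunc e)) ?X = mspan (lev e d)"
  proof
    show "generate (add_monoid (trunc e)) ?X \<subseteq> mspan (lev e d)"
      by (rule M.add.generate_subgroup_incl[OF X sg])
    show "mspan (lev e d) \<subseteq> generate (add_monoid (trunc e)) ?X"
    proof
      fix p :: "'k mpoly" assume "p \<in> mspan (lev e d)"
      then show "p \<in> generate (add_monoid (trunc e)) ?X"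
      proof (rule mspan_induct)
        show "0 \<in> generate (add_monoid (trunc e)) ?X"
          using generate.one[of "add_monoid (trunc e)" ?X] by simp
        show "p + q \<in> generate (add_monoid (trunc e)) ?X"
          if "p \<in> generate (add_monoid (trunc e)) ?X" "q \<in> generate (add_monoid (trunc e)) ?X" for p q
          using generate.eng[OF that] by simp
      next
        fix a and c :: 'k assume "a \<in> lev e d"
        then obtain b1 b2 where b: "b1 \<in> Mon" "b2 \<in> Mon" "a = b1 + b2" "tdeg b1 = d" "e \<le> wdeg w b2"
          unfolding lev_def by blast
        have "Poly_Mapping.single a c = Poly_Mapping.single b1 c * Poly_Mapping.single b2 1"
          using b by (simp add: mult_single)
        moreover have "Poly_Mapping.single b1 c \<in> mspan (lev 0 d)" "Poly_Mapping.single b2 1 \<in> (mspan (lev e 0) :: 'k mpoly set)"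
          using b by (auto simp: lev_zero lev_0)
        ultimately show "Poly_Mapping.single a c \<in> generate (add_monoid (trunc e)) ?X"
          by (intro generate.incl) blast
      qed
    qed
  qed
  then show ?thesis by (simp add: ideal_filt_def ideal_power_eq)
qed

section \<open>Minimal monomial generators of the truncation\<close>

text \<open>Ties between equal weights are broken by the index, so that any two distinct variables
  are comparable.\<close>

definition prec :: "nat \<Rightarrow> nat \<Rightarrow> bool" where
  "prec i j \<longleftrightarrow> w i < w j \<or> w i = w j \<and> i < j"

text \<open>The position of a variable counted from the largest one down. Unlike the weight it
  separates any two of the variables.\<close>

definition height :: "nat \<Rightarrow> nat" where
  "height i = card {m \<in> {..<n}. prec i m}"

text \<open>Trading a variable for a larger one lowers this number, so generators made of heavier
  variables come first. Generators of equal rank may be ordered arbitrarily, because every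
  comparison that is used is strict.\<close>

definition rank :: "(nat \<Rightarrow>\<^sub>0 nat) \<Rightarrow> nat" where
  "rank c = (\<Sum>i<n. Poly_Mapping.lookup c i * height i)"

text \<open>The monomials of the truncation that leave it when any one variable is removed, that is,
  those minimal under divisibility. For e \<le> 0 only the monomial 1 remains.\<close>

definition gens :: "int \<Rightarrow> (nat \<Rightarrow>\<^sub>0 nat) set" where
  "gens e = {c \<in> Mon. e \<le> wdeg w c \<and> (\<forall>i. Poly_Mapping.lookup c i \<noteq> 0 \<longrightarrow> wdeg w c - w i < e)}"

definition larger_vars :: "(nat \<Rightarrow>\<^sub>0 nat) \<Rightarrow> nat set" where
  "larger_vars c = {j \<in> {..<n}. \<exists>i. Poly_Mapping.lookup c i \<noteq> 0 \<and> prec i j}"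

lemma height_less:
  assumes "prec i j" "j < n"
  shows "height j < height i"
  unfolding height_def
proof (rule psubset_card_mono)
  \<comment> \<open>The inclusion is strict because j is larger than i but not larger than
    itself.\<close>
  show "{m \<in> {..<n}. prec j m} \<subset> {m \<in> {..<n}. prec i m}"
    using assms unfolding prec_def by auto
qed simp

lemma Mon_lookup: "a \<in> Mon \<Longrightarrow> Poly_Mapping.lookup a i \<noteq> 0 \<Longrightarrow> i < n"
  by (auto simp: Mon_def in_keys_iff subset_iff)

lemma Mon_lookup_0: "a \<in> Mon \<Longrightarrow> \<not> i < n \<Longrightarrow> Poly_Mapping.lookup a i = 0"
  using Mon_lookup by blast

lemma lookup_le_wdeg:
  assumes "a \<in> Mon"
  shows "int (Poly_Mapping.lookup a i) \<le> wdeg w a"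
proof (cases "i < n")
  case True
  have "int (Poly_Mapping.lookup a i) \<le> int (Poly_Mapping.lookup a i) * w i"
    using weight_pos[OF True] by (simp add: mult_le_cancel_left1)
  also have "\<dots> \<le> (\<Sum>i<n. int (Poly_Mapping.lookup a i) * w i)"
    using True weight_pos by (intro member_le_sum) (auto simp: less_imp_le)
  finally show ?thesis by (simp add: wdeg_eq assms)
next
  case False
  then show ?thesis using Mon_lookup_0[OF assms] wdeg_nonneg[OF assms] by simp
qed

text \<open>If x_i divides c, minimality gives wdeg c < e + w i, and weights of at least 1 let the
  weighted degree bound every exponent. The sum of all weights makes the bound uniform in i.\<close>

lemma finite_gens: "finite (gens e)"
proof -
  define W where "W = (\<Sum>i<n. w i)"
  define F where "F = {f. \<forall>i. (i \<in> {..<n} \<longrightarrow> f i \<in> {..nat (e + W)}) \<and> (i \<notin> {..<n} \<longrightarrow> f i = (0::nat))}"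
  have finF: "finite F" unfolding F_def by (rule finite_set_of_finite_funs) auto
  have sub: "Poly_Mapping.lookup ` gens e \<subseteq> F"
  proof (rule image_subsetI)
    fix c assume c: "c \<in> gens e"
    then have cM: "c \<in> Mon" by (simp add: gens_def)
    have "Poly_Mapping.lookup c i \<le> nat (e + W)" if "i < n" for i
    proof (cases "Poly_Mapping.lookup c i = 0")
      case False
      then have "wdeg w c < e + w i" using c unfolding gens_def by fastforce
      moreover have "w i \<le> W"
        unfolding W_def using that weight_pos by (intro member_le_sum) (auto simp: less_imp_le)
      ultimately show ?thesis using lookup_le_wdeg[OF cM, of i] by linarith
    qed simp
    then show "Poly_Mapping.lookup c \<in> F" using Mon_lookup[OF cM] by (auto simp: F_def)
  qed
  have inj: "inj_on Poly_Mapping.lookup (gens e)" by (intro inj_onI poly_mapping_eqI) simp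
  show ?thesis by (rule finite_imageD[OF finite_subset[OF sub finF] inj])
qed

lemma gens_Mon: "c \<in> gens e \<Longrightarrow> c \<in> Mon"
  by (simp add: gens_def)

lemma gens_lev: "c \<in> gens e \<Longrightarrow> c \<in> lev e 0"
  by (simp add: gens_def lev_0)

text \<open>A monomial of the truncation that is not a generator lies in m S_{\<ge>e}. Multiplying
  it by a monomial of degree d therefore gives the zero class in degree d.\<close>

lemma not_gens_split:
  assumes "c \<in> Mon" "e \<le> wdeg w c" "c \<notin> gens e"
  obtains i c' where "i < n" "c' \<in> Mon" "c = var i + c'" "e \<le> wdeg w c'"
proof -
  obtain i where i: "Poly_Mapping.lookup c i \<noteq> 0" "e \<le> wdeg w c - w i"
    using assms unfolding gens_def by fastforce
  obtain c' where c': "c' \<in> Mon" "c = var i + c'" "i < n"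
    by (rule split_var[OF assms(1), of i]) (use i in \<open>auto simp: in_keys_iff\<close>)
  then have "wdeg w c = w i + wdeg w c'" by (simp add: wdeg_add)
  then show ?thesis using that c' i by simp
qed

lemma tdeg_int: "int (tdeg a) = (\<Sum>i<n. int (Poly_Mapping.lookup a i))"
  by (simp add: tdeg_def)

text \<open>By the assumption on \<open>b\<close>, the generator \<open>c0\<close> consists of the largest variables of \<open>b + c0\<close>,
  which are the heaviest ones and those of least height.\<close>

context
  fixes b c0 b' c
  assumes M: "b \<in> Mon" "c0 \<in> Mon" "b' \<in> Mon" "c \<in> Mon"
    and eq: "b + c0 = b' + c"
    and small: "\<And>j. j \<in> larger_vars c0 \<Longrightarrow> Poly_Mapping.lookup b j = 0"
begin

text \<open>Take for i the smallest variable of c0, the one of greatest height. A variable larger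
  than i does not occur in b, so c contains it at most as often as c0 does. A smaller variable does
  not occur in c0.\<close>

lemma minimal_var:
  assumes "c0 \<noteq> 0"
  shows "\<exists>i. i < n \<and> Poly_Mapping.lookup c0 i \<noteq> 0 \<and> (\<forall>m<n. m \<noteq> i \<longrightarrow>
      prec i m \<and> Poly_Mapping.lookup c m \<le> Poly_Mapping.lookup c0 m \<or>
      prec m i \<and> Poly_Mapping.lookup c0 m = 0)"
proof -
  have ne: "Poly_Mapping.keys c0 \<noteq> {}" using assms by simp
  have "Max (height ` Poly_Mapping.keys c0) \<in> height ` Poly_Mapping.keys c0"
    by (rule Max_in) (use ne in auto)
  then obtain i where i: "i \<in> Poly_Mapping.keys c0" "height i = Max (height ` Poly_Mapping.keys c0)"
    by (elim imageE) simp
  have i_max: "height m \<le> height i" if "m \<in> Poly_Mapping.keys c0" for m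
    unfolding i(2) using that by (intro Max_ge) auto
  have "i < n" using i(1) Mon_lookup M by (simp add: in_keys_iff)
  moreover have "prec i m \<and> Poly_Mapping.lookup c m \<le> Poly_Mapping.lookup c0 m \<or>
      prec m i \<and> Poly_Mapping.lookup c0 m = 0" if m: "m < n" "m \<noteq> i" for m
  proof (cases "prec i m")
    case True
    then have "m \<in> larger_vars c0" using m i(1) by (auto simp: larger_vars_def in_keys_iff)
    then have "Poly_Mapping.lookup b m = 0" by (rule small)
    moreover have "Poly_Mapping.lookup b m + Poly_Mapping.lookup c0 m =
        Poly_Mapping.lookup b' m + Poly_Mapping.lookup c m"
      by (simp only: lookup_add[symmetric] eq)
    ultimately show ?thesis using True by simp
  next
    case False
    then have "prec m i" using m unfolding prec_def by auto
    moreover from this have "height i < height m" using \<open>i < n\<close> by (rule height_less)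
    ultimately show ?thesis using i_max[of m] by (auto simp: in_keys_iff)
  qed
  ultimately show ?thesis using i(1) by (intro exI[of _ i]) (auto simp: in_keys_iff)
qed

text \<open>Passing from c0 to c removes variables at least as heavy as x_i and adds variables at
  most as heavy. Since c has smaller degree, the weighted degree drops by at least w i, and
  minimality of c0 turns this into a drop below e.\<close>

lemma smaller_divisor_weight:
  assumes c0: "c0 \<in> gens e" and less: "tdeg c < tdeg c0"
  shows "wdeg w c < e"
proof -
  have "c0 \<noteq> 0" using less by auto
  from minimal_var[OF this] obtain i where i: "i < n" "Poly_Mapping.lookup c0 i \<noteq> 0"
    "\<And>m. m < n \<Longrightarrow> m \<noteq> i \<Longrightarrow>
      prec i m \<and> Poly_Mapping.lookup c m \<le> Poly_Mapping.lookup c0 m \<or>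
      prec m i \<and> Poly_Mapping.lookup c0 m = 0"
    by auto
  \<comment> \<open>Subtracting w i from all weights makes the two factors have opposite signs:
    above i the exponent does not grow and the weight is at least w i, below i it is the other way
    round.\<close>
  have "(int (Poly_Mapping.lookup c m) - int (Poly_Mapping.lookup c0 m)) * (w m - w i) \<le> 0" if "m < n" for m
  proof (cases "m = i")
    case False
    then show ?thesis using i(3)[OF that False] unfolding prec_def by (auto simp: mult_le_0_iff)
  qed simp
  then have "(\<Sum>m<n. (int (Poly_Mapping.lookup c m) - int (Poly_Mapping.lookup c0 m)) * (w m - w i)) \<le> 0"
    by (intro sum_nonpos) auto
  also have "(\<Sum>m<n. (int (Poly_Mapping.lookup c m) - int (Poly_Mapping.lookup c0 m)) * (w m - w i))
      = (wdeg w c - wdeg w c0) - w i * (int (tdeg c) - int (tdeg c0))"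
    unfolding wdeg_eq[OF M(4)] wdeg_eq[OF M(2)] tdeg_int sum_subtractf[symmetric] sum_distrib_left
    by (intro sum.cong refl) (simp add: algebra_simps)
  finally have "wdeg w c - wdeg w c0 \<le> w i * (int (tdeg c) - int (tdeg c0))" by simp
  also have "\<dots> \<le> w i * (-1)"
    using less weight_pos[OF i(1)] by (intro mult_left_mono) auto
  finally have "wdeg w c \<le> wdeg w c0 - w i" by simp
  moreover have "wdeg w c0 - w i < e" using c0 i(2) by (simp add: gens_def)
  ultimately show ?thesis by simp
qed

text \<open>The same comparison with heights in place of weights, where the sign is reversed because
  larger variables have smaller height. Heights are distinct, so equality would force c and c0 to
  agree away from i, and then also at i by equality of degrees.\<close>

lemma equal_divisor_rank:
  assumes deg: "tdeg c = tdeg c0" and "c \<noteq> c0"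
  shows "rank c0 < rank c"
proof -
  have "c0 \<noteq> 0"
  proof
    assume "c0 = 0"
    then have "tdeg c = 0" using deg by simp
    then show False using \<open>c \<noteq> c0\<close> \<open>c0 = 0\<close> tdeg_eq_0_iff[OF M(4)] by simp
  qed
  from minimal_var[OF this] obtain i where i: "i < n" "Poly_Mapping.lookup c0 i \<noteq> 0"
    "\<And>m. m < n \<Longrightarrow> m \<noteq> i \<Longrightarrow>
      prec i m \<and> Poly_Mapping.lookup c m \<le> Poly_Mapping.lookup c0 m \<or>
      prec m i \<and> Poly_Mapping.lookup c0 m = 0"
    by auto
  define T where "T = (\<lambda>m. (int (Poly_Mapping.lookup c m) - int (Poly_Mapping.lookup c0 m)) *
      (int (height m) - int (height i)))"
  have T: "T m \<ge> 0" if "m < n" for m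
  proof (cases "m = i")
    case False
    then show ?thesis
      using i(3)[OF that False] height_less[of i m, OF _ that] height_less[of m i, OF _ i(1)]
      unfolding T_def by (auto simp: zero_le_mult_iff)
  qed (simp add: T_def)
  have diff: "int (rank c) - int (rank c0) = (\<Sum>m<n. T m)"
  proof -
    \<comment> \<open>The correction by \<open>height i\<close> is multiplied by the difference of
      the degrees, which is zero.\<close>
    have "(\<Sum>m<n. T m) = (int (rank c) - int (rank c0)) - int (height i) * (int (tdeg c) - int (tdeg c0))"
      unfolding rank_def T_def tdeg_int of_nat_sum sum_subtractf[symmetric] sum_distrib_left
      by (intro sum.cong refl) (simp add: algebra_simps)
    then show ?thesis using deg by simp
  qed
  have "(\<Sum>m<n. T m) \<noteq> 0"
  proof
    assume "(\<Sum>m<n. T m) = 0"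
    then have T0: "T m = 0" if "m < n" for m
      using sum_nonneg_eq_0_iff[of "{..<n}" T] T that by auto
    have ne: "Poly_Mapping.lookup c m = Poly_Mapping.lookup c0 m" if "m < n" "m \<noteq> i" for m
      using T0[OF that(1)] i(3)[OF that] height_less[of i m, OF _ that(1)] height_less[of m i, OF _ i(1)]
      unfolding T_def by auto
    have split: "tdeg a = Poly_Mapping.lookup a i + (\<Sum>m\<in>{..<n} - {i}. Poly_Mapping.lookup a m)" for a
      unfolding tdeg_def using i(1) by (intro sum.remove) auto
    have "(\<Sum>m\<in>{..<n} - {i}. Poly_Mapping.lookup c m) = (\<Sum>m\<in>{..<n} - {i}. Poly_Mapping.lookup c0 m)"
      using ne by (intro sum.cong) auto
    then have "Poly_Mapping.lookup c i = Poly_Mapping.lookup c0 i"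
      using split[of c] split[of c0] deg by simp
    then have "Poly_Mapping.lookup c m = Poly_Mapping.lookup c0 m" if "m < n" for m
      using ne[OF that] by (cases "m = i") auto
    moreover have "Poly_Mapping.lookup c m = Poly_Mapping.lookup c0 m" if "\<not> m < n" for m
      using Mon_lookup_0[OF M(4) that] Mon_lookup_0[OF M(2) that] by simp
    ultimately have "c = c0" by (intro poly_mapping_eqI) blast
    then show False using \<open>c \<noteq> c0\<close> by simp
  qed
  then have "(\<Sum>m<n. T m) > 0" using T sum_nonneg[of "{..<n}" T] by force
  then show ?thesis using diff by simp
qed

end

text \<open>A variable x_p of c is traded for the larger x_j. The weighted degree does not drop, so
  the result stays in the truncation, and the height drops strictly.\<close>

lemma exchange_var:
  assumes c: "c \<in> gens e" and j: "j \<in> larger_vars c"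
  obtains p c' where "p < n" "c' \<in> Mon" "c + var j = var p + c'" "e \<le> wdeg w c'" "rank c' < rank c"
proof -
  obtain p where p: "Poly_Mapping.lookup c p \<noteq> 0" "prec p j" "j < n"
    using j unfolding larger_vars_def by auto
  obtain c1 where c1: "c1 \<in> Mon" "c = var p + c1" "p < n"
    by (rule split_var[OF gens_Mon[OF c], of p]) (use p in \<open>auto simp: in_keys_iff\<close>)
  have rank_add: "rank (a + b) = rank a + rank b" for a b
    by (simp add: rank_def lookup_add algebra_simps sum.distrib)
  have rank_var: "rank (var i) = height i" if "i < n" for i
  proof -
    have "rank (var i) = (\<Sum>m<n. if i = m then height m else 0)"
      unfolding rank_def lookup_var by (intro sum.cong) auto
    then show ?thesis using that by simp
  qed
  show ?thesis
  proof (rule that[of p "c1 + var j"])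
    show "c + var j = var p + (c1 + var j)" unfolding c1(2) by (simp add: add.assoc)
    have "wdeg w c = w p + wdeg w c1" unfolding c1(2) using c1 by (subst wdeg_add) auto
    moreover have "wdeg w (c1 + var j) = wdeg w c1 + w j" using c1 p by (subst wdeg_add) auto
    moreover have "e \<le> wdeg w c" "w p \<le> w j" using c p by (auto simp: gens_def prec_def)
    ultimately show "e \<le> wdeg w (c1 + var j)" by simp
    have "rank c = height p + rank c1" unfolding c1(2) rank_add rank_var[OF c1(3)] ..
    then show "rank (c1 + var j) < rank c"
      using height_less[OF p(2,3)] rank_var[OF p(3)] by (simp add: rank_add)
  qed (use c1 p in simp_all)
qed

end

text \<open>Lexicographic numbering: the rank is the leading digit in base \<open>card A\<close>,
  and an arbitrary enumeration of A supplies the last digit and breaks the ties.\<close>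

lemma finite_rank_embedding:
  fixes \<rho> :: "'a \<Rightarrow> nat"
  assumes "finite A"
  shows "\<exists>\<iota> :: 'a \<Rightarrow> nat. inj_on \<iota> A \<and> (\<forall>a\<in>A. \<forall>b\<in>A. \<rho> a < \<rho> b \<longrightarrow> \<iota> a < \<iota> b)"
proof -
  obtain h where h: "bij_betw h A {0..<card A}" using ex_bij_betw_finite_nat[OF assms] by blast
  have hl: "h a < card A" if "a \<in> A" for a
    using bij_betwE[OF h] that by auto
  define \<iota> where "\<iota> = (\<lambda>a. \<rho> a * card A + h a)"
  have mono: "\<iota> a < \<iota> b" if "a \<in> A" "b \<in> A" "\<rho> a < \<rho> b" for a b
  proof -
    have "\<iota> a < Suc (\<rho> a) * card A" using hl[OF that(1)] by (simp add: \<iota>_def)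
    also have "\<dots> \<le> \<rho> b * card A" using that(3) by (intro mult_right_mono) auto
    also have "\<dots> \<le> \<iota> b" by (simp add: \<iota>_def)
    finally show ?thesis .
  qed
  moreover have "inj_on \<iota> A"
  proof (rule inj_onI)
    fix a b assume ab: "a \<in> A" "b \<in> A" "\<iota> a = \<iota> b"
    then have "\<rho> a = \<rho> b" using mono[of a b] mono[of b a]
      by (cases "\<rho> a" "\<rho> b" rule: linorder_cases) auto
    then have "h a = h b" using ab by (simp add: \<iota>_def)
    then show "a = b" using h ab by (auto simp: bij_betw_def inj_on_def)
  qed
  ultimately show ?thesis by blast
qed

section \<open>The associated graded module as a quotient of a Rees module\<close>

context weighted_variables
begin

abbreviation SS :: "'k::field mpoly ring" where "SS \<equiv> mpoly_ring n"
abbreviation mm :: "'k::field mpoly set" where "mm \<equiv> irrelevant_ideal n"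

definition gr_coset :: "int \<Rightarrow> nat \<Rightarrow> 'k::field mpoly \<Rightarrow> 'k mpoly set" where
  "gr_coset e d p = {q. q - p \<in> mspan (lev e (Suc d))}"

lemma gr_coset_self: "p \<in> gr_coset e d p"
  by (simp add: gr_coset_def)

lemma gr_coset_eq_iff: "gr_coset e d p = gr_coset e d q \<longleftrightarrow> p - q \<in> mspan (lev e (Suc d))"
proof
  assume "gr_coset e d p = gr_coset e d q"
  moreover have "p \<in> gr_coset e d p" by (simp add: gr_coset_def)
  ultimately show "p - q \<in> mspan (lev e (Suc d))" by (simp add: gr_coset_def)
next
  assume *: "p - q \<in> mspan (lev e (Suc d))"
  have "r - p \<in> mspan (lev e (Suc d)) \<longleftrightarrow> r - q \<in> mspan (lev e (Suc d))" for r
    using mspan_add[OF _ *, of "r - p"] mspan_diff[OF _ *, of "r - q"] by auto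
  then show "gr_coset e d p = gr_coset e d q" by (simp add: gr_coset_def)
qed

lemma r_coset_eq: "mspan (lev e (Suc d)) +>\<^bsub>trunc e\<^esub> p = gr_coset e d p"
proof -
  have "q \<in> gr_coset e d p \<longleftrightarrow> (\<exists>h\<in>mspan (lev e (Suc d)). q = h + p)" for q
    by (auto simp: gr_coset_def intro!: bexI[of _ "q - p"])
  then show ?thesis by (auto simp: a_r_coset_def r_coset_def)
qed

lemma r_coset_SS: "mspan (lev 0 (Suc d)) +>\<^bsub>SS\<^esub> p = gr_coset 0 d p"
  using r_coset_eq[of 0 d p] by (simp add: a_r_coset_def r_coset_def)

text \<open>The product of cosets as sets depends only on the operation of G, so its carrier is left
  open.\<close>

lemma gr_coset_set_mult:
  assumes G: "(\<otimes>\<^bsub>G\<^esub>) = (+)"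
  shows "gr_coset e d p <#>\<^bsub>G\<^esub> gr_coset e d q = gr_coset e d (p + q)"
proof (intro subset_antisym subsetI)
  fix r assume "r \<in> gr_coset e d p <#>\<^bsub>G\<^esub> gr_coset e d q"
  then obtain x y where "r = x + y" "x - p \<in> mspan (lev e (Suc d))" "y - q \<in> mspan (lev e (Suc d))"
    by (auto simp: gr_coset_def set_mult_def G)
  then show "r \<in> gr_coset e d (p + q)"
    using mspan_add[of "x - p" _ "y - q"] by (simp add: gr_coset_def algebra_simps)
next
  fix r assume "r \<in> gr_coset e d (p + q)"
  then have "r - q \<in> gr_coset e d p" "q \<in> gr_coset e d q" "r = (r - q) + q" by (auto simp: gr_coset_def algebra_simps)
  then show "r \<in> gr_coset e d p <#>\<^bsub>G\<^esub> gr_coset e d q" unfolding set_mult_def G by blast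
qed

abbreviation piece :: "int \<Rightarrow> nat \<Rightarrow> 'k::field mpoly set monoid" where
  "piece e d \<equiv> gr_piece SS mm (trunc e) d"

lemma piece_simps:
  "carrier (piece e d) = gr_coset e d ` mspan (lev e d)"
  "\<one>\<^bsub>piece e d\<^esub> = gr_coset e d 0"
  "gr_coset e d p \<otimes>\<^bsub>piece e d\<^esub> gr_coset e d q = gr_coset e d (p + q)"
proof -
  have "(mspan (lev e (Suc d)) :: 'a mpoly set) #>\<^bsub>add_monoid (trunc e\<lparr>carrier := mspan (lev e d)\<rparr>)\<^esub> p = gr_coset e d p" for p :: "'a mpoly"
    using r_coset_eq[of e d p] by (simp add: a_r_coset_def r_coset_def)
  then show "carrier (piece e d) = (gr_coset e d ` mspan (lev e d) :: 'a mpoly set set)"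
    by (auto simp: gr_piece_def ideal_filt_eq A_FactGroup_def FactGroup_def RCOSETS_def)
  show "\<one>\<^bsub>piece e d\<^esub> = (gr_coset e d 0 :: 'b mpoly set)"
    by (simp add: gr_piece_def ideal_filt_eq A_FactGroup_def FactGroup_def gr_coset_def)
  show "gr_coset e d p \<otimes>\<^bsub>piece e d\<^esub> gr_coset e d q = gr_coset e d (p + q)"
    by (simp add: gr_piece_def ideal_filt_eq A_FactGroup_def FactGroup_def gr_coset_set_mult)
qed

lemma comm_group_piece: "comm_group (piece e d :: 'k::field mpoly set monoid)"
proof (intro comm_groupI)
  fix x :: "'k mpoly set" assume "x \<in> carrier (piece e d)"
  then obtain p where p: "p \<in> mspan (lev e d)" "x = gr_coset e d p" by (auto simp: piece_simps)
  then show "\<exists>y\<in>carrier (piece e d). y \<otimes>\<^bsub>piece e d\<^esub> x = \<one>\<^bsub>piece e d\<^esub>"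
    by (intro bexI[of _ "gr_coset e d (- p)"]) (auto simp: piece_simps mspan_uminus)
qed (auto simp: piece_simps mspan_add add_ac)

lemma group_piece: "group (piece e d :: 'k::field mpoly set monoid)"
  using comm_group_piece comm_group.axioms(2) by blast

lemma finprod_piece:
  fixes f :: "'i \<Rightarrow> 'k::field mpoly"
  assumes "finite I" "\<And>i. i \<in> I \<Longrightarrow> f i \<in> mspan (lev e d)"
  shows "finprod (piece e d) (\<lambda>i. gr_coset e d (f i)) I = gr_coset e d (sum f I)"
proof -
  interpret G: comm_group "piece e d :: 'k mpoly set monoid" by (rule comm_group_piece)
  show ?thesis
    using assms
  proof (induction I rule: finite_induct)
    case empty
    then show ?case by (simp add: piece_simps)
  next
    case (insert i I)
    then show ?case by (subst G.finprod_insert) (auto simp: piece_simps)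
  qed
qed

text \<open>Writing the Rees module as polynomials in one more variable \<open>t\<close>, the Cauchy product becomes
  the multiplication of polynomials, so that the module axioms for the associated graded module are
  inherited from those of the polynomial ring.\<close>

definition Rees :: "int \<Rightarrow> 'k::field mpoly poly set" where
  "Rees e = {f. \<forall>d. coeff f d \<in> mspan (lev e d)}"

text \<open>The quotient map from the Rees module onto the associated graded module: the coefficient
  of t^d is read modulo the next step of the filtration.\<close>

definition gr_class :: "int \<Rightarrow> 'k::field mpoly poly \<Rightarrow> nat \<Rightarrow> 'k mpoly set" where
  "gr_class e f = (\<lambda>d. gr_coset e d (coeff f d))"

abbreviation NN :: "int \<Rightarrow> (nat \<Rightarrow> 'k::field mpoly set, nat \<Rightarrow> 'k mpoly set) module" where
  "NN e \<equiv> gr_module SS mm (trunc e)"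

abbreviation RR :: "(nat \<Rightarrow> 'k::field mpoly set) ring" where
  "RR \<equiv> gr_ring SS mm"

lemma ReesD: "f \<in> Rees e \<Longrightarrow> coeff f d \<in> mspan (lev e d)"
  by (simp add: Rees_def)

lemma Rees_zero [simp]: "0 \<in> Rees e" by (simp add: Rees_def)

lemma Rees_add: "f \<in> Rees e \<Longrightarrow> g \<in> Rees e \<Longrightarrow> f + g \<in> Rees e"
  by (simp add: Rees_def mspan_add)

lemma Rees_uminus: "f \<in> Rees e \<Longrightarrow> - f \<in> Rees e"
  by (simp add: Rees_def mspan_uminus)

lemma Rees_sum: "(\<And>i. i \<in> I \<Longrightarrow> f i \<in> Rees e) \<Longrightarrow> sum f I \<in> Rees e"
  by (simp add: Rees_def coeff_sum mspan_sum)

lemma Rees_monom: "p \<in> mspan (lev e d) \<Longrightarrow> monom p d \<in> Rees e"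
  by (simp add: Rees_def)

lemma Rees_one: "1 \<in> Rees 0"
  using one_in_mspan by (auto simp: Rees_def coeff_1 lev_0_0)

lemma Rees_mult:
  assumes "f \<in> Rees 0" "g \<in> Rees e"
  shows "f * g \<in> Rees e"
proof -
  have "coeff f i * coeff g (d - i) \<in> mspan (lev e d)" if "i \<le> d" for i d
    using mspan_lev_mult[OF ReesD[OF assms(1), of i] ReesD[OF assms(2), of "d - i"]] that by simp
  then show ?thesis by (auto simp: Rees_def coeff_mult intro!: mspan_sum)
qed

lemma gr_class_eq_iff: "gr_class e f = gr_class e g \<longleftrightarrow> (\<forall>d. coeff (f - g) d \<in> mspan (lev e (Suc d)))"
  by (simp add: gr_class_def fun_eq_iff gr_coset_eq_iff)

lemma carrier_NN: "carrier (NN e) = gr_class e ` Rees e"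
proof -
  have "carrier (NN e) = {x. (\<forall>d. x d \<in> gr_coset e d ` mspan (lev e d)) \<and> finite {d. x d \<noteq> gr_coset e d 0}}"
    by (auto simp: gr_module_def carrier_sum_group group_piece piece_simps)
  also have "\<dots> = gr_class e ` Rees e"
  proof (intro subset_antisym subsetI)
    fix x assume x: "x \<in> {x. (\<forall>d. x d \<in> gr_coset e d ` mspan (lev e d)) \<and> finite {d. x d \<noteq> gr_coset e d 0}}"
    then have "\<forall>d. \<exists>p. p \<in> mspan (lev e d) \<and> x d = gr_coset e d p" by blast
    then obtain p where "\<forall>d. p d \<in> mspan (lev e d) \<and> x d = gr_coset e d (p d)"
      using choice[of "\<lambda>d p. p \<in> mspan (lev e d) \<and> x d = gr_coset e d p"] by blast
    then have p: "\<And>d. p d \<in> mspan (lev e d)" "\<And>d. x d = gr_coset e d (p d)" by auto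
    \<comment> \<open>The chosen representative of a zero class need not be zero, so p may have
      infinite support. Keeping it only where the class is nonzero gives a polynomial.\<close>
    define D where "D = {d. x d \<noteq> gr_coset e d 0}"
    define f where "f = (\<Sum>d\<in>D. monom (p d) d)"
    have "finite D" using x by (simp add: D_def)
    then have cf: "coeff f d = (if d \<in> D then p d else 0)" for d
      by (simp add: f_def coeff_sum)
    have "f \<in> Rees e" using p by (simp add: Rees_def cf)
    moreover have "x d = gr_class e f d" for d
      unfolding gr_class_def cf using p(2)[of d] by (cases "d \<in> D") (simp, simp add: D_def)
    ultimately show "x \<in> gr_class e ` Rees e" by (intro image_eqI[of _ _ f]) auto
  next
    fix x assume "x \<in> gr_class e ` Rees e"
    then obtain f where f: "f \<in> Rees e" "x = gr_class e f" by blast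
    have "{d. x d \<noteq> gr_coset e d 0} \<subseteq> {d. coeff f d \<noteq> 0}" by (auto simp: f gr_class_def)
    moreover have "finite {d. coeff f d \<noteq> 0}" using MOST_coeff_eq_0[of f] by (simp add: eventually_cofinite)
    ultimately show "x \<in> {x. (\<forall>d. x d \<in> gr_coset e d ` mspan (lev e d)) \<and> finite {d. x d \<noteq> gr_coset e d 0}}"
      using f finite_subset by (auto simp: gr_class_def ReesD)
  qed
  finally show ?thesis .
qed

lemma gr_class_zero: "\<zero>\<^bsub>NN e\<^esub> = gr_class e 0"
  by (simp add: gr_module_def gr_class_def piece_simps restrict_def)

lemma gr_class_add: "gr_class e f \<oplus>\<^bsub>NN e\<^esub> gr_class e g = gr_class e (f + g)"
  by (simp add: gr_module_def gr_class_def piece_simps restrict_def)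

text \<open>Independence of representatives: a x - p q = a (x - q) + (a - p) q, where both summands
  lie one step deeper in the filtration. The union over all representatives is then a union of
  copies of one set.\<close>

lemma gr_piece_smult_gr_coset:
  assumes "p \<in> mspan (lev 0 i)" "q \<in> mspan (lev e j)"
  shows "gr_piece_smult SS mm (trunc e) i j (gr_coset 0 i p) (gr_coset e j q) = gr_coset e (i + j) (p * q)"
proof -
  have "gr_coset e (i + j) (a * x) = gr_coset e (i + j) (p * q)" if a: "a \<in> gr_coset 0 i p" and x: "x \<in> gr_coset e j q" for a x
  proof -
    have a': "a - p \<in> mspan (lev 0 (Suc i))" and x': "x - q \<in> mspan (lev e (Suc j))"
      using a x by (auto simp: gr_coset_def)
    have "a \<in> mspan (lev 0 i)"
      using mspan_add[OF mspan_mono[OF lev_Suc a'] assms(1)] by simp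
    then have "a * (x - q) \<in> mspan (lev e (Suc (i + j)))" using mspan_lev_mult[OF _ x'] by fastforce
    moreover have "(a - p) * q \<in> mspan (lev e (Suc (i + j)))"
      using mspan_lev_mult[OF a' assms(2)] by simp
    ultimately have "a * (x - q) + (a - p) * q \<in> mspan (lev e (Suc (i + j)))"
      by (rule mspan_add)
    then show ?thesis by (simp add: gr_coset_eq_iff algebra_simps)
  qed
  then have "(\<Union>a\<in>gr_coset 0 i p. \<Union>x\<in>gr_coset e j q. gr_coset e (i + j) (a * x))
      = (\<Union>a\<in>gr_coset 0 i p. \<Union>x\<in>gr_coset e j q. gr_coset e (i + j) (p * q))"
    by (intro SUP_cong refl)
  moreover have "gr_coset 0 i p \<noteq> {}" "gr_coset e j q \<noteq> {}" using gr_coset_self by blast+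
  ultimately show ?thesis
    by (simp add: gr_piece_smult_def ideal_filt_eq r_coset_eq)
qed

lemma gr_smult_gr_class:
  assumes f: "f \<in> Rees 0" and g: "g \<in> Rees e"
  shows "gr_smult SS mm (trunc e) (gr_class 0 f) (gr_class e g) = gr_class e (f * g)"
proof
  fix d
  interpret G: comm_group "piece e d :: 'a mpoly set monoid" by (rule comm_group_piece)
  have mem: "coeff f i * coeff g (d - i) \<in> mspan (lev e d)" if "i \<in> {..d}" for i
    using mspan_lev_mult[OF ReesD[OF f, of i] ReesD[OF g, of "d - i"]] that by simp
  have "gr_piece_smult SS mm (trunc e) i (d - i) (gr_class 0 f i) (gr_class e g (d - i))
      = gr_coset e d (coeff f i * coeff g (d - i))" if "i \<in> {..d}" for i
    using gr_piece_smult_gr_coset[OF ReesD[OF f] ReesD[OF g], of i "d - i"] that by (simp add: gr_class_def)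
  then have "gr_smult SS mm (trunc e) (gr_class 0 f) (gr_class e g) d
      = finprod (piece e d) (\<lambda>i. gr_coset e d (coeff f i * coeff g (d - i))) {..d}"
    unfolding gr_smult_def using mem by (intro G.finprod_cong') (auto simp: piece_simps)
  also have "\<dots> = gr_coset e d (\<Sum>i\<le>d. coeff f i * coeff g (d - i))"
    by (rule finprod_piece) (use mem in auto)
  finally show "gr_smult SS mm (trunc e) (gr_class 0 f) (gr_class e g) d = gr_class e (f * g) d"
    by (simp add: gr_class_def coeff_mult)
qed

lemma smult_NN: "f \<in> Rees 0 \<Longrightarrow> g \<in> Rees e \<Longrightarrow> gr_class 0 f \<odot>\<^bsub>NN e\<^esub> gr_class e g = gr_class e (f * g)"
  by (simp add: gr_module_def gr_smult_gr_class)

lemma RR_simps: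
  "carrier RR = gr_class 0 ` Rees 0"
  "\<zero>\<^bsub>RR\<^esub> = gr_class 0 0"
  "\<one>\<^bsub>RR\<^esub> = gr_class 0 1"
  "gr_class 0 f \<oplus>\<^bsub>RR\<^esub> gr_class 0 g = gr_class 0 (f + g)"
  "f \<in> Rees 0 \<Longrightarrow> g \<in> Rees 0 \<Longrightarrow> gr_class 0 f \<otimes>\<^bsub>RR\<^esub> gr_class 0 g = gr_class 0 (f * g)"
proof -
  show "carrier RR = (gr_class 0 ` Rees 0 :: (nat \<Rightarrow> 'a mpoly set) set)"
    by (simp add: gr_ring_def self_module_mpoly carrier_NN)
  show "\<zero>\<^bsub>RR\<^esub> = (gr_class 0 0 :: nat \<Rightarrow> 'b mpoly set)"
    by (simp add: gr_ring_def self_module_mpoly gr_class_zero)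
  show "\<one>\<^bsub>RR\<^esub> = (gr_class 0 1 :: nat \<Rightarrow> 'c mpoly set)"
    by (intro ext) (simp add: gr_ring_def self_module_mpoly ideal_filt_eq r_coset_SS gr_class_def coeff_1)
  show "gr_class 0 f \<oplus>\<^bsub>RR\<^esub> gr_class 0 g = gr_class 0 (f + g)"
    by (simp add: gr_ring_def self_module_mpoly gr_class_add)
  show "gr_class 0 f \<otimes>\<^bsub>RR\<^esub> gr_class 0 g = gr_class 0 (f * g)" if "f \<in> Rees 0" "g \<in> Rees 0"
    using gr_smult_gr_class[OF that] by (simp add: gr_ring_def self_module_mpoly)
qed

lemma cring_RR: "cring (RR :: (nat \<Rightarrow> 'k::field mpoly set) ring)"
proof (intro cringI abelian_groupI comm_monoidI)
  fix x :: "nat \<Rightarrow> 'k mpoly set" assume "x \<in> carrier RR"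
  then obtain f where "f \<in> Rees 0" "x = gr_class 0 f" by (auto simp: RR_simps)
  then show "\<exists>y\<in>carrier RR. y \<oplus>\<^bsub>RR\<^esub> x = \<zero>\<^bsub>RR\<^esub>"
    by (intro bexI[of _ "gr_class 0 (- f)"]) (auto simp: RR_simps Rees_uminus)
qed (auto simp: RR_simps Rees_add Rees_mult Rees_one algebra_simps)

lemma module_NN: "Module.module RR (NN e :: (nat \<Rightarrow> 'k::field mpoly set, nat \<Rightarrow> 'k mpoly set) module)"
proof (intro moduleI abelian_groupI)
  fix x :: "nat \<Rightarrow> 'k mpoly set" assume "x \<in> carrier (NN e)"
  then obtain f where "f \<in> Rees e" "x = gr_class e f" by (auto simp: carrier_NN)
  then show "\<exists>y\<in>carrier (NN e). y \<oplus>\<^bsub>NN e\<^esub> x = \<zero>\<^bsub>NN e\<^esub>"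
    by (intro bexI[of _ "gr_class e (- f)"]) (auto simp: carrier_NN gr_class_add gr_class_zero Rees_uminus)
qed (auto simp: cring_RR RR_simps carrier_NN smult_NN gr_class_add gr_class_zero Rees_add Rees_mult Rees_one algebra_simps)

section \<open>The grading of the associated graded module\<close>

abbreviation grade :: "int \<Rightarrow> int \<Rightarrow> (nat \<Rightarrow> 'k::field mpoly set) set" where
  "grade e \<equiv> gr_grading SS mm (trunc e)"

text \<open>A homogeneous element has trivial classes outside its degree, so the other coefficients
  of any representative may be replaced by zero.\<close>

lemma grade_iff:
  "x \<in> grade e d \<longleftrightarrow> (\<exists>f\<in>Rees e. x = gr_class e f \<and> (\<forall>i. int i \<noteq> d \<longrightarrow> coeff f i = 0))"
proof
  assume x: "x \<in> grade e d"
  then obtain f where f: "f \<in> Rees e" "x = gr_class e f" by (auto simp: gr_grading_def carrier_NN)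
  \<comment> \<open>The grading is indexed by integers; in negative degrees only the zero element is
    left.\<close>
  define g where "g = (if d \<ge> 0 then monom (coeff f (nat d)) (nat d) else 0)"
  have cg: "coeff g i = (if int i = d then coeff f i else 0)" for i
    by (auto simp: g_def)
  have "gr_coset e i (coeff f i) = gr_coset e i 0" if "int i \<noteq> d" for i
    using x that unfolding gr_grading_def f(2) gr_class_def by (auto simp: piece_simps)
  then have "x = gr_class e g" unfolding f(2) gr_class_def cg by (intro ext) simp
  moreover have "g \<in> Rees e" using f(1) by (simp add: Rees_def cg)
  ultimately show "\<exists>f\<in>Rees e. x = gr_class e f \<and> (\<forall>i. int i \<noteq> d \<longrightarrow> coeff f i = 0)"
    using cg by (intro bexI[of _ g]) auto
next
  assume "\<exists>f\<in>Rees e. x = gr_class e f \<and> (\<forall>i. int i \<noteq> d \<longrightarrow> coeff f i = 0)"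
  then show "x \<in> grade e d" by (auto simp: gr_grading_def carrier_NN piece_simps gr_class_def)
qed

lemma inv_NN:
  assumes "f \<in> Rees e" shows "inv\<^bsub>add_monoid (NN e)\<^esub> (gr_class e f) = gr_class e (- f)"
proof -
  interpret N: Module.module RR "NN e" by (rule module_NN)
  show ?thesis
    using N.add.inv_equality[of "gr_class e (- f)" "gr_class e f"] assms
    by (auto simp: a_inv_def carrier_NN gr_class_add gr_class_zero Rees_uminus)
qed

lemma subgroup_grade: "subgroup (grade e d) (add_monoid (NN e))"
proof
  show "grade e d \<subseteq> carrier (add_monoid (NN e))" by (auto simp: gr_grading_def)
  show "x \<otimes>\<^bsub>add_monoid (NN e)\<^esub> y \<in> grade e d" if xy: "x \<in> grade e d" "y \<in> grade e d" for x y
  proof -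
    obtain f g where "f \<in> Rees e" "x = gr_class e f" "\<forall>i. int i \<noteq> d \<longrightarrow> coeff f i = 0"
      "g \<in> Rees e" "y = gr_class e g" "\<forall>i. int i \<noteq> d \<longrightarrow> coeff g i = 0"
      using xy unfolding grade_iff by blast
    then show ?thesis unfolding grade_iff
      by (intro bexI[of _ "f + g"]) (auto simp: gr_class_add Rees_add)
  qed
  show "\<one>\<^bsub>add_monoid (NN e)\<^esub> \<in> grade e d"
    unfolding grade_iff by (intro bexI[of _ 0]) (auto simp: gr_class_zero)
  show "inv\<^bsub>add_monoid (NN e)\<^esub> x \<in> grade e d" if x: "x \<in> grade e d" for x
  proof -
    obtain f where "f \<in> Rees e" "x = gr_class e f" "\<forall>i. int i \<noteq> d \<longrightarrow> coeff f i = 0"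
      using x unfolding grade_iff by blast
    then show ?thesis unfolding grade_iff
      by (intro bexI[of _ "- f"]) (auto simp: inv_NN Rees_uminus)
  qed
qed

lemma subgroup_grade_RR:
  "subgroup (grade 0 d) (add_monoid (RR :: (nat \<Rightarrow> 'k::field mpoly set) ring))"
proof -
  have *: "carrier RR = carrier (NN 0 :: (nat \<Rightarrow> 'k mpoly set, nat \<Rightarrow> 'k mpoly set) module)"
    "add RR = add (NN 0 :: (nat \<Rightarrow> 'k mpoly set, nat \<Rightarrow> 'k mpoly set) module)"
    "zero RR = zero (NN 0 :: (nat \<Rightarrow> 'k mpoly set, nat \<Rightarrow> 'k mpoly set) module)"
    by (simp_all add: gr_ring_def self_module_mpoly)
  show ?thesis
    using subgroup_grade[of 0 d] by (simp add: subgroup_def m_inv_def *)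
qed

lemma grade_smult:
  assumes "x \<in> grade 0 i" "y \<in> grade e j"
  shows "x \<odot>\<^bsub>NN e\<^esub> y \<in> grade e (i + j)"
proof -
  obtain f g where fg: "f \<in> Rees 0" "x = gr_class 0 f" "\<And>l. int l \<noteq> i \<Longrightarrow> coeff f l = 0"
    "g \<in> Rees e" "y = gr_class e g" "\<And>l. int l \<noteq> j \<Longrightarrow> coeff g l = 0"
    using assms unfolding grade_iff by blast
  have "coeff (f * g) l = 0" if "int l \<noteq> i + j" for l
    unfolding coeff_mult
  proof (intro sum.neutral ballI)
    fix m assume "m \<in> {..l}"
    then show "coeff f m * coeff g (l - m) = 0"
      using fg(3)[of m] fg(6)[of "l - m"] that by (cases "int m = i") (auto simp: of_nat_diff)
  qed
  then show ?thesis
    unfolding grade_iff using fg by (intro bexI[of _ "f * g"]) (auto simp: smult_NN Rees_mult)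
qed

lemma mult_RR_eq_smult: "x \<otimes>\<^bsub>RR\<^esub> y = x \<odot>\<^bsub>NN 0\<^esub> y"
  by (simp add: gr_ring_def self_module_mpoly gr_module_def)

lemma finsum_NN:
  fixes f :: "'i \<Rightarrow> 'k::field mpoly poly"
  assumes "finite I" "\<And>i. i \<in> I \<Longrightarrow> f i \<in> Rees e"
  shows "finsum (NN e) (\<lambda>i. gr_class e (f i)) I = gr_class e (sum f I)"
proof -
  interpret N: Module.module RR "NN e :: (nat \<Rightarrow> 'k mpoly set, nat \<Rightarrow> 'k mpoly set) module"
    by (rule module_NN)
  show ?thesis using assms
  proof (induction I rule: finite_induct)
    case (insert i I)
    then show ?case by (subst N.finsum_insert) (auto simp: carrier_NN gr_class_add)
  qed (simp add: gr_class_zero)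
qed

lemma finsum_RR:
  fixes f :: "'i \<Rightarrow> 'k::field mpoly poly"
  assumes "finite I" "\<And>i. i \<in> I \<Longrightarrow> f i \<in> Rees 0"
  shows "finsum RR (\<lambda>i. gr_class 0 (f i)) I = gr_class 0 (sum f I)"
proof -
  interpret R: cring "RR :: (nat \<Rightarrow> 'k mpoly set) ring" by (rule cring_RR)
  show ?thesis using assms
  proof (induction I rule: finite_induct)
    case (insert i I)
    then show ?case by (subst R.finsum_insert) (auto simp: RR_simps)
  qed (simp add: RR_simps)
qed

section \<open>Ideals generated by variables\<close>

definition gr_var :: "nat \<Rightarrow> nat \<Rightarrow> 'k::field mpoly set" where
  "gr_var j = gr_class 0 (monom (mvar j) (Suc 0))"

text \<open>In the coefficient of t^d only monomials of degree exactly d survive in the associated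
  graded ring. The condition says that each of these is divisible by a variable of A, which
  describes the ideal of these variables by monomials.\<close>

definition leads_in :: "nat set \<Rightarrow> 'k::field mpoly poly \<Rightarrow> bool" where
  "leads_in A f \<longleftrightarrow> (\<forall>d b. tdeg b = d \<longrightarrow> Poly_Mapping.lookup (coeff f d) b \<noteq> 0 \<longrightarrow>
     (\<exists>j\<in>A. Poly_Mapping.lookup b j \<noteq> 0))"

definition varideal :: "nat set \<Rightarrow> (nat \<Rightarrow> 'k::field mpoly set) set" where
  "varideal A = {gr_class 0 f | f. f \<in> Rees 0 \<and> leads_in A f}"

lemma monom_mvar_Rees [simp]: "j < n \<Longrightarrow> monom (mvar j) (Suc 0) \<in> Rees 0"
  by (intro Rees_monom) (simp add: mvar_eq lev_zero)

lemma monom_single_Rees: "a \<in> lev e d \<Longrightarrow> monom (Poly_Mapping.single a c) d \<in> Rees e"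
  by (intro Rees_monom) simp

text \<open>Monomials of degree d do not occur in m^(d+1), so their coefficients are invariants of
  the class. This makes \<open>leads_in\<close> independent of the representative.\<close>

lemma lookup_lead_cong:
  assumes "gr_class 0 f = gr_class 0 g" "tdeg b = d"
  shows "Poly_Mapping.lookup (coeff f d) b = Poly_Mapping.lookup (coeff g d) b"
proof -
  have "coeff f d - coeff g d \<in> mspan (lev 0 (Suc d))"
    using assms(1) by (simp add: gr_class_eq_iff)
  moreover have "b \<notin> lev 0 (Suc d)" using assms(2) by (simp add: lev_zero)
  ultimately have "Poly_Mapping.lookup (coeff f d - coeff g d) b = 0" using mspanD by blast
  then show ?thesis by (simp add: lookup_minus)
qed

lemma varideal_iff: "f \<in> Rees 0 \<Longrightarrow> gr_class 0 f \<in> varideal A \<longleftrightarrow> leads_in A f"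
proof -
  have "leads_in A f" if "gr_class 0 g = gr_class 0 f" "leads_in A g" for g
    using that(2) lookup_lead_cong[OF that(1)] unfolding leads_in_def by simp
  then show "f \<in> Rees 0 \<Longrightarrow> gr_class 0 f \<in> varideal A \<longleftrightarrow> leads_in A f"
    unfolding varideal_def by force
qed

lemma gr_var_carrier: "j < n \<Longrightarrow> gr_var j \<in> carrier RR"
  by (auto simp: gr_var_def RR_simps)

lemma gr_class_monom_eq_zero: "a \<in> lev e (Suc d) \<Longrightarrow> gr_class e (monom (Poly_Mapping.single a c) d) = gr_class e 0"
  by (simp add: gr_class_eq_iff)

text \<open>The single terms to be checked are restricted to the support of f, so that properties of
  this support are available in the induction.\<close>

lemma gr_class_induct:
  fixes f :: "'k::field mpoly poly"
  assumes zero: "gr_class e 0 \<in> K"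
    and add: "\<And>g h. gr_class e g \<in> K \<Longrightarrow> gr_class e h \<in> K \<Longrightarrow> gr_class e (g + h) \<in> K"
    and single: "\<And>d a c. Poly_Mapping.lookup (coeff f d) a \<noteq> 0 \<Longrightarrow>
      gr_class e (monom (Poly_Mapping.single a c) d) \<in> K"
  shows "gr_class e f \<in> K"
proof -
  have mono: "gr_class e (monom p d) \<in> K" if "p \<in> mspan (Poly_Mapping.keys (coeff f d))" for p d
    using that
  proof (rule mspan_induct)
    show "gr_class e (monom (p + q) d) \<in> K" if "gr_class e (monom p d) \<in> K" "gr_class e (monom q d) \<in> K" for p q
      using add[OF that] by (simp add: add_monom)
  qed (use zero single in \<open>auto simp: in_keys_iff\<close>)
  have "gr_class e (\<Sum>d\<in>D. monom (coeff f d) d) \<in> K" if "finite D" for D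
    using that
  proof (induction D rule: finite_induct)
    case (insert d D)
    have "gr_class e (monom (coeff f d) d) \<in> K" by (rule mono) (simp add: mspan_def)
    then show ?case using insert add by simp
  qed (simp add: zero)
  from this[of "{..degree f}"] show ?thesis by (simp add: poly_as_sum_of_monoms)
qed

lemma lookup_mult_monom_mvar:
  "Poly_Mapping.lookup (coeff (f * monom (mvar j) (Suc 0)) (Suc d)) (b + var j)
    = Poly_Mapping.lookup (coeff f d) b"
  unfolding mult.commute[of f] mvar_eq coeff_monom_mult
  by (simp add: mult.commute[of "Poly_Mapping.single _ _"] lookup_single_times)

lemma lookup_mult_monom_mvar_nonzero:
  assumes "Poly_Mapping.lookup (coeff (f * monom (mvar j) (Suc 0)) d) b \<noteq> 0"
  shows "\<exists>b'. b = b' + var j"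
proof (rule ccontr)
  assume "\<not> ?thesis"
  \<comment> \<open>The truncated d - 1 is harmless: for d = 0 the coefficient of the product is
    zero.\<close>
  then have "Poly_Mapping.lookup (coeff f (d - 1) * Poly_Mapping.single (var j) 1) b = 0"
    by (intro lookup_single_times_eq_0) auto
  then show False
    using assms unfolding mult.commute[of f] mvar_eq coeff_monom_mult
    by (simp add: mult.commute[of "Poly_Mapping.single _ _"] split: if_splits)
qed

lemma varideal_sum:
  fixes c :: "nat \<Rightarrow> nat \<Rightarrow> 'k::field mpoly set"
  assumes "A \<subseteq> {..<n}" "c \<in> A \<rightarrow> carrier RR"
  shows "(\<Oplus>\<^bsub>RR\<^esub>j\<in>A. c j \<otimes>\<^bsub>RR\<^esub> gr_var j) \<in> varideal A"
proof -
  interpret R: cring "RR :: (nat \<Rightarrow> 'k mpoly set) ring" by (rule cring_RR)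
  have "\<forall>j\<in>A. \<exists>f. f \<in> Rees 0 \<and> c j = gr_class 0 f"
    using assms(2) by (auto simp: RR_simps)
  then obtain f where "\<forall>j\<in>A. f j \<in> Rees 0 \<and> c j = gr_class 0 (f j)"
    using bchoice[of A "\<lambda>j f. f \<in> Rees 0 \<and> c j = gr_class 0 f"] by blast
  then have f: "\<And>j. j \<in> A \<Longrightarrow> f j \<in> Rees 0" "\<And>j. j \<in> A \<Longrightarrow> c j = gr_class 0 (f j)" by auto
  have fin: "finite A" using assms(1) finite_subset by blast
  define F where "F = (\<Sum>j\<in>A. f j * monom (mvar j) (Suc 0))"
  have mem: "f j * monom (mvar j) (Suc 0) \<in> Rees 0" if "j \<in> A" for j
    using f(1)[OF that] that assms(1) by (intro Rees_mult) auto
  have "(\<Oplus>\<^bsub>RR\<^esub>j\<in>A. c j \<otimes>\<^bsub>RR\<^esub> gr_var j) = (\<Oplus>\<^bsub>RR\<^esub>j\<in>A. gr_class 0 (f j * monom (mvar j) (Suc 0)))"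
  proof (intro R.finsum_cong' refl)
    show "c j \<otimes>\<^bsub>RR\<^esub> gr_var j = gr_class 0 (f j * monom (mvar j) (Suc 0))" if "j \<in> A" for j
      using f that assms(1) by (auto simp: gr_var_def RR_simps)
  qed (use mem in \<open>auto simp: RR_simps\<close>)
  also have "\<dots> = gr_class 0 F" unfolding F_def by (rule finsum_RR[OF fin mem])
  finally have eq: "(\<Oplus>\<^bsub>RR\<^esub>j\<in>A. c j \<otimes>\<^bsub>RR\<^esub> gr_var j) = gr_class 0 F" .
  have "leads_in A F"
    unfolding leads_in_def
  proof (intro allI impI)
    fix d b assume "Poly_Mapping.lookup (coeff F d) b \<noteq> 0"
    then have "(\<Sum>j\<in>A. Poly_Mapping.lookup (coeff (f j * monom (mvar j) (Suc 0)) d) b) \<noteq> 0"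
      unfolding F_def by (simp add: coeff_sum lookup_sum)
    then obtain j where "j \<in> A" "Poly_Mapping.lookup (coeff (f j * monom (mvar j) (Suc 0)) d) b \<noteq> 0"
      by (meson sum.not_neutral_contains_not_neutral)
    then show "\<exists>j\<in>A. Poly_Mapping.lookup b j \<noteq> 0"
      using lookup_mult_monom_mvar_nonzero by (fastforce simp: lookup_add lookup_var)
  qed
  moreover have "F \<in> Rees 0" unfolding F_def by (rule Rees_sum[OF mem])
  ultimately show ?thesis unfolding eq by (simp add: varideal_iff)
qed

text \<open>Each term of f either has too large a degree, and its class is zero, or contains a
  variable of A, which is split off. The subgroup D serves two purposes: it is the whole ring for
  arbitrary cofactors, and the part of degree 1 for linear cofactors of quadratic elements.\<close>

lemma varideal_repr_in:
  fixes f :: "'k::field mpoly poly" and D :: "(nat \<Rightarrow> 'k mpoly set) set"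
  assumes A: "A \<subseteq> {..<n}" and f: "f \<in> Rees 0" "leads_in A f"
    and D: "subgroup D (add_monoid RR)"
    and mem: "\<And>d b j c. Poly_Mapping.lookup (coeff f (Suc d)) (var j + b) \<noteq> 0 \<Longrightarrow> b \<in> Mon \<Longrightarrow>
      tdeg b = d \<Longrightarrow> gr_class 0 (monom (Poly_Mapping.single b c) d) \<in> D"
  shows "\<exists>c\<in>A \<rightarrow> D. gr_class 0 f = (\<Oplus>\<^bsub>RR\<^esub>j\<in>A. c j \<otimes>\<^bsub>RR\<^esub> gr_var j)"
proof -
  interpret R: cring "RR :: (nat \<Rightarrow> 'k mpoly set) ring" by (rule cring_RR)
  have DR: "D \<subseteq> carrier RR" using subgroup.subset[OF D] by simp
  have zD: "\<zero>\<^bsub>RR\<^esub> \<in> D" using subgroup.one_closed[OF D] by simp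
  have fin: "finite A" using A finite_subset by blast
  have xA: "(gr_var j :: nat \<Rightarrow> 'k mpoly set) \<in> carrier RR" if "j \<in> A" for j using that A gr_var_carrier by blast
  define K where "K = {x. \<exists>c\<in>A \<rightarrow> D. x = (\<Oplus>\<^bsub>RR\<^esub>j\<in>A. c j \<otimes>\<^bsub>RR\<^esub> gr_var j)}"
  have "gr_class 0 f \<in> K"
  proof (rule gr_class_induct)
    show zK: "gr_class 0 0 \<in> K"
      unfolding K_def
    proof (intro CollectI bexI[of _ "\<lambda>_. \<zero>\<^bsub>RR\<^esub>"])
      have "(\<Oplus>\<^bsub>RR\<^esub>j\<in>A. \<zero>\<^bsub>RR\<^esub> \<otimes>\<^bsub>RR\<^esub> gr_var j) = (\<zero>\<^bsub>RR\<^esub> :: nat \<Rightarrow> 'k mpoly set)"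
        by (rule R.add.finprod_one_eqI) (use xA in auto)
      then show "(gr_class 0 0 :: nat \<Rightarrow> 'k mpoly set) = (\<Oplus>\<^bsub>RR\<^esub>j\<in>A. \<zero>\<^bsub>RR\<^esub> \<otimes>\<^bsub>RR\<^esub> gr_var j)"
        unfolding RR_simps(2)[symmetric] by (rule sym)
    qed (use zD in auto)
    show "gr_class 0 (g + h) \<in> K" if gh: "gr_class 0 g \<in> K" "gr_class 0 h \<in> K" for g h
    proof -
      obtain c c' where c: "c \<in> A \<rightarrow> D" "gr_class 0 g = (\<Oplus>\<^bsub>RR\<^esub>j\<in>A. c j \<otimes>\<^bsub>RR\<^esub> gr_var j)"
        "c' \<in> A \<rightarrow> D" "gr_class 0 h = (\<Oplus>\<^bsub>RR\<^esub>j\<in>A. c' j \<otimes>\<^bsub>RR\<^esub> gr_var j)"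
        using gh unfolding K_def by blast
      have cR: "c j \<in> carrier RR" "c' j \<in> carrier RR" if "j \<in> A" for j
        using c DR that by auto
      have "gr_class 0 (g + h) = (\<Oplus>\<^bsub>RR\<^esub>j\<in>A. c j \<otimes>\<^bsub>RR\<^esub> gr_var j) \<oplus>\<^bsub>RR\<^esub> (\<Oplus>\<^bsub>RR\<^esub>j\<in>A. c' j \<otimes>\<^bsub>RR\<^esub> gr_var j)"
        using c by (simp add: RR_simps(4)[symmetric])
      also have "\<dots> = (\<Oplus>\<^bsub>RR\<^esub>j\<in>A. c j \<otimes>\<^bsub>RR\<^esub> gr_var j \<oplus>\<^bsub>RR\<^esub> c' j \<otimes>\<^bsub>RR\<^esub> gr_var j)"
        using cR xA by (intro R.finsum_addf[symmetric]) auto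
      also have "\<dots> = (\<Oplus>\<^bsub>RR\<^esub>j\<in>A. (c j \<oplus>\<^bsub>RR\<^esub> c' j) \<otimes>\<^bsub>RR\<^esub> gr_var j)"
        using cR xA by (intro R.finsum_cong') (auto simp: R.l_distr)
      finally show ?thesis
        unfolding K_def using c subgroup.m_closed[OF D]
        by (intro CollectI bexI[of _ "\<lambda>j. c j \<oplus>\<^bsub>RR\<^esub> c' j"]) auto
    qed
    fix d a and c :: 'k assume nz: "Poly_Mapping.lookup (coeff f d) a \<noteq> 0"
    then have a: "a \<in> lev 0 d" using ReesD[OF f(1), of d] mspanD by blast
    show "gr_class 0 (monom (Poly_Mapping.single a c) d) \<in> K"
    proof (cases "tdeg a = d")
      case False
      then have "a \<in> lev 0 (Suc d)" using a by (simp add: lev_zero)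
      from gr_class_monom_eq_zero[OF this, of c] show ?thesis using zK by (simp only:)
    next
      case True
      then obtain j where j: "j \<in> A" "j \<in> Poly_Mapping.keys a"
        using f(2) nz unfolding leads_in_def by (auto simp: in_keys_iff)
      have aM: "a \<in> Mon" using a lev_Mon by blast
      obtain b where b: "b \<in> Mon" "a = var j + b" "j < n" by (rule split_var[OF aM j(2)])
      define d' where "d' = tdeg b"
      have d: "d = Suc d'" using True b by (simp add: d'_def)
      define y where "y = gr_class 0 (monom (Poly_Mapping.single b c) d')"
      have nz': "Poly_Mapping.lookup (coeff f (Suc d')) (var j + b) \<noteq> 0"
        using nz unfolding b(2) d .
      have yD: "y \<in> D" unfolding y_def by (rule mem[OF nz' b(1)]) (simp add: d'_def)
      have yR: "y \<in> carrier RR" using yD DR by blast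
      have bl: "b \<in> lev 0 d'" using b by (simp add: lev_zero d'_def)
      have "gr_class 0 (monom (Poly_Mapping.single a c) d) = y \<otimes>\<^bsub>RR\<^esub> gr_var j"
      proof -
        have "y \<otimes>\<^bsub>RR\<^esub> gr_var j = gr_class 0 (monom (Poly_Mapping.single b c) d' * monom (mvar j) (Suc 0))"
          unfolding y_def gr_var_def using b(3)
          by (intro RR_simps(5) monom_single_Rees[OF bl] monom_mvar_Rees)
        then show ?thesis by (simp add: b(2) d mult_monom mvar_eq mult_single add.commute)
      qed
      also have "\<dots> = (\<Oplus>\<^bsub>RR\<^esub>i\<in>A. if j = i then y \<otimes>\<^bsub>RR\<^esub> gr_var i else \<zero>\<^bsub>RR\<^esub>)"
        using j(1) fin xA yR by (intro R.finsum_singleton[symmetric]) auto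
      also have "\<dots> = (\<Oplus>\<^bsub>RR\<^esub>i\<in>A. (if i = j then y else \<zero>\<^bsub>RR\<^esub>) \<otimes>\<^bsub>RR\<^esub> gr_var i)"
        using xA yR by (intro R.finsum_cong') auto
      finally show ?thesis
        unfolding K_def using yD zD
        by (intro CollectI bexI[of _ "\<lambda>i. if i = j then y else \<zero>\<^bsub>RR\<^esub>"]) auto
    qed
  qed
  then show ?thesis unfolding K_def by blast
qed

lemma linear_coefficient_ring_RR:
  "linear_coefficient_ring (RR :: (nat \<Rightarrow> 'k::field mpoly set) ring) (grade 0) n gr_var varideal"
proof -
  interpret R: cring "RR :: (nat \<Rightarrow> 'k mpoly set) ring" by (rule cring_RR)
  show ?thesis
  proof (intro linear_coefficient_ring.intro linear_coefficient_ring_axioms.intro R.cring_axioms)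
    show "subgroup (grade 0 d) (add_monoid (RR :: (nat \<Rightarrow> 'k mpoly set) ring))" for d
      by (rule subgroup_grade_RR)
    show "a \<otimes>\<^bsub>RR\<^esub> b \<in> grade 0 (i + j)" if "a \<in> grade 0 i" "b \<in> grade 0 j"
      for i j and a b :: "nat \<Rightarrow> 'k mpoly set"
      unfolding mult_RR_eq_smult using grade_smult[OF that] .
    show "gr_var j \<in> (grade 0 1 :: (nat \<Rightarrow> 'k mpoly set) set)" if "j < n" for j
      unfolding grade_iff gr_var_def using that by (intro bexI[of _ "monom (mvar j) (Suc 0)"]) auto
    show "(\<Oplus>\<^bsub>RR\<^esub>j\<in>A. c j \<otimes>\<^bsub>RR\<^esub> gr_var j) \<in> varideal A"
      if "A \<subseteq> {..<n}" "c \<in> A \<rightarrow> carrier RR" for A and c :: "nat \<Rightarrow> nat \<Rightarrow> 'k mpoly set"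
      by (rule varideal_sum[OF that])
    show "\<exists>c\<in>A \<rightarrow> carrier RR. r = (\<Oplus>\<^bsub>RR\<^esub>j\<in>A. c j \<otimes>\<^bsub>RR\<^esub> gr_var j)"
      if A: "A \<subseteq> {..<n}" and r: "r \<in> varideal A" for A and r :: "nat \<Rightarrow> 'k mpoly set"
    proof -
      obtain f where f: "r = gr_class 0 f" "f \<in> Rees 0" "leads_in A f" using r unfolding varideal_def by blast
      show ?thesis
        unfolding f(1)
      proof (rule varideal_repr_in[OF A f(2,3)])
        show "subgroup (carrier RR) (add_monoid (RR :: (nat \<Rightarrow> 'k mpoly set) ring))"
          using R.add.subgroup_self by simp
      qed (auto simp: RR_simps lev_zero intro!: imageI monom_single_Rees)
    qed
    show "\<exists>c\<in>A \<rightarrow> grade 0 1. r = (\<Oplus>\<^bsub>RR\<^esub>j\<in>A. c j \<otimes>\<^bsub>RR\<^esub> gr_var j)"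
      if A: "A \<subseteq> {..<n}" and r: "r \<in> varideal A" "r \<in> grade 0 2" for A and r :: "nat \<Rightarrow> 'k mpoly set"
    proof -
      obtain f where f: "f \<in> Rees 0" "r = gr_class 0 f" "\<forall>i. int i \<noteq> 2 \<longrightarrow> coeff f i = 0"
        using r(2) unfolding grade_iff by blast
      have lead: "leads_in A f" using r(1) unfolding f(2) varideal_iff[OF f(1)] .
      show ?thesis
        unfolding f(2)
      proof (rule varideal_repr_in[OF A f(1) lead subgroup_grade_RR])
        fix d b j and c :: 'k
        assume *: "Poly_Mapping.lookup (coeff f (Suc d)) (var j + b) \<noteq> 0" "b \<in> Mon" "tdeg b = d"
        \<comment> \<open>The representative is concentrated in degree 2, so splitting off one
          variable leaves degree 1.\<close>
        then have "d = 1" using f(3)[rule_format, of "Suc d"] by (cases "int (Suc d) = 2") auto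
        then show "gr_class 0 (monom (Poly_Mapping.single b c) d) \<in> grade 0 1"
          unfolding grade_iff using *
          by (intro bexI[of _ "monom (Poly_Mapping.single b c) d"] monom_single_Rees)
            (auto simp: lev_zero)
      qed
    qed
    show "r \<in> varideal A"
      if A: "A \<subseteq> {..<n}" and j: "j < n" "j \<notin> A" and r: "r \<in> carrier RR" "r \<otimes>\<^bsub>RR\<^esub> gr_var j \<in> varideal A"
      for A j and r :: "nat \<Rightarrow> 'k mpoly set"
    proof -
      obtain f where f: "f \<in> Rees 0" "r = gr_class 0 f" using r(1) by (auto simp: RR_simps)
      have "f * monom (mvar j) (Suc 0) \<in> Rees 0" using f(1) j(1) by (intro Rees_mult) auto
      moreover have "gr_class 0 (f * monom (mvar j) (Suc 0)) \<in> varideal A"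
        using r(2) f j(1) by (simp add: gr_var_def RR_simps)
      ultimately have lead: "leads_in A (f * monom (mvar j) (Suc 0))" by (simp add: varideal_iff)
      \<comment> \<open>Multiplication by x_j shifts exponents injectively, so no leading monomial
        is cancelled. A variable of A that divides b x_j differs from x_j and hence divides
        b.\<close>
      have "leads_in A f"
        unfolding leads_in_def
      proof (intro allI impI)
        fix d b assume b: "tdeg b = d" "Poly_Mapping.lookup (coeff f d) b \<noteq> 0"
        have deg: "tdeg (b + var j) = Suc d" unfolding tdeg_add tdeg_var[OF j(1)] b(1) by simp
        have "Poly_Mapping.lookup (coeff (f * monom (mvar j) (Suc 0)) (Suc d)) (b + var j) \<noteq> 0"
          unfolding lookup_mult_monom_mvar by (rule b(2))
        with lead deg have "\<exists>i\<in>A. Poly_Mapping.lookup (b + var j) i \<noteq> 0"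
          unfolding leads_in_def by blast
        then show "\<exists>i\<in>A. Poly_Mapping.lookup b i \<noteq> 0"
          using j(2) by (auto simp: lookup_add lookup_var split: if_splits)
      qed
      then show ?thesis unfolding f(2) varideal_iff[OF f(1)] .
    qed
  qed
qed

section \<open>The linear resolution\<close>

context
  fixes e :: int and \<iota> :: "(nat \<Rightarrow>\<^sub>0 nat) \<Rightarrow> nat"
  assumes inj: "inj_on \<iota> (gens e)"
    and mono: "\<And>a b. a \<in> gens e \<Longrightarrow> b \<in> gens e \<Longrightarrow> rank a < rank b \<Longrightarrow> \<iota> a < \<iota> b"
begin

abbreviation dec :: "nat \<Rightarrow> nat \<Rightarrow>\<^sub>0 nat" where
  "dec \<equiv> inv_into (gens e) \<iota>"

text \<open>The exponent 0 of t places every generator in degree 0, the part M/mM of the associated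
  graded module.\<close>

definition gen_poly :: "nat \<Rightarrow> 'k::field mpoly poly" where
  "gen_poly l = monom (Poly_Mapping.single (dec l) 1) 0"

definition gen_class :: "nat \<Rightarrow> nat \<Rightarrow> 'k::field mpoly set" where
  "gen_class l = gr_class e (gen_poly l)"

lemma dec_gens: "l \<in> \<iota> ` gens e \<Longrightarrow> dec l \<in> gens e"
  by (rule inv_into_into)

lemma dec_enc: "c \<in> gens e \<Longrightarrow> dec (\<iota> c) = c"
  using inj by (rule inv_into_f_f)

lemma enc_dec: "l \<in> \<iota> ` gens e \<Longrightarrow> \<iota> (dec l) = l"
  by (rule f_inv_into_f)

lemma gen_poly_Rees: "l \<in> \<iota> ` gens e \<Longrightarrow> gen_poly l \<in> Rees e"
  unfolding gen_poly_def by (intro monom_single_Rees gens_lev dec_gens)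

lemma gen_class_grade: "l \<in> \<iota> ` gens e \<Longrightarrow> gen_class l \<in> grade e 0"
  unfolding grade_iff gen_class_def
  by (intro bexI[of _ "gen_poly l"] gen_poly_Rees) (auto simp: gen_poly_def)

text \<open>Lifts combinations of classes to polynomials, where coefficients can be compared
  monomial by monomial.\<close>

lemma lincomb_gen_class:
  fixes F :: "nat \<Rightarrow> 'k::field mpoly poly"
  assumes F: "\<And>l. l \<in> \<iota> ` gens e \<Longrightarrow> F l \<in> Rees 0" "\<And>l. l \<in> \<iota> ` gens e \<Longrightarrow> h l = gr_class 0 (F l)"
  shows "(\<Oplus>\<^bsub>NN e\<^esub>l\<in>\<iota> ` gens e. h l \<odot>\<^bsub>NN e\<^esub> gen_class l)
    = gr_class e (\<Sum>l\<in>\<iota> ` gens e. F l * gen_poly l)"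
proof -
  interpret N: Module.module RR "NN e :: (nat \<Rightarrow> 'k mpoly set, nat \<Rightarrow> 'k mpoly set) module"
    by (rule module_NN)
  have mem: "F l * gen_poly l \<in> Rees e" if "l \<in> \<iota> ` gens e" for l
    using F(1)[OF that] gen_poly_Rees[OF that] by (rule Rees_mult)
  have "(\<Oplus>\<^bsub>NN e\<^esub>l\<in>\<iota> ` gens e. h l \<odot>\<^bsub>NN e\<^esub> gen_class l)
      = (\<Oplus>\<^bsub>NN e\<^esub>l\<in>\<iota> ` gens e. gr_class e (F l * gen_poly l))"
  proof (intro N.finsum_cong' refl)
    show "h l \<odot>\<^bsub>NN e\<^esub> gen_class l = gr_class e (F l * gen_poly l)" if "l \<in> \<iota> ` gens e" for l
      unfolding F(2)[OF that] gen_class_def by (rule smult_NN[OF F(1)[OF that] gen_poly_Rees[OF that]])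
  qed (use mem in \<open>auto simp: carrier_NN\<close>)
  also have "\<dots> = gr_class e (\<Sum>l\<in>\<iota> ` gens e. F l * gen_poly l)"
    by (rule finsum_NN) (use mem finite_gens in auto)
  finally show ?thesis .
qed

lemma coeff_mult_gen_poly: "coeff (f * gen_poly l) d = coeff f d * Poly_Mapping.single (dec l) 1"
  unfolding gen_poly_def mult.commute[of f] coeff_monom_mult
  by (simp only: not_less0 if_False diff_zero mult.commute[of _ "coeff f d"])

text \<open>Suppose some leading monomial b of \<open>F i\<close> avoids the larger variables of the
  generator c0. Then the monomial b + c0 has a nonzero class in degree d, and no other summand of
  the relation can contribute to it, so its coefficient could not vanish.\<close>

lemma relation_lead:
  fixes F :: "nat \<Rightarrow> 'k::field mpoly poly"
  assumes F: "\<And>l. l \<in> \<iota> ` gens e \<Longrightarrow> F l \<in> Rees 0" "\<And>l. l > i \<Longrightarrow> F l = 0"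
    and zero: "gr_class e (\<Sum>l\<in>\<iota> ` gens e. F l * gen_poly l) = gr_class e 0"
    and i: "i \<in> \<iota> ` gens e"
  shows "leads_in (larger_vars (dec i)) (F i)"
  unfolding leads_in_def
proof (intro allI impI, rule ccontr)
  let ?C = "\<iota> ` gens e"
  fix d b assume deg: "tdeg b = d" and nz: "Poly_Mapping.lookup (coeff (F i) d) b \<noteq> 0"
    and "\<not> (\<exists>j\<in>larger_vars (dec i). Poly_Mapping.lookup b j \<noteq> 0)"
  then have small: "Poly_Mapping.lookup b j = 0" if "j \<in> larger_vars (dec i)" for j
    using that by blast
  define c0 where "c0 = dec i"
  have c0: "c0 \<in> gens e" unfolding c0_def by (rule dec_gens[OF i])
  have bM: "b \<in> Mon" using mspanD[OF ReesD[OF F(1)[OF i]] nz] lev_Mon by blast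
  note small = small[folded c0_def]
  \<comment> \<open>Another splitting with one more variable in the first factor would leave a
    second factor of smaller degree, whose weight is too small.\<close>
  have not_lev: "b + c0 \<notin> lev e (Suc d)"
  proof
    assume "b + c0 \<in> lev e (Suc d)"
    then obtain b' c where bc: "b' \<in> Mon" "c \<in> Mon" "b + c0 = b' + c" "tdeg b' = Suc d" "e \<le> wdeg w c"
      unfolding lev_def by blast
    have "tdeg (b + c0) = tdeg (b' + c)" using bc(3) by simp
    then have "tdeg c < tdeg c0" using deg bc(4) by simp
    then have "wdeg w c < e"
      using smaller_divisor_weight[OF bM gens_Mon[OF c0] bc(1,2,3) small c0] by simp
    then show False using bc(5) by simp
  qed
  have "coeff (\<Sum>l\<in>?C. F l * gen_poly l) d \<in> mspan (lev e (Suc d))"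
    using zero unfolding gr_class_eq_iff by simp
  then have "Poly_Mapping.lookup (coeff (\<Sum>l\<in>?C. F l * gen_poly l) d) (b + c0) = 0"
    using not_lev by (auto dest: mspanD)
  moreover have "Poly_Mapping.lookup (coeff (\<Sum>l\<in>?C. F l * gen_poly l) d) (b + c0)
      = (\<Sum>l\<in>?C. Poly_Mapping.lookup (coeff (F l) d * Poly_Mapping.single (dec l) 1) (b + c0))"
    by (simp add: coeff_sum lookup_sum coeff_mult_gen_poly)
  \<comment> \<open>A second contribution b' + c must have b' of degree exactly d, as otherwise the
    monomial would lie deeper in the filtration. Then c and c0 have equal degree, c has larger rank
    and comes after c0, and its coefficient is zero.\<close>
  moreover have "\<dots> = (\<Sum>l\<in>{i}. Poly_Mapping.lookup (coeff (F l) d * Poly_Mapping.single (dec l) 1) (b + c0))"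
  proof (rule sum.mono_neutral_right)
    show "\<forall>l\<in>?C - {i}. Poly_Mapping.lookup (coeff (F l) d * Poly_Mapping.single (dec l) 1) (b + c0) = 0"
    proof (intro ballI, rule ccontr)
      fix l assume l: "l \<in> ?C - {i}"
        and nzl: "Poly_Mapping.lookup (coeff (F l) d * Poly_Mapping.single (dec l) 1) (b + c0) \<noteq> 0"
      define c where "c = dec l"
      have lC: "l \<in> ?C" and "l \<noteq> i" using l by auto
      have c: "c \<in> gens e" unfolding c_def by (rule dec_gens[OF lC])
      obtain b' where b': "b + c0 = b' + c"
        using lookup_single_times_eq_0[of "b + c0" "dec l" "coeff (F l) d"] nzl unfolding c_def by blast
      have nz': "Poly_Mapping.lookup (coeff (F l) d) b' \<noteq> 0"
        using nzl unfolding c_def[symmetric] b' lookup_single_times .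
      then have b'lev: "b' \<in> lev 0 d" using mspanD[OF ReesD[OF F(1)[OF lC]]] by blast
      then have b'M: "b' \<in> Mon" using lev_Mon by blast
      have "tdeg b' = d"
      proof (rule ccontr)
        assume "tdeg b' \<noteq> d"
        then have "b' \<in> lev 0 (Suc d)" using b'lev by (simp add: lev_zero)
        then have "b' + c \<in> lev e (Suc d + 0)" using gens_lev[OF c] by (rule lev_add)
        then show False using not_lev b' by simp
      qed
      moreover have "tdeg (b + c0) = tdeg (b' + c)" using b' by simp
      ultimately have "tdeg c = tdeg c0" using deg by simp
      moreover have "c \<noteq> c0" using enc_dec[OF lC] enc_dec[OF i] \<open>l \<noteq> i\<close> unfolding c_def c0_def by auto
      ultimately have "rank c0 < rank c"
        using equal_divisor_rank[OF bM gens_Mon[OF c0] b'M gens_Mon[OF c] b' small] by simp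
      then have "i < l" using mono[OF c0 c] enc_dec[OF lC] enc_dec[OF i] unfolding c_def c0_def by simp
      then show False using F(2) nz' by simp
    qed
  qed (use i finite_gens in auto)
  ultimately show False using nz by (simp add: c0_def[symmetric] lookup_single_times)
qed

text \<open>The exchange x_j c = x_p c' gives a binomial relation with the earlier generator c'. If
  c' is not a generator, the class of x_j c vanishes and x_j alone is the relation.\<close>

lemma linear_relation:
  assumes i: "i \<in> \<iota> ` gens e" and j: "j \<in> larger_vars (dec i)"
  shows "\<exists>F :: nat \<Rightarrow> 'k::field mpoly poly. (\<forall>l. F l \<in> Rees 0) \<and> (\<forall>l. gr_class 0 (F l) \<in> grade 0 1) \<and>
    (\<forall>l. l \<notin> \<iota> ` gens e \<longrightarrow> F l = 0) \<and> F i = monom (mvar j) (Suc 0) \<and> (\<forall>l>i. F l = 0) \<and>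
    gr_class e (\<Sum>l\<in>\<iota> ` gens e. F l * gen_poly l) = gr_class e 0"
proof -
  let ?C = "\<iota> ` gens e"
  define c where "c = dec i"
  have c: "c \<in> gens e" and ic: "\<iota> c = i" unfolding c_def using dec_gens[OF i] enc_dec[OF i] by auto
  have jn: "j < n" using j unfolding larger_vars_def by simp
  obtain p c' where p: "p < n" "c' \<in> Mon" "c + var j = var p + c'" "e \<le> wdeg w c'" "rank c' < rank c"
    by (rule exchange_var[OF c j[folded c_def]])
  have grade_mv: "gr_class 0 (monom (mvar q) (Suc 0)) \<in> grade 0 1" "gr_class 0 (- monom (mvar q) (Suc 0)) \<in> grade 0 1"
    if "q < n" for q
    unfolding grade_iff using that
    by (rule_tac bexI[of _ "monom (mvar q) (Suc 0)"], simp, simp,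
        rule_tac bexI[of _ "- monom (mvar q) (Suc 0)"], simp, simp add: Rees_uminus)
  have grade_0: "gr_class 0 0 \<in> grade 0 1"
    unfolding grade_iff by (intro bexI[of _ 0]) auto
  have prod_i: "monom (mvar j) (Suc 0) * gen_poly i = monom (Poly_Mapping.single (c + var j) 1) (Suc 0)"
    unfolding gen_poly_def c_def[symmetric] by (simp add: mult_monom mvar_eq mult_single add.commute)
  show ?thesis
  proof (cases "c' \<in> gens e")
    case True
    define i' where "i' = \<iota> c'"
    have i': "i' \<in> ?C" "dec i' = c'" "i' < i"
      unfolding i'_def using True dec_enc[OF True] mono[OF True c p(5)] ic by auto
    define F :: "nat \<Rightarrow> 'k mpoly poly" where
      "F = (\<lambda>l. if l = i then monom (mvar j) (Suc 0) else if l = i' then - monom (mvar p) (Suc 0) else 0)"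
    have "(\<Sum>l\<in>?C. F l * gen_poly l) = (\<Sum>l\<in>{i, i'}. F l * gen_poly l)"
      using finite_gens i i' by (intro sum.mono_neutral_right) (auto simp: F_def)
    also have "\<dots> = monom (mvar j) (Suc 0) * gen_poly i - monom (mvar p) (Suc 0) * gen_poly i'"
      using i'(3) by (simp add: F_def)
    also have "monom (mvar p) (Suc 0) * gen_poly i' = monom (Poly_Mapping.single (c + var j) 1) (Suc 0)"
      unfolding gen_poly_def i'(2) p(3) by (simp add: mult_monom mvar_eq mult_single)
    finally have "(\<Sum>l\<in>?C. F l * gen_poly l) = 0" unfolding prod_i by simp
    then show ?thesis
      using i i' jn p(1) grade_mv grade_0 by (intro exI[of _ F]) (auto simp: F_def Rees_uminus)
  next
    case False
    obtain q c'' where q: "q < n" "c'' \<in> Mon" "c' = var q + c''" "e \<le> wdeg w c''"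
      by (rule not_gens_split[OF p(2,4) False])
    \<comment> \<open>Two variables have been split off within the truncation, so the monomial lies
      in m^2 S_{\<ge>e} and its class in degree 1 is zero.\<close>
    have "(var p + var q) + c'' \<in> lev e (Suc (Suc 0))"
      using p q by (intro levI) auto
    then have lev2: "c + var j \<in> lev e (Suc (Suc 0))" unfolding p(3) q(3) by (simp add: add.assoc)
    define F :: "nat \<Rightarrow> 'k mpoly poly" where
      "F = (\<lambda>l. if l = i then monom (mvar j) (Suc 0) else 0)"
    have "(\<Sum>l\<in>?C. F l * gen_poly l) = (\<Sum>l\<in>{i}. F l * gen_poly l)"
      using finite_gens i by (intro sum.mono_neutral_right) (auto simp: F_def)
    also have "\<dots> = monom (Poly_Mapping.single (c + var j) 1) (Suc 0)"
      by (simp add: F_def prod_i)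
    finally have "gr_class e (\<Sum>l\<in>?C. F l * gen_poly l) = gr_class e 0"
      by (simp only: gr_class_monom_eq_zero[OF lev2])
    then show ?thesis
      using i jn grade_mv grade_0 by (intro exI[of _ F]) (auto simp: F_def)
  qed
qed

text \<open>A term in m^d S_{\<ge>e} is b c with b of degree d. If c is not a generator, one more
  variable can be split off and the class in degree d is zero.\<close>

lemma gen_class_spans:
  fixes f :: "'k::field mpoly poly"
  assumes f: "f \<in> Rees e"
  shows "\<exists>F :: nat \<Rightarrow> 'k mpoly poly. (\<forall>l. F l \<in> Rees 0) \<and> (\<forall>l. l \<notin> \<iota> ` gens e \<longrightarrow> F l = 0) \<and>
    gr_class e f = gr_class e (\<Sum>l\<in>\<iota> ` gens e. F l * gen_poly l)"
proof -
  let ?C = "\<iota> ` gens e"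
  define K where "K = {x. \<exists>F :: nat \<Rightarrow> 'k mpoly poly. (\<forall>l. F l \<in> Rees 0) \<and> (\<forall>l. l \<notin> ?C \<longrightarrow> F l = 0) \<and>
    x = gr_class e (\<Sum>l\<in>?C. F l * gen_poly l)}"
  have "gr_class e f \<in> K"
  proof (rule gr_class_induct)
    show zK: "gr_class e 0 \<in> K" unfolding K_def by (intro CollectI exI[of _ "\<lambda>_. 0"]) auto
    show "gr_class e (g + h) \<in> K" if gh: "gr_class e g \<in> K" "gr_class e h \<in> K" for g h
    proof -
      obtain F where F: "\<forall>l. F l \<in> Rees 0" "\<forall>l. l \<notin> ?C \<longrightarrow> F l = 0"
        "gr_class e g = gr_class e (\<Sum>l\<in>?C. F l * gen_poly l)"
        using gh(1) unfolding K_def by blast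
      obtain H where H: "\<forall>l. H l \<in> Rees 0" "\<forall>l. l \<notin> ?C \<longrightarrow> H l = 0"
        "gr_class e h = gr_class e (\<Sum>l\<in>?C. H l * gen_poly l)"
        using gh(2) unfolding K_def by blast
      have "gr_class e (g + h) = gr_class e (\<Sum>l\<in>?C. (F l + H l) * gen_poly l)"
        using F(3) H(3) by (simp add: gr_class_add[symmetric] distrib_right sum.distrib)
      then show ?thesis
        unfolding K_def using F(1,2) H(1,2)
        by (intro CollectI exI[of _ "\<lambda>l. F l + H l"]) (simp add: Rees_add)
    qed
    fix d a and x :: 'k assume "Poly_Mapping.lookup (coeff f d) a \<noteq> 0"
    then have "a \<in> lev e d" using ReesD[OF f] mspanD by blast
    then obtain b c where bc: "b \<in> Mon" "c \<in> Mon" "a = b + c" "tdeg b = d" "e \<le> wdeg w c"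
      unfolding lev_def by blast
    show "gr_class e (monom (Poly_Mapping.single a x) d) \<in> K"
    proof (cases "c \<in> gens e")
      case True
      have bl: "b \<in> lev 0 d" using bc by (simp add: lev_zero)
      define F :: "nat \<Rightarrow> 'k mpoly poly" where
        "F = (\<lambda>l. if l = \<iota> c then monom (Poly_Mapping.single b x) d else 0)"
      have "(\<Sum>l\<in>?C. F l * gen_poly l) = (\<Sum>l\<in>{\<iota> c}. F l * gen_poly l)"
        using finite_gens True by (intro sum.mono_neutral_right) (auto simp: F_def)
      also have "\<dots> = monom (Poly_Mapping.single a x) d"
        using bc(3) by (simp add: F_def gen_poly_def dec_enc[OF True] mult_monom mult_single)
      finally have "gr_class e (monom (Poly_Mapping.single a x) d) = gr_class e (\<Sum>l\<in>?C. F l * gen_poly l)" by simp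
      moreover have "\<forall>l. F l \<in> Rees 0" unfolding F_def using monom_single_Rees[OF bl] by simp
      moreover have "\<forall>l. l \<notin> ?C \<longrightarrow> F l = 0" using True by (auto simp: F_def)
      ultimately show ?thesis unfolding K_def by (intro CollectI exI[of _ F]) simp
    next
      case False
      obtain q c'' where q: "q < n" "c'' \<in> Mon" "c = var q + c''" "e \<le> wdeg w c''"
        by (rule not_gens_split[OF bc(2,5) False])
      have "(b + var q) + c'' \<in> lev e (Suc d)"
        using bc q by (intro levI) auto
      then have "a \<in> lev e (Suc d)" unfolding bc(3) q(3) by (simp add: add.assoc)
      then show ?thesis using zK by (simp only: gr_class_monom_eq_zero)
    qed
  qed
  then show ?thesis unfolding K_def by blast
qed

lemma has_linear_resolution_NN_aux:
  "has_linear_resolution RR (grade 0) (NN e :: (nat \<Rightarrow> 'k::field mpoly set, nat \<Rightarrow> 'k mpoly set) module) (grade e)"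
proof -
  interpret L: linear_coefficient_ring "RR :: (nat \<Rightarrow> 'k mpoly set) ring" "grade 0" n gr_var varideal
    by (rule linear_coefficient_ring_RR)
  let ?C = "\<iota> ` gens e"
  let ?g = "gen_class :: nat \<Rightarrow> nat \<Rightarrow> 'k mpoly set"
  have finC: "finite ?C" using finite_gens by simp
  have gN: "?g l \<in> carrier (NN e)" if "l \<in> ?C" for l
    using gen_poly_Rees[OF that] unfolding gen_class_def carrier_NN by (rule imageI)
  have coeffs: "(\<lambda>l. gr_class 0 (F l)) \<in> L.coeffs ?C"
    if "\<forall>l. F l \<in> Rees 0" "\<forall>l. l \<notin> ?C \<longrightarrow> F l = 0" for F :: "nat \<Rightarrow> 'k mpoly poly"
    unfolding L.coeffs_def using that by (auto simp: RR_simps)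
  \<comment> \<open>Zero classes are lifted to the zero polynomial, so that vanishing of the later
    coefficients of a relation becomes a literal equality of polynomials.\<close>
  have rep: "\<exists>F. (\<forall>l. F l \<in> Rees 0) \<and> (\<forall>l. h l = gr_class 0 (F l)) \<and> (\<forall>l. h l = \<zero>\<^bsub>RR\<^esub> \<longrightarrow> F l = 0)"
    if h: "h \<in> L.coeffs ?C" for h
  proof -
    have "\<exists>f. f \<in> Rees 0 \<and> h l = gr_class 0 f \<and> (h l = \<zero>\<^bsub>RR\<^esub> \<longrightarrow> f = 0)" for l
    proof (cases "h l = \<zero>\<^bsub>RR\<^esub>")
      case True
      then show ?thesis by (intro exI[of _ 0]) (simp add: RR_simps)
    next
      case False
      then show ?thesis using L.coeffsD[OF h, of l] unfolding RR_simps(1) by blast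
    qed
    then have "\<exists>F. \<forall>l. F l \<in> Rees 0 \<and> h l = gr_class 0 (F l) \<and> (h l = \<zero>\<^bsub>RR\<^esub> \<longrightarrow> F l = 0)"
      by (intro choice allI)
    then obtain F where F: "\<forall>l. F l \<in> Rees 0 \<and> h l = gr_class 0 (F l) \<and> (h l = \<zero>\<^bsub>RR\<^esub> \<longrightarrow> F l = 0)"
      by (elim exE)
    show ?thesis by (rule exI[of _ F]) (use F in blast)
  qed
  have lin: "L.linear_relations ?C (\<lambda>l. larger_vars (dec l))
      {h \<in> L.coeffs ?C. (\<Oplus>\<^bsub>NN e\<^esub>l\<in>?C. h l \<odot>\<^bsub>NN e\<^esub> ?g l) = \<zero>\<^bsub>NN e\<^esub>}"
  proof (rule L.kernel_linear_relations[OF module_NN gN finC])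
    show "larger_vars (dec i) \<subseteq> {..<n}" for i by (auto simp: larger_vars_def)
    show "h i \<in> varideal (larger_vars (dec i))"
      if h: "h \<in> L.coeffs ?C" "(\<Oplus>\<^bsub>NN e\<^esub>l\<in>?C. h l \<odot>\<^bsub>NN e\<^esub> ?g l) = \<zero>\<^bsub>NN e\<^esub>" "i \<in> ?C"
        "\<And>l. l > i \<Longrightarrow> h l = \<zero>\<^bsub>RR\<^esub>" for h i
    proof -
      obtain F where F: "\<forall>l. F l \<in> Rees 0" "\<forall>l. h l = gr_class 0 (F l)" "\<forall>l. h l = \<zero>\<^bsub>RR\<^esub> \<longrightarrow> F l = 0"
        using rep[OF h(1)] by blast
      have "gr_class e (\<Sum>l\<in>?C. F l * gen_poly l) = gr_class e 0"
        using lincomb_gen_class[of F h] F(1,2) h(2) by (simp add: gr_class_zero)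
      then have "leads_in (larger_vars (dec i)) (F i)"
        using F(1,3) h(4) by (intro relation_lead[OF _ _ _ h(3)]) auto
      then show ?thesis using F(1,2) by (simp add: varideal_iff)
    qed
    show "\<exists>h\<in>L.coeffs ?C. (\<Oplus>\<^bsub>NN e\<^esub>l\<in>?C. h l \<odot>\<^bsub>NN e\<^esub> ?g l) = \<zero>\<^bsub>NN e\<^esub> \<and>
        h i = gr_var j \<and> (\<forall>l>i. h l = \<zero>\<^bsub>RR\<^esub>) \<and> (\<forall>l. h l \<in> grade 0 1)"
      if ij: "i \<in> ?C" "j \<in> larger_vars (dec i)" for i j
    proof -
      obtain F :: "nat \<Rightarrow> 'k mpoly poly" where F: "\<forall>l. F l \<in> Rees 0" "\<forall>l. gr_class 0 (F l) \<in> grade 0 1"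
        "\<forall>l. l \<notin> ?C \<longrightarrow> F l = 0" "F i = monom (mvar j) (Suc 0)" "\<forall>l>i. F l = 0"
        "gr_class e (\<Sum>l\<in>?C. F l * gen_poly l) = gr_class e 0"
        using linear_relation[OF ij, where ?'k = 'k] by (elim exE conjE) (rule that)
      show ?thesis
      proof (intro bexI[of _ "\<lambda>l. gr_class 0 (F l)"] conjI)
        show "(\<Oplus>\<^bsub>NN e\<^esub>l\<in>?C. gr_class 0 (F l) \<odot>\<^bsub>NN e\<^esub> ?g l) = \<zero>\<^bsub>NN e\<^esub>"
          using lincomb_gen_class[of F "\<lambda>l. gr_class 0 (F l)"] F(1,6) by (simp add: gr_class_zero)
      qed (use F coeffs in \<open>auto simp: RR_simps gr_var_def\<close>)
    qed
  qed
  show ?thesis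
  proof (rule L.has_linear_resolutionI[OF module_NN subgroup_grade grade_smult gen_class_grade lin])
    show "\<exists>h\<in>L.coeffs ?C. y = (\<Oplus>\<^bsub>NN e\<^esub>l\<in>?C. h l \<odot>\<^bsub>NN e\<^esub> ?g l)" if y: "y \<in> carrier (NN e)" for y
    proof -
      obtain f where f: "f \<in> Rees e" "y = gr_class e f" using y unfolding carrier_NN by blast
      obtain F :: "nat \<Rightarrow> 'k mpoly poly" where F: "\<forall>l. F l \<in> Rees 0" "\<forall>l. l \<notin> ?C \<longrightarrow> F l = 0"
        "gr_class e f = gr_class e (\<Sum>l\<in>?C. F l * gen_poly l)"
        using gen_class_spans[OF f(1)] by (elim exE conjE) (rule that)
      show ?thesis
        unfolding f(2) F(3)
        using lincomb_gen_class[of F "\<lambda>l. gr_class 0 (F l)"] F(1) coeffs[OF F(1,2)]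
        by (intro bexI[of _ "\<lambda>l. gr_class 0 (F l)"]) auto
    qed
  qed
qed

end

lemma has_linear_resolution_NN:
  "has_linear_resolution RR (grade 0) (NN e :: (nat \<Rightarrow> 'k::field mpoly set, nat \<Rightarrow> 'k mpoly set) module) (grade e)"
proof -
  obtain \<iota> :: "(nat \<Rightarrow>\<^sub>0 nat) \<Rightarrow> nat" where \<iota>: "inj_on \<iota> (gens e)"
    "\<forall>a\<in>gens e. \<forall>b\<in>gens e. rank a < rank b \<longrightarrow> \<iota> a < \<iota> b"
    using finite_rank_embedding[OF finite_gens] by blast
  show ?thesis by (rule has_linear_resolution_NN_aux[OF \<iota>(1)]) (use \<iota>(2) in blast)
qed

section \<open>The grading of the truncation\<close>

lemma truncation_grading_eq:
  "truncation_grading (self_module SS) (wgrading n w) e i =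
    (mspan {a \<in> Mon. wdeg w a = i \<and> e \<le> i} :: 'k::field mpoly set)"
  by (auto simp: truncation_grading_def wgrading_eq self_module_mpoly mspan_def)

lemma graded_module_truncation:
  "graded_module SS (wgrading n w) (trunc e :: ('k::field mpoly, 'k mpoly) module)
    (\<lambda>i. mspan {a \<in> Mon. wdeg w a = i \<and> e \<le> i})"
  unfolding graded_module_def
proof (intro conjI allI ballI)
  let ?B = "\<lambda>i. {a \<in> Mon. wdeg w a = i \<and> e \<le> i}"
  show "Module.module SS (trunc e :: ('k mpoly, 'k mpoly) module)" by (rule module_trunc)
  have B_sub: "?B i \<subseteq> lev e 0" for i by (auto simp: lev_0)
  show "subgroup (mspan (?B i)) (add_monoid (trunc e :: ('k mpoly, 'k mpoly) module))" for i
    by (rule subgroup_mspan[OF B_sub])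
  show "a \<odot>\<^bsub>trunc e\<^esub> x \<in> mspan (?B (i + j))"
    if "a \<in> wgrading n w i" "x \<in> mspan (?B j)" for i j and a x :: "'k mpoly"
    using that unfolding wgrading_eq trunc_simps
  proof (rule mspan_mult)
    \<comment> \<open>Weighted degrees of monomials are nonnegative, so e \<le> j gives e \<le> i +
      j.\<close>
    show "b + c \<in> ?B (i + j)" if "b \<in> {a \<in> Mon. wdeg w a = i}" "c \<in> ?B j" for b c
      using that wdeg_nonneg[of b] by (auto simp: wdeg_add)
  qed
  fix x :: "'k mpoly" assume "x \<in> carrier (trunc e)"
  then have x: "x \<in> mspan (lev e 0)" by simp
  define f where "f = (\<lambda>d. \<Sum>a\<in>{a \<in> Poly_Mapping.keys x. wdeg w a = d}.
    Poly_Mapping.single a (Poly_Mapping.lookup x a))"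
  have lookup_f: "Poly_Mapping.lookup (f d) a = (if wdeg w a = d then Poly_Mapping.lookup x a else 0)" for d a
  proof -
    have "Poly_Mapping.lookup (f d) a = (\<Sum>b\<in>{b \<in> Poly_Mapping.keys x. wdeg w b = d}.
        if b = a then Poly_Mapping.lookup x a else 0)"
      unfolding f_def lookup_sum by (intro sum.cong) (auto simp: lookup_single when_def)
    then show ?thesis by (auto simp: in_keys_iff)
  qed
  have f_mem: "f i \<in> mspan (?B i)" for i
  proof (rule mspanI)
    fix a assume "Poly_Mapping.lookup (f i) a \<noteq> 0"
    then have "wdeg w a = i" "Poly_Mapping.lookup x a \<noteq> 0" by (auto simp: lookup_f split: if_splits)
    then show "a \<in> ?B i" using mspanD[OF x] by (auto simp: lev_0)
  qed
  have finsum_eq: "finsum (trunc e) g {i. g i \<noteq> \<zero>\<^bsub>trunc e\<^esub>} = sum g {i. g i \<noteq> 0}"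
    if "\<forall>i. g i \<in> mspan (?B i)" "finite {i. g i \<noteq> 0}" for g :: "int \<Rightarrow> 'k mpoly"
    unfolding trunc_simps using that mspan_mono[OF B_sub] by (intro finsum_trunc) auto
  show "\<exists>!f. (\<forall>i. f i \<in> mspan (?B i)) \<and> finite {i. f i \<noteq> \<zero>\<^bsub>trunc e\<^esub>} \<and>
      x = finsum (trunc e) f {i. f i \<noteq> \<zero>\<^bsub>trunc e\<^esub>}"
  proof (rule ex1I[of _ f])
    have "{i. f i \<noteq> 0} \<subseteq> wdeg w ` Poly_Mapping.keys x"
    proof
      fix i assume "i \<in> {i. f i \<noteq> 0}"
      then obtain a where "Poly_Mapping.lookup (f i) a \<noteq> 0" using poly_mapping_eqI[of "f i" 0] by auto
      then show "i \<in> wdeg w ` Poly_Mapping.keys x" by (auto simp: lookup_f in_keys_iff split: if_splits)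
    qed
    then have fin: "finite {i. f i \<noteq> 0}" by (rule finite_subset) simp
    have "sum f {i. f i \<noteq> 0} = sum f (wdeg w ` Poly_Mapping.keys x)"
      using \<open>{i. f i \<noteq> 0} \<subseteq> _\<close> by (intro sum.mono_neutral_left) auto
    also have "\<dots> = x" unfolding f_def by (subst sum.group) (auto simp: poly_mapping_sum_single)
    finally show "(\<forall>i. f i \<in> mspan (?B i)) \<and> finite {i. f i \<noteq> \<zero>\<^bsub>trunc e\<^esub>} \<and>
        x = finsum (trunc e) f {i. f i \<noteq> \<zero>\<^bsub>trunc e\<^esub>}"
      using f_mem fin finsum_eq[of f] by simp
  next
    fix g assume "(\<forall>i. g i \<in> mspan (?B i)) \<and> finite {i. g i \<noteq> \<zero>\<^bsub>trunc e\<^esub>} \<and>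
        x = finsum (trunc e) g {i. g i \<noteq> \<zero>\<^bsub>trunc e\<^esub>}"
    then have g: "\<forall>i. g i \<in> mspan (?B i)" "finite {i. g i \<noteq> 0}" "x = sum g {i. g i \<noteq> 0}"
      using finsum_eq[of g] by auto
    have g0: "Poly_Mapping.lookup (g i) a = 0" if "wdeg w a \<noteq> i" for i a
      using mspanD[OF g(1)[rule_format, of i], of a] that by auto
    have "Poly_Mapping.lookup (g i) a = Poly_Mapping.lookup (f i) a" for i a
    proof (cases "wdeg w a = i")
      case True
      have "Poly_Mapping.lookup x a = (\<Sum>m\<in>{m. g m \<noteq> 0}. Poly_Mapping.lookup (g m) a)"
        by (subst g(3)) (simp add: lookup_sum)
      \<comment> \<open>The part g i may be zero, so i is added to the index set before the sum is
        reduced to the only part that can contain a.\<close>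
      also have "\<dots> = (\<Sum>m\<in>insert i {m. g m \<noteq> 0}. Poly_Mapping.lookup (g m) a)"
        using g(2) by (intro sum.mono_neutral_left) auto
      also have "\<dots> = (\<Sum>m\<in>{i}. Poly_Mapping.lookup (g m) a)"
        using g(2) g0 True by (intro sum.mono_neutral_right) auto
      finally show ?thesis using True by (simp add: lookup_f)
    qed (simp add: g0 lookup_f)
    then show "g = f" by (intro ext poly_mapping_eqI)
  qed
qed

end

theorem theorem1:
  fixes n :: nat and w :: "nat \<Rightarrow> int" and e :: int
  defines "S \<equiv> self_module (mpoly_ring n :: 'k::field mpoly ring)"
  assumes "\<And>i. i < n \<Longrightarrow> w i > 0"
  shows "nonstandard_Koszul n w
           (truncation S (wgrading n w) e) (truncation_grading S (wgrading n w) e)"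
proof -
  interpret weighted_variables n w by unfold_locales (rule assms(2))
  have "graded_module (mpoly_ring n) (wgrading n w) (truncation S (wgrading n w) e)
      (truncation_grading S (wgrading n w) e)"
    using graded_module_truncation[of e] unfolding S_def truncation_eq truncation_grading_eq[abs_def] .
  then show ?thesis
    using has_linear_resolution_NN[of e]
    unfolding nonstandard_Koszul_def Let_def S_def truncation_eq
    by (simp add: self_module_mpoly)
qed

end
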